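(* Fix a logic $\mathcal{L}$. Let $\mathscr{E}$ be the class of morphisms $\epsilon$ in $\mathbf{FA}_{\mathcal{L}}$ such that $\epsilon^o$ is bijective on objects and full and every component of $\epsilon^p$ is surjective, and let $\mathscr{M}$ be the class of subprop-morphisms in $\mathbf{FA}_{\mathcal{L}}$. Let $F:(\mathcal{C},P)\to(\mathcal{D},Q)$ be a morphism in $\mathbf{FA}_{\mathcal{L}}$. Then: (1) $F=\psi\circ\epsilon$ for some $\epsilon\in\mathscr{E}$ and $\psi\in\mathscr{M}$. (2) If $K:(\mathcal{C},P)\to(\mathcal{E},R)$ is a morphism in $\mathbf{FA}_{\mathcal{L}}$ such that $K^o$ is full and surjective on objects and $K^p_c$ is surjective for each $c\in\mathrm{Ob}(\mathcal{C})$, then there exists a unique morphism $H:(\mathcal{E},R)\to(\mathcal{D},Q)$ with $H\circ K=F$ if and only if $\ker K\le\ker F$.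
   Context: Syntax and logics: a first-order language $\mathscr{L}$ has quantifier symbols $\mathscr{L}_q$ and connectives $\mathscr{L}_\omega$ with arities (designated $e\in\mathscr{L}_0$, $\otimes\in\mathscr{L}_2$); signatures with sorts, function and relation symbols; terms- and formulas-in-context; assertions are equations-in-context and sequents-in-context; theories are sets of assertions. A logic $\mathcal{L}$ assigns to each signature a closure operator $T\mapsto T_{\mathcal{L}}$ on theories (satisfying typed equational logic); $T\vdash_{\mathcal{L}}T'$ iff $A(T')\subseteq A(T_{\mathcal{L}})$. $\mathrm{Ob}(\mathbf{FA})$: prop-categories $(\mathcal{C},P)$ ($\mathcal{C}$ with designated finite products, $P:\mathcal{C}^{op}\to\mathbf{Pos}$) with $\mathscr{L}_\omega$-algebra structures on each $P(c)$ preserved by $P(f)$, elements $Eq_c\in P(c\times c)$, maps $\Omega_{b,c}:P(b\times c)\to P(b)$ natural in $b$, such that $(P(c),\otimes,e_c)$ is a monoid, $\Omega_{b,1}\circ P(\pi_1^{b,1})=\mathrm{id}$, $\Omega_{b,c\times d}\circ P(a_{b,c,d})=\Omega_{b,c}\circ\Omega_{b\times c,d}$, $Eq_1=e_{1\times1}$, $Eq_{c_1\times c_2}=P(\langle\pi_1^{c_1,c_2}\pi_1,\pi_1^{c_1,c_2}\pi_2\rangle)(Eq_{c_1})\otimes P(\langle\pi_2^{c_1,c_2}\pi_1,\pi_2^{c_1,c_2}\pi_2\rangle)(Eq_{c_2})$. Structures in $(\mathcal{C},P)$ interpret terms as morphisms and formulas as elements of $P$ in the standard way; a structure satisfies an equation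 if both sides agree and a sequent $\phi_1..\phi_n\vdash\phi$ if $\bigotimes[\![\phi_i]\!]\le[\![\phi]\!]$; $T\models_{(\mathcal{C},P)}T'$ iff every $T$-model in $(\mathcal{C},P)$ satisfies $T'$. $\mathrm{Ob}(\mathbf{FA}_{\mathcal{L}})$ is the class of $(\mathcal{C},P)\in\mathrm{Ob}(\mathbf{FA})$ such that $T\vdash_{\mathcal{L}}T'$ implies $T\models_{(\mathcal{C},P)}T'$; $\mathbf{FA}_{\mathcal{L}}$ is the full sub-2-category of $\mathbf{FA}$ on these objects. Morphisms $F:(\mathcal{C},P)\to(\mathcal{D},Q)$: finite-product-preserving $F^o$ and natural $F^p:P\Rightarrow QF^o$ with each $F^p_c$ an $\mathscr{L}_\omega$-homomorphism, $F^p_b\Omega_{b,c}=\Omega_{F^ob,F^oc}Q(a_{F,b,c}^{-1})F^p_{b\times c}$, $F^p_{c\times c}(Eq_c)=Q(a_{F,c,c})Eq_{F^oc}$ ($a_{F,b,c}$ canonical iso). Composition $(K\circ F)^o=K^oF^o$, $(K\circ F)^p_c=K^p_{F^oc}F^p_c$. A subprop-morphism is a morphism $\iota$ with $\iota^o$ faithful and every $\iota^p$-component an order embedding. Kernel: $\ker F$ consists of the relation on $\mathrm{Ob}(\mathcal{C})$: $c_1\sim c_2$ iff $F^oc_1=F^oc_2$; the relation on morphisms: $f_1\sim f_2$ iff $F^of_1=F^of_2$; and the relation on $\bigsqcup_cP(c)$: $r_1\prec r_2$ (with $r_i\in P(c_i)$) iff $F^p_{c_1}(r_1)\le F^p_{c_2}(r_2)$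 (in particular $F^oc_1=F^oc_2$). $\ker K\le\ker F$ means each relation of $\ker K$ is contained in the corresponding relation of $\ker F$. *)

theory Defs
  imports Main "HOL-Library.FuncSet"
begin

section \<open>Syntax\<close>

record ('q, 'k) lang =
  lquants :: "'q set"
  lconns :: "'k set"
  larity :: "'k \<Rightarrow> nat"
  lunit :: 'k
  ltensor :: 'k

definition language :: "('q, 'k) lang \<Rightarrow> bool" where
  "language \<L> \<longleftrightarrow>
     lunit \<L> \<in> lconns \<L> \<and> larity \<L> (lunit \<L>) = 0 \<and>
     ltensor \<L> \<in> lconns \<L> \<and> larity \<L> (ltensor \<L>) = 2"

record ('s, 'f, 'r) sig =
  sorts :: "'s set"
  funs :: "'f set"
  fdom :: "'f \<Rightarrow> 's list"
  fcod :: "'f \<Rightarrow> 's"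
  rels :: "'r set"
  rdom :: "'r \<Rightarrow> 's list"

definition signature :: "('s, 'f, 'r) sig \<Rightarrow> bool" where
  "signature \<Sigma> \<longleftrightarrow>
     (\<forall>f\<in>funs \<Sigma>. set (fdom \<Sigma> f) \<subseteq> sorts \<Sigma> \<and> fcod \<Sigma> f \<in> sorts \<Sigma>) \<and>
     (\<forall>R\<in>rels \<Sigma>. set (rdom \<Sigma> R) \<subseteq> sorts \<Sigma>)"

text \<open>
  Syntax is taken up to renaming of variables, by de Bruijn indices.  A context is the list of the
  sorts of its variables, the most recently declared variable first: \<open>Var 0\<close> is the head of the
  list, and \<open>\<sigma> # \<Gamma>\<close> is the extension of \<open>\<Gamma>\<close> by one variable of sort \<open>\<sigma>\<close>.
  \<open>EqF \<sigma> t u\<close> is the atomic formula stating the equality of two terms of sort \<open>\<sigma>\<close>, and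
  \<open>QuF q \<sigma> \<phi>\<close> binds variable \<open>0\<close>, of sort \<open>\<sigma>\<close>, in \<open>\<phi>\<close>.
\<close>

datatype 'f tm = Var nat | Fn 'f "'f tm list"

datatype ('s, 'f, 'r, 'q, 'k) fm =
    RelF 'r "'f tm list"
  | EqF 's "'f tm" "'f tm"
  | ConF 'k "('s, 'f, 'r, 'q, 'k) fm list"
  | QuF 'q 's "('s, 'f, 'r, 'q, 'k) fm"

definition context_of :: "('s, 'f, 'r) sig \<Rightarrow> 's list \<Rightarrow> bool" where
  "context_of \<Sigma> \<Gamma> \<longleftrightarrow> set \<Gamma> \<subseteq> sorts \<Sigma>"

inductive term_in :: "('s, 'f, 'r) sig \<Rightarrow> 's list \<Rightarrow> 'f tm \<Rightarrow> 's \<Rightarrow> bool"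
  for \<Sigma> \<Gamma> where
  "i < length \<Gamma> \<Longrightarrow> term_in \<Sigma> \<Gamma> (Var i) (\<Gamma> ! i)"
| "f \<in> funs \<Sigma> \<Longrightarrow> list_all2 (term_in \<Sigma> \<Gamma>) ts (fdom \<Sigma> f) \<Longrightarrow>
     term_in \<Sigma> \<Gamma> (Fn f ts) (fcod \<Sigma> f)"

inductive formula_in ::
  "('q, 'k) lang \<Rightarrow> ('s, 'f, 'r) sig \<Rightarrow> 's list \<Rightarrow> ('s, 'f, 'r, 'q, 'k) fm \<Rightarrow> bool"
  for \<L> \<Sigma> where
  "R \<in> rels \<Sigma> \<Longrightarrow> list_all2 (term_in \<Sigma> \<Gamma>) ts (rdom \<Sigma> R) \<Longrightarrow>
     formula_in \<L> \<Sigma> \<Gamma> (RelF R ts)"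
| "\<sigma> \<in> sorts \<Sigma> \<Longrightarrow> term_in \<Sigma> \<Gamma> t \<sigma> \<Longrightarrow> term_in \<Sigma> \<Gamma> u \<sigma> \<Longrightarrow>
     formula_in \<L> \<Sigma> \<Gamma> (EqF \<sigma> t u)"
| "k \<in> lconns \<L> \<Longrightarrow> length \<phi>s = larity \<L> k \<Longrightarrow> (\<forall>\<phi>\<in>set \<phi>s. formula_in \<L> \<Sigma> \<Gamma> \<phi>) \<Longrightarrow>
     formula_in \<L> \<Sigma> \<Gamma> (ConF k \<phi>s)"
| "q \<in> lquants \<L> \<Longrightarrow> \<sigma> \<in> sorts \<Sigma> \<Longrightarrow> formula_in \<L> \<Sigma> (\<sigma> # \<Gamma>) \<phi> \<Longrightarrow>
     formula_in \<L> \<Sigma> \<Gamma> (QuF q \<sigma> \<phi>)"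

datatype ('s, 'f, 'r, 'q, 'k) assertion =
    Equation "'s list" "'f tm" "'f tm" 's
  | Sequent "'s list" "('s, 'f, 'r, 'q, 'k) fm list" "('s, 'f, 'r, 'q, 'k) fm"

fun assertion_over ::
  "('q, 'k) lang \<Rightarrow> ('s, 'f, 'r) sig \<Rightarrow> ('s, 'f, 'r, 'q, 'k) assertion \<Rightarrow> bool" where
  "assertion_over \<L> \<Sigma> (Equation \<Gamma> t u \<sigma>) \<longleftrightarrow>
     context_of \<Sigma> \<Gamma> \<and> \<sigma> \<in> sorts \<Sigma> \<and> term_in \<Sigma> \<Gamma> t \<sigma> \<and> term_in \<Sigma> \<Gamma> u \<sigma>"
| "assertion_over \<L> \<Sigma> (Sequent \<Gamma> \<phi>s \<phi>) \<longleftrightarrow>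
     context_of \<Sigma> \<Gamma> \<and> (\<forall>\<psi>\<in>set \<phi>s. formula_in \<L> \<Sigma> \<Gamma> \<psi>) \<and> formula_in \<L> \<Sigma> \<Gamma> \<phi>"

definition theory_over ::
  "('q, 'k) lang \<Rightarrow> ('s, 'f, 'r) sig \<Rightarrow> ('s, 'f, 'r, 'q, 'k) assertion set \<Rightarrow> bool" where
  "theory_over \<L> \<Sigma> T \<longleftrightarrow> (\<forall>a\<in>T. assertion_over \<L> \<Sigma> a)"


section \<open>Logics\<close>

fun tm_subst :: "'f tm list \<Rightarrow> 'f tm \<Rightarrow> 'f tm" where
  "tm_subst ms (Var i) = ms ! i"
| "tm_subst ms (Fn f ts) = Fn f (map (tm_subst ms) ts)"

text \<open>
  Closure under the rules of typed equational logic.  The last rule is simultaneous substitution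
  of equals for equals; it includes congruence, weakening and renaming of variables.
\<close>

definition equational ::
  "('s, 'f, 'r) sig \<Rightarrow> ('s, 'f, 'r, 'q, 'k) assertion set \<Rightarrow> bool" where
  "equational \<Sigma> A \<longleftrightarrow>
     (\<forall>\<Gamma> t \<sigma>. context_of \<Sigma> \<Gamma> \<and> term_in \<Sigma> \<Gamma> t \<sigma> \<longrightarrow> Equation \<Gamma> t t \<sigma> \<in> A) \<and>
     (\<forall>\<Gamma> t u \<sigma>. Equation \<Gamma> t u \<sigma> \<in> A \<longrightarrow> Equation \<Gamma> u t \<sigma> \<in> A) \<and>
     (\<forall>\<Gamma> t u v \<sigma>. Equation \<Gamma> t u \<sigma> \<in> A \<and> Equation \<Gamma> u v \<sigma> \<in> A \<longrightarrow> Equation \<Gamma> t v \<sigma> \<in> A) \<and>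
     (\<forall>\<Gamma> \<Delta> t u \<tau> ms ns.
        context_of \<Sigma> \<Gamma> \<and> Equation \<Delta> t u \<tau> \<in> A \<and>
        length ms = length \<Delta> \<and> length ns = length \<Delta> \<and>
        (\<forall>i<length \<Delta>. Equation \<Gamma> (ms ! i) (ns ! i) (\<Delta> ! i) \<in> A) \<longrightarrow>
        Equation \<Gamma> (tm_subst ms t) (tm_subst ns u) \<tau> \<in> A)"

type_synonym ('s, 'f, 'r, 'q, 'k) logic =
  "('s, 'f, 'r) sig \<Rightarrow> ('s, 'f, 'r, 'q, 'k) assertion set \<Rightarrow> ('s, 'f, 'r, 'q, 'k) assertion set"

locale logic =
  fixes \<L> :: "('q, 'k) lang" and Lg :: "('s, 'f, 'r, 'q, 'k) logic"
  assumes language: "language \<L>"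
    and closed: "\<lbrakk>signature \<Sigma>; theory_over \<L> \<Sigma> T\<rbrakk> \<Longrightarrow> theory_over \<L> \<Sigma> (Lg \<Sigma> T)"
    and extensive: "\<lbrakk>signature \<Sigma>; theory_over \<L> \<Sigma> T\<rbrakk> \<Longrightarrow> T \<subseteq> Lg \<Sigma> T"
    and monotone: "\<lbrakk>signature \<Sigma>; theory_over \<L> \<Sigma> T; theory_over \<L> \<Sigma> T'; T \<subseteq> T'\<rbrakk>
        \<Longrightarrow> Lg \<Sigma> T \<subseteq> Lg \<Sigma> T'"
    and idempotent: "\<lbrakk>signature \<Sigma>; theory_over \<L> \<Sigma> T\<rbrakk> \<Longrightarrow> Lg \<Sigma> (Lg \<Sigma> T) = Lg \<Sigma> T"
    and equational: "\<lbrakk>signature \<Sigma>; theory_over \<L> \<Sigma> T\<rbrakk> \<Longrightarrow> equational \<Sigma> (Lg \<Sigma> T)"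

definition entails ::
  "('s, 'f, 'r, 'q, 'k) logic \<Rightarrow> ('s, 'f, 'r) sig
    \<Rightarrow> ('s, 'f, 'r, 'q, 'k) assertion set \<Rightarrow> ('s, 'f, 'r, 'q, 'k) assertion set \<Rightarrow> bool" where
  "entails Lg \<Sigma> T T' \<longleftrightarrow> T' \<subseteq> Lg \<Sigma> T"


section \<open>Categories with designated finite products\<close>

record ('o, 'm) fpcat =
  Ob :: "'o set"
  Ar :: "'m set"
  Dom :: "'m \<Rightarrow> 'o"
  Cod :: "'m \<Rightarrow> 'o"
  Id :: "'o \<Rightarrow> 'm"
  Comp :: "'m \<Rightarrow> 'm \<Rightarrow> 'm"  (infixr "\<odot>\<index>" 75)
  One :: 'o
  Prd :: "'o \<Rightarrow> 'o \<Rightarrow> 'o"  (infixl "\<otimes>\<index>" 80)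
  Pr1 :: "'o \<Rightarrow> 'o \<Rightarrow> 'm"
  Pr2 :: "'o \<Rightarrow> 'o \<Rightarrow> 'm"

definition hom :: "('o, 'm, 'z) fpcat_scheme \<Rightarrow> 'o \<Rightarrow> 'o \<Rightarrow> 'm set" where
  "hom C a b = {f \<in> Ar C. Dom C f = a \<and> Cod C f = b}"

definition is_terminal :: "('o, 'm, 'z) fpcat_scheme \<Rightarrow> 'o \<Rightarrow> bool" where
  "is_terminal C t \<longleftrightarrow> t \<in> Ob C \<and> (\<forall>x\<in>Ob C. \<exists>!h. h \<in> hom C x t)"

definition is_product ::
  "('o, 'm, 'z) fpcat_scheme \<Rightarrow> 'o \<Rightarrow> 'o \<Rightarrow> 'o \<Rightarrow> 'm \<Rightarrow> 'm \<Rightarrow> bool" where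
  "is_product C a b p p1 p2 \<longleftrightarrow>
     a \<in> Ob C \<and> b \<in> Ob C \<and> p \<in> Ob C \<and> p1 \<in> hom C p a \<and> p2 \<in> hom C p b \<and>
     (\<forall>x\<in>Ob C. \<forall>f\<in>hom C x a. \<forall>g\<in>hom C x b.
        \<exists>!h. h \<in> hom C x p \<and> Comp C p1 h = f \<and> Comp C p2 h = g)"

locale fp_category =
  fixes C :: "('o, 'm, 'z) fpcat_scheme" (structure)
  assumes Dom_Ob: "f \<in> Ar C \<Longrightarrow> Dom C f \<in> Ob C"
    and Cod_Ob: "f \<in> Ar C \<Longrightarrow> Cod C f \<in> Ob C"
    and Id_hom: "a \<in> Ob C \<Longrightarrow> Id C a \<in> hom C a a"
    and Comp_hom: "\<lbrakk>f \<in> hom C a b; g \<in> hom C b c\<rbrakk> \<Longrightarrow> g \<odot> f \<in> hom C a c"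
    and Id_right: "f \<in> hom C a b \<Longrightarrow> f \<odot> Id C a = f"
    and Id_left: "f \<in> hom C a b \<Longrightarrow> Id C b \<odot> f = f"
    and Comp_assoc: "\<lbrakk>f \<in> hom C a b; g \<in> hom C b c; h \<in> hom C c d\<rbrakk>
        \<Longrightarrow> (h \<odot> g) \<odot> f = h \<odot> (g \<odot> f)"
    and One_terminal: "is_terminal C (One C)"
    and Prd_product: "\<lbrakk>a \<in> Ob C; b \<in> Ob C\<rbrakk>
        \<Longrightarrow> is_product C a b (a \<otimes> b) (Pr1 C a b) (Pr2 C a b)"

definition bang :: "('o, 'm, 'z) fpcat_scheme \<Rightarrow> 'o \<Rightarrow> 'm" where
  "bang C x = (THE h. h \<in> hom C x (One C))"

definition pair :: "('o, 'm, 'z) fpcat_scheme \<Rightarrow> 'm \<Rightarrow> 'm \<Rightarrow> 'm"  ("\<langle>_,/ _\<rangle>\<index>") where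
  "pair C f g = (THE h. h \<in> hom C (Dom C f) (Prd C (Cod C f) (Cod C g)) \<and>
     Comp C (Pr1 C (Cod C f) (Cod C g)) h = f \<and> Comp C (Pr2 C (Cod C f) (Cod C g)) h = g)"

definition inverse_arrow :: "('o, 'm, 'z) fpcat_scheme \<Rightarrow> 'm \<Rightarrow> 'm" where
  "inverse_arrow C f = (THE g. g \<in> hom C (Cod C f) (Dom C f) \<and>
     Comp C g f = Id C (Dom C f) \<and> Comp C f g = Id C (Cod C f))"

text \<open>\<open>f \<times> id\<^sub>c\<close>\<close>

definition prd_id :: "('o, 'm, 'z) fpcat_scheme \<Rightarrow> 'm \<Rightarrow> 'o \<Rightarrow> 'm" where
  "prd_id C f c = pair C (Comp C f (Pr1 C (Dom C f) c)) (Pr2 C (Dom C f) c)"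

text \<open>The associativity isomorphism \<open>b \<times> (c \<times> d) \<rightarrow> (b \<times> c) \<times> d\<close>.\<close>

definition assoc_arrow :: "('o, 'm, 'z) fpcat_scheme \<Rightarrow> 'o \<Rightarrow> 'o \<Rightarrow> 'o \<Rightarrow> 'm" where
  "assoc_arrow C b c d =
     (let q1 = Pr1 C b (Prd C c d); q2 = Pr2 C b (Prd C c d)
      in pair C (pair C q1 (Comp C (Pr1 C c d) q2)) (Comp C (Pr2 C c d) q2))"


section \<open>The objects of \<open>FA\<close>\<close>

text \<open>
  \<open>Fib c\<close> with the relation \<open>Le c\<close> is the poset \<open>P(c)\<close>, and \<open>Reix f\<close> is \<open>P(f)\<close>.  A connective
  \<open>k\<close> acts on \<open>P(c)\<close> by \<open>Con k c\<close>, its arguments being passed as a list; a quantifier symbol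
  \<open>q\<close> gives the maps \<open>Qu q b c : P(b \<times> c) \<rightarrow> P(b)\<close>.
\<close>

record ('o, 'm, 'p, 'q, 'k) propcat = "('o, 'm) fpcat" +
  Fib :: "'o \<Rightarrow> 'p set"
  Le :: "'o \<Rightarrow> ('p \<times> 'p) set"
  Reix :: "'m \<Rightarrow> 'p \<Rightarrow> 'p"
  Con :: "'k \<Rightarrow> 'o \<Rightarrow> 'p list \<Rightarrow> 'p"
  Qu :: "'q \<Rightarrow> 'o \<Rightarrow> 'o \<Rightarrow> 'p \<Rightarrow> 'p"
  Equ :: "'o \<Rightarrow> 'p"

abbreviation unit_at :: "('q, 'k) lang \<Rightarrow> ('o, 'm, 'p, 'q, 'k) propcat \<Rightarrow> 'o \<Rightarrow> 'p" where
  "unit_at \<L> C c \<equiv> Con C (lunit \<L>) c []"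

abbreviation tensor_at ::
  "('q, 'k) lang \<Rightarrow> ('o, 'm, 'p, 'q, 'k) propcat \<Rightarrow> 'o \<Rightarrow> 'p \<Rightarrow> 'p \<Rightarrow> 'p" where
  "tensor_at \<L> C c x y \<equiv> Con C (ltensor \<L>) c [x, y]"

locale FA_object = fp_category C
  for \<L> :: "('q, 'k) lang" and C :: "('o, 'm, 'p, 'q, 'k) propcat" (structure) +
  assumes Le_poset: "c \<in> Ob C \<Longrightarrow> partial_order_on (Fib C c) (Le C c)"
    and Reix_Fib: "\<lbrakk>f \<in> hom C a b; r \<in> Fib C b\<rbrakk> \<Longrightarrow> Reix C f r \<in> Fib C a"
    and Reix_mono: "\<lbrakk>f \<in> hom C a b; (r, s) \<in> Le C b\<rbrakk> \<Longrightarrow> (Reix C f r, Reix C f s) \<in> Le C a"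
    and Reix_Id: "\<lbrakk>c \<in> Ob C; r \<in> Fib C c\<rbrakk> \<Longrightarrow> Reix C (Id C c) r = r"
    and Reix_Comp: "\<lbrakk>f \<in> hom C a b; g \<in> hom C b c; r \<in> Fib C c\<rbrakk>
        \<Longrightarrow> Reix C (g \<odot> f) r = Reix C f (Reix C g r)"
    and Con_Fib: "\<lbrakk>k \<in> lconns \<L>; c \<in> Ob C; length rs = larity \<L> k; set rs \<subseteq> Fib C c\<rbrakk>
        \<Longrightarrow> Con C k c rs \<in> Fib C c"
    and Reix_Con: "\<lbrakk>k \<in> lconns \<L>; f \<in> hom C a b; length rs = larity \<L> k; set rs \<subseteq> Fib C b\<rbrakk>
        \<Longrightarrow> Reix C f (Con C k b rs) = Con C k a (map (Reix C f) rs)"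
    and tensor_assoc: "\<lbrakk>c \<in> Ob C; x \<in> Fib C c; y \<in> Fib C c; z \<in> Fib C c\<rbrakk>
        \<Longrightarrow> tensor_at \<L> C c (tensor_at \<L> C c x y) z = tensor_at \<L> C c x (tensor_at \<L> C c y z)"
    and unit_left: "\<lbrakk>c \<in> Ob C; x \<in> Fib C c\<rbrakk> \<Longrightarrow> tensor_at \<L> C c (unit_at \<L> C c) x = x"
    and unit_right: "\<lbrakk>c \<in> Ob C; x \<in> Fib C c\<rbrakk> \<Longrightarrow> tensor_at \<L> C c x (unit_at \<L> C c) = x"
    and Qu_Fib: "\<lbrakk>q \<in> lquants \<L>; b \<in> Ob C; c \<in> Ob C; r \<in> Fib C (b \<otimes> c)\<rbrakk>
        \<Longrightarrow> Qu C q b c r \<in> Fib C b"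
    and Qu_natural: "\<lbrakk>q \<in> lquants \<L>; f \<in> hom C a b; c \<in> Ob C; r \<in> Fib C (b \<otimes> c)\<rbrakk>
        \<Longrightarrow> Reix C f (Qu C q b c r) = Qu C q a c (Reix C (prd_id C f c) r)"
    and Qu_One: "\<lbrakk>q \<in> lquants \<L>; b \<in> Ob C; r \<in> Fib C b\<rbrakk>
        \<Longrightarrow> Qu C q b (One C) (Reix C (Pr1 C b (One C)) r) = r"
    and Qu_Prd: "\<lbrakk>q \<in> lquants \<L>; b \<in> Ob C; c \<in> Ob C; d \<in> Ob C; r \<in> Fib C ((b \<otimes> c) \<otimes> d)\<rbrakk>
        \<Longrightarrow> Qu C q b (c \<otimes> d) (Reix C (assoc_arrow C b c d) r) = Qu C q b c (Qu C q (b \<otimes> c) d r)"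
    and Equ_Fib: "c \<in> Ob C \<Longrightarrow> Equ C c \<in> Fib C (c \<otimes> c)"
    and Equ_One: "Equ C (One C) = unit_at \<L> C (One C \<otimes> One C)"
    and Equ_Prd: "\<lbrakk>c1 \<in> Ob C; c2 \<in> Ob C\<rbrakk> \<Longrightarrow>
        Equ C (c1 \<otimes> c2) =
        tensor_at \<L> C ((c1 \<otimes> c2) \<otimes> (c1 \<otimes> c2))
          (Reix C \<langle>Pr1 C c1 c2 \<odot> Pr1 C (c1 \<otimes> c2) (c1 \<otimes> c2),
                   Pr1 C c1 c2 \<odot> Pr2 C (c1 \<otimes> c2) (c1 \<otimes> c2)\<rangle> (Equ C c1))
          (Reix C \<langle>Pr2 C c1 c2 \<odot> Pr1 C (c1 \<otimes> c2) (c1 \<otimes> c2),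
                   Pr2 C c1 c2 \<odot> Pr2 C (c1 \<otimes> c2) (c1 \<otimes> c2)\<rangle> (Equ C c2))"


section \<open>Structures and satisfaction\<close>

record ('s, 'f, 'r, 'o, 'm, 'p) struct =
  s_sort :: "'s \<Rightarrow> 'o"
  s_fun :: "'f \<Rightarrow> 'm"
  s_rel :: "'r \<Rightarrow> 'p"

text \<open>
  Lists of sorts (contexts as well as arities) are interpreted by iterated products, the head of
  the list being the rightmost factor: \<open>[\<sigma>\<^sub>1, \<dots>, \<sigma>\<^sub>n]\<close> becomes \<open>((1 \<times> \<sigma>\<^sub>n) \<times> \<dots>) \<times> \<sigma>\<^sub>1\<close>.
\<close>

fun sem_ctx ::
  "('o, 'm, 'p, 'q, 'k) propcat \<Rightarrow> ('s, 'f, 'r, 'o, 'm, 'p) struct \<Rightarrow> 's list \<Rightarrow> 'o" where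
  "sem_ctx C M [] = One C"
| "sem_ctx C M (\<sigma> # \<Gamma>) = Prd C (sem_ctx C M \<Gamma>) (s_sort M \<sigma>)"

definition structure_in ::
  "('s, 'f, 'r) sig \<Rightarrow> ('o, 'm, 'p, 'q, 'k) propcat \<Rightarrow> ('s, 'f, 'r, 'o, 'm, 'p) struct \<Rightarrow> bool" where
  "structure_in \<Sigma> C M \<longleftrightarrow>
     (\<forall>\<sigma>\<in>sorts \<Sigma>. s_sort M \<sigma> \<in> Ob C) \<and>
     (\<forall>f\<in>funs \<Sigma>. s_fun M f \<in> hom C (sem_ctx C M (fdom \<Sigma> f)) (s_sort M (fcod \<Sigma> f))) \<and>
     (\<forall>R\<in>rels \<Sigma>. s_rel M R \<in> Fib C (sem_ctx C M (rdom \<Sigma> R)))"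

fun sem_var ::
  "('o, 'm, 'p, 'q, 'k) propcat \<Rightarrow> ('s, 'f, 'r, 'o, 'm, 'p) struct \<Rightarrow> 's list \<Rightarrow> nat \<Rightarrow> 'm" where
  "sem_var C M [] i = undefined"
| "sem_var C M (\<sigma> # \<Gamma>) 0 = Pr2 C (sem_ctx C M \<Gamma>) (s_sort M \<sigma>)"
| "sem_var C M (\<sigma> # \<Gamma>) (Suc i) = Comp C (sem_var C M \<Gamma> i) (Pr1 C (sem_ctx C M \<Gamma>) (s_sort M \<sigma>))"

fun tuple :: "('o, 'm, 'z) fpcat_scheme \<Rightarrow> 'o \<Rightarrow> 'm list \<Rightarrow> 'm" where
  "tuple C x [] = bang C x"
| "tuple C x (f # fs) = pair C (tuple C x fs) f"

fun sem_tm ::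
  "('o, 'm, 'p, 'q, 'k) propcat \<Rightarrow> ('s, 'f, 'r, 'o, 'm, 'p) struct \<Rightarrow> 's list \<Rightarrow> 'f tm \<Rightarrow> 'm" where
  "sem_tm C M \<Gamma> (Var i) = sem_var C M \<Gamma> i"
| "sem_tm C M \<Gamma> (Fn f ts) = Comp C (s_fun M f) (tuple C (sem_ctx C M \<Gamma>) (map (sem_tm C M \<Gamma>) ts))"

fun sem_fm ::
  "('o, 'm, 'p, 'q, 'k) propcat \<Rightarrow> ('s, 'f, 'r, 'o, 'm, 'p) struct
    \<Rightarrow> 's list \<Rightarrow> ('s, 'f, 'r, 'q, 'k) fm \<Rightarrow> 'p" where
  "sem_fm C M \<Gamma> (RelF R ts) = Reix C (tuple C (sem_ctx C M \<Gamma>) (map (sem_tm C M \<Gamma>) ts)) (s_rel M R)"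
| "sem_fm C M \<Gamma> (EqF \<sigma> t u) = Reix C (pair C (sem_tm C M \<Gamma> t) (sem_tm C M \<Gamma> u)) (Equ C (s_sort M \<sigma>))"
| "sem_fm C M \<Gamma> (ConF k \<phi>s) = Con C k (sem_ctx C M \<Gamma>) (map (sem_fm C M \<Gamma>) \<phi>s)"
| "sem_fm C M \<Gamma> (QuF q \<sigma> \<phi>) = Qu C q (sem_ctx C M \<Gamma>) (s_sort M \<sigma>) (sem_fm C M (\<sigma> # \<Gamma>) \<phi>)"

fun satisfies ::
  "('q, 'k) lang \<Rightarrow> ('o, 'm, 'p, 'q, 'k) propcat \<Rightarrow> ('s, 'f, 'r, 'o, 'm, 'p) struct
    \<Rightarrow> ('s, 'f, 'r, 'q, 'k) assertion \<Rightarrow> bool" where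
  "satisfies \<L> C M (Equation \<Gamma> t u \<sigma>) \<longleftrightarrow> sem_tm C M \<Gamma> t = sem_tm C M \<Gamma> u"
| "satisfies \<L> C M (Sequent \<Gamma> \<phi>s \<phi>) \<longleftrightarrow>
     (let x = sem_ctx C M \<Gamma>
      in (foldr (tensor_at \<L> C x) (map (sem_fm C M \<Gamma>) \<phi>s) (unit_at \<L> C x), sem_fm C M \<Gamma> \<phi>)
           \<in> Le C x)"

definition model_of ::
  "('q, 'k) lang \<Rightarrow> ('s, 'f, 'r) sig \<Rightarrow> ('o, 'm, 'p, 'q, 'k) propcat
    \<Rightarrow> ('s, 'f, 'r, 'q, 'k) assertion set \<Rightarrow> ('s, 'f, 'r, 'o, 'm, 'p) struct \<Rightarrow> bool" where
  "model_of \<L> \<Sigma> C T M \<longleftrightarrow> structure_in \<Sigma> C M \<and> (\<forall>a\<in>T. satisfies \<L> C M a)"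

definition sem_entails ::
  "('q, 'k) lang \<Rightarrow> ('s, 'f, 'r) sig \<Rightarrow> ('o, 'm, 'p, 'q, 'k) propcat
    \<Rightarrow> ('s, 'f, 'r, 'q, 'k) assertion set \<Rightarrow> ('s, 'f, 'r, 'q, 'k) assertion set \<Rightarrow> bool" where
  "sem_entails \<L> \<Sigma> C T T' \<longleftrightarrow> (\<forall>M. model_of \<L> \<Sigma> C T M \<longrightarrow> (\<forall>a\<in>T'. satisfies \<L> C M a))"

definition FA_logic_object ::
  "('q, 'k) lang \<Rightarrow> ('s, 'f, 'r, 'q, 'k) logic \<Rightarrow> ('o, 'm, 'p, 'q, 'k) propcat \<Rightarrow> bool" where
  "FA_logic_object \<L> Lg C \<longleftrightarrow>
     FA_object \<L> C \<and>
     (\<forall>\<Sigma> T T'. signature \<Sigma> \<and> theory_over \<L> \<Sigma> T \<and> theory_over \<L> \<Sigma> T' \<and> entails Lg \<Sigma> T T'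
        \<longrightarrow> sem_entails \<L> \<Sigma> C T T')"


section \<open>Morphisms\<close>

record ('o1, 'm1, 'p1, 'o2, 'm2, 'p2) mor =
  mO :: "'o1 \<Rightarrow> 'o2"
  mM :: "'m1 \<Rightarrow> 'm2"
  mP :: "'o1 \<Rightarrow> 'p1 \<Rightarrow> 'p2"

text \<open>The canonical morphism \<open>F(b \<times> c) \<rightarrow> Fb \<times> Fc\<close>.\<close>

definition canon ::
  "('o1, 'm1, 'y) fpcat_scheme \<Rightarrow> ('o2, 'm2, 'z) fpcat_scheme
    \<Rightarrow> ('o1, 'm1, 'p1, 'o2, 'm2, 'p2) mor \<Rightarrow> 'o1 \<Rightarrow> 'o1 \<Rightarrow> 'm2" where
  "canon C D F b c = pair D (mM F (Pr1 C b c)) (mM F (Pr2 C b c))"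

text \<open>
  The components of a morphism are extensional functions on the carriers (as in
  \<open>\<rightarrow>\<^sub>E\<close>), so that equality of records is equality of morphisms.
\<close>

locale FA_morphism =
  fixes \<L> :: "('q, 'k) lang"
    and C :: "('o1, 'm1, 'p1, 'q, 'k) propcat" and D :: "('o2, 'm2, 'p2, 'q, 'k) propcat"
    and F :: "('o1, 'm1, 'p1, 'o2, 'm2, 'p2) mor"
  assumes mO_fun: "mO F \<in> Ob C \<rightarrow>\<^sub>E Ob D"
    and mM_fun: "mM F \<in> Ar C \<rightarrow>\<^sub>E Ar D"
    and mP_fun: "mP F \<in> (\<Pi>\<^sub>E c\<in>Ob C. Fib C c \<rightarrow>\<^sub>E Fib D (mO F c))"
    and mM_hom: "f \<in> hom C a b \<Longrightarrow> mM F f \<in> hom D (mO F a) (mO F b)"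
    and mM_Id: "a \<in> Ob C \<Longrightarrow> mM F (Id C a) = Id D (mO F a)"
    and mM_Comp: "\<lbrakk>f \<in> hom C a b; g \<in> hom C b c\<rbrakk>
        \<Longrightarrow> mM F (Comp C g f) = Comp D (mM F g) (mM F f)"
    and pres_terminal: "is_terminal C t \<Longrightarrow> is_terminal D (mO F t)"
    and pres_product: "is_product C a b p p1 p2
        \<Longrightarrow> is_product D (mO F a) (mO F b) (mO F p) (mM F p1) (mM F p2)"
    and mP_mono: "\<lbrakk>c \<in> Ob C; (r, s) \<in> Le C c\<rbrakk> \<Longrightarrow> (mP F c r, mP F c s) \<in> Le D (mO F c)"
    and mP_natural: "\<lbrakk>f \<in> hom C a b; r \<in> Fib C b\<rbrakk>
        \<Longrightarrow> mP F a (Reix C f r) = Reix D (mM F f) (mP F b r)"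
    and mP_Con: "\<lbrakk>k \<in> lconns \<L>; c \<in> Ob C; length rs = larity \<L> k; set rs \<subseteq> Fib C c\<rbrakk>
        \<Longrightarrow> mP F c (Con C k c rs) = Con D k (mO F c) (map (mP F c) rs)"
    and mP_Qu: "\<lbrakk>q \<in> lquants \<L>; b \<in> Ob C; c \<in> Ob C; r \<in> Fib C (Prd C b c)\<rbrakk>
        \<Longrightarrow> mP F b (Qu C q b c r) =
            Qu D q (mO F b) (mO F c)
              (Reix D (inverse_arrow D (canon C D F b c)) (mP F (Prd C b c) r))"
    and mP_Equ: "c \<in> Ob C
        \<Longrightarrow> mP F (Prd C c c) (Equ C c) = Reix D (canon C D F c c) (Equ D (mO F c))"

definition FA_logic_morphism ::
  "('q, 'k) lang \<Rightarrow> ('s, 'f, 'r, 'q, 'k) logic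
    \<Rightarrow> ('o1, 'm1, 'p1, 'q, 'k) propcat \<Rightarrow> ('o2, 'm2, 'p2, 'q, 'k) propcat
    \<Rightarrow> ('o1, 'm1, 'p1, 'o2, 'm2, 'p2) mor \<Rightarrow> bool" where
  "FA_logic_morphism \<L> Lg C D F \<longleftrightarrow>
     FA_logic_object \<L> Lg C \<and> FA_logic_object \<L> Lg D \<and> FA_morphism \<L> C D F"

text \<open>\<open>mor_comp C K F\<close> is \<open>K \<circ> F\<close>, where \<open>C\<close> is the source of \<open>F\<close>.\<close>

definition mor_comp ::
  "('o1, 'm1, 'p1, 'q, 'k) propcat \<Rightarrow> ('o2, 'm2, 'p2, 'o3, 'm3, 'p3) mor
    \<Rightarrow> ('o1, 'm1, 'p1, 'o2, 'm2, 'p2) mor \<Rightarrow> ('o1, 'm1, 'p1, 'o3, 'm3, 'p3) mor" where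
  "mor_comp C K F =
     \<lparr> mO = compose (Ob C) (mO K) (mO F),
       mM = compose (Ar C) (mM K) (mM F),
       mP = (\<lambda>c\<in>Ob C. compose (Fib C c) (mP K (mO F c)) (mP F c)) \<rparr>"

definition full_functor ::
  "('o1, 'm1, 'y) fpcat_scheme \<Rightarrow> ('o2, 'm2, 'z) fpcat_scheme
    \<Rightarrow> ('o1, 'm1, 'p1, 'o2, 'm2, 'p2) mor \<Rightarrow> bool" where
  "full_functor C D F \<longleftrightarrow>
     (\<forall>a\<in>Ob C. \<forall>b\<in>Ob C. mM F ` hom C a b = hom D (mO F a) (mO F b))"

definition faithful_functor ::
  "('o1, 'm1, 'y) fpcat_scheme \<Rightarrow> ('o1, 'm1, 'p1, 'o2, 'm2, 'p2) mor \<Rightarrow> bool" where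
  "faithful_functor C F \<longleftrightarrow> (\<forall>a\<in>Ob C. \<forall>b\<in>Ob C. inj_on (mM F) (hom C a b))"

definition pred_surjective ::
  "('o1, 'm1, 'p1, 'q, 'k) propcat \<Rightarrow> ('o2, 'm2, 'p2, 'q, 'k) propcat
    \<Rightarrow> ('o1, 'm1, 'p1, 'o2, 'm2, 'p2) mor \<Rightarrow> bool" where
  "pred_surjective C D F \<longleftrightarrow> (\<forall>c\<in>Ob C. mP F c ` Fib C c = Fib D (mO F c))"

definition pred_order_embedding ::
  "('o1, 'm1, 'p1, 'q, 'k) propcat \<Rightarrow> ('o2, 'm2, 'p2, 'q, 'k) propcat
    \<Rightarrow> ('o1, 'm1, 'p1, 'o2, 'm2, 'p2) mor \<Rightarrow> bool" where
  "pred_order_embedding C D F \<longleftrightarrow>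
     (\<forall>c\<in>Ob C. \<forall>r\<in>Fib C c. \<forall>s\<in>Fib C c.
        (mP F c r, mP F c s) \<in> Le D (mO F c) \<longleftrightarrow> (r, s) \<in> Le C c)"

definition class_E ::
  "('q, 'k) lang \<Rightarrow> ('s, 'f, 'r, 'q, 'k) logic
    \<Rightarrow> ('o1, 'm1, 'p1, 'q, 'k) propcat \<Rightarrow> ('o2, 'm2, 'p2, 'q, 'k) propcat
    \<Rightarrow> ('o1, 'm1, 'p1, 'o2, 'm2, 'p2) mor set" where
  "class_E \<L> Lg C D =
     {F. FA_logic_morphism \<L> Lg C D F \<and>
         bij_betw (mO F) (Ob C) (Ob D) \<and> full_functor C D F \<and> pred_surjective C D F}"

definition class_M ::
  "('q, 'k) lang \<Rightarrow> ('s, 'f, 'r, 'q, 'k) logic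
    \<Rightarrow> ('o1, 'm1, 'p1, 'q, 'k) propcat \<Rightarrow> ('o2, 'm2, 'p2, 'q, 'k) propcat
    \<Rightarrow> ('o1, 'm1, 'p1, 'o2, 'm2, 'p2) mor set" where
  "class_M \<L> Lg C D =
     {F. FA_logic_morphism \<L> Lg C D F \<and> faithful_functor C F \<and> pred_order_embedding C D F}"


section \<open>Kernels\<close>

text \<open>
  The disjoint union of the sets \<open>P(c)\<close> is \<open>Sigma (Ob C) (Fib C)\<close>.
\<close>

record ('o, 'm, 'p) ker =
  ker_ob :: "('o \<times> 'o) set"
  ker_ar :: "('m \<times> 'm) set"
  ker_pr :: "(('o \<times> 'p) \<times> ('o \<times> 'p)) set"

definition mor_kernel ::
  "('o1, 'm1, 'p1, 'q, 'k) propcat \<Rightarrow> ('o2, 'm2, 'p2, 'q, 'k) propcat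
    \<Rightarrow> ('o1, 'm1, 'p1, 'o2, 'm2, 'p2) mor \<Rightarrow> ('o1, 'm1, 'p1) ker" where
  "mor_kernel C D F =
     \<lparr> ker_ob = {(c1, c2). c1 \<in> Ob C \<and> c2 \<in> Ob C \<and> mO F c1 = mO F c2},
       ker_ar = {(f1, f2). f1 \<in> Ar C \<and> f2 \<in> Ar C \<and> mM F f1 = mM F f2},
       ker_pr = {((c1, r1), (c2, r2)).
                   (c1, r1) \<in> Sigma (Ob C) (Fib C) \<and> (c2, r2) \<in> Sigma (Ob C) (Fib C) \<and>
                   mO F c1 = mO F c2 \<and> (mP F c1 r1, mP F c2 r2) \<in> Le D (mO F c1)} \<rparr>"

definition kernel_le :: "('o, 'm, 'p) ker \<Rightarrow> ('o, 'm, 'p) ker \<Rightarrow> bool" where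
  "kernel_le k k' \<longleftrightarrow>
     ker_ob k \<subseteq> ker_ob k' \<and> ker_ar k \<subseteq> ker_ar k' \<and> ker_pr k \<subseteq> ker_pr k'"

end

theory Submission
  imports Defs
begin

text \<open>
  For a morphism \<open>K\<close> that is full, surjective on objects and surjective on predicates,
  everything in the target lifts along \<open>K\<close>; in particular composable arrows lift to
  composable arrows, even if \<open>K\<close> is not injective on objects. So an \<open>H\<close> with
  \<open>H \<circ> K = F\<close> is forced, and it is well defined by the inclusion of kernels, for
  predicates by antisymmetry. It preserves one product cone on each pair of objects, namely the image of a
  cone upstairs, hence all of them.

  For the factorization of \<open>F\<close>, arrows and predicates of the source are identified when
  \<open>F\<close> identifies them, and predicates are ordered as in the target. The quotient is realized
  on chosen representatives, so that it lives in the same types as the source. The second factor is the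
  morphism \<open>H\<close> for \<open>K\<close> the projection to this quotient. The quotient validates
  \<open>Lg\<close> because a subprop-morphism transports a structure to one whose interpretation agrees
  up to the canonical isomorphisms of contexts, and so both preserves and reflects satisfaction.
\<close>

section \<open>Finite products\<close>

text \<open>Designated products are preserved only up to isomorphism, so canonical isomorphisms
  enter every comparison of two interpretations or two morphisms, and much of the calculation shows
  that they match. Representatives are chosen inside a fixed hom-set or fibre: \<open>F\<close> need
  not be injective on objects, while the first factor has to be bijective on them, so arrows with
  the same image but different endpoints must stay distinct. Within a hom-set or a fibre,
  \<open>F\<close> is injective on representatives; hence a law of the quotient can be tested after
  applying \<open>F\<close>, where it is either a law of the target or the image of a law of the
  source. Validity of \<open>Lg\<close> in the quotient is inherited from the target and not from
  the source: a structure in the quotient may satisfy a theory only because of the identifications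
  made, so it need not come from a model in the source.\<close>

lemma homI: "f \<in> Ar C \<Longrightarrow> Dom C f = a \<Longrightarrow> Cod C f = b \<Longrightarrow> f \<in> hom C a b"
  by (simp add: hom_def)

lemma homD:
  assumes "f \<in> hom C a b"
  shows "f \<in> Ar C" "Dom C f = a" "Cod C f = b"
  using assms by (auto simp: hom_def)

context fp_category
begin

lemma hom_Ob:
  assumes "f \<in> hom C a b"
  shows "a \<in> Ob C" "b \<in> Ob C"
  using assms Dom_Ob Cod_Ob by (auto simp: hom_def)

lemma One_Ob: "One C \<in> Ob C"
  using One_terminal by (simp add: is_terminal_def)

lemma Prd_Ob: "a \<in> Ob C \<Longrightarrow> b \<in> Ob C \<Longrightarrow> a \<otimes> b \<in> Ob C"
  using Prd_product by (simp add: is_product_def)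

lemma Pr1_hom: "a \<in> Ob C \<Longrightarrow> b \<in> Ob C \<Longrightarrow> Pr1 C a b \<in> hom C (a \<otimes> b) a"
  using Prd_product by (simp add: is_product_def)

lemma Pr2_hom: "a \<in> Ob C \<Longrightarrow> b \<in> Ob C \<Longrightarrow> Pr2 C a b \<in> hom C (a \<otimes> b) b"
  using Prd_product by (simp add: is_product_def)

lemma terminal_eq:
  assumes "is_terminal C t" "f \<in> hom C x t" "g \<in> hom C x t"
  shows "f = g"
  using assms hom_Ob unfolding is_terminal_def by blast

lemma terminal_arrow:
  assumes "is_terminal C t" "x \<in> Ob C"
  obtains h where "h \<in> hom C x t"
  using assms unfolding is_terminal_def by blast

lemma bang_hom: "x \<in> Ob C \<Longrightarrow> bang C x \<in> hom C x (One C)"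
  using One_terminal unfolding bang_def is_terminal_def by (metis (no_types, lifting) theI')

lemma product_eq:
  assumes "is_product C a b p p1 p2" "h \<in> hom C x p" "k \<in> hom C x p"
    "p1 \<odot> h = p1 \<odot> k" "p2 \<odot> h = p2 \<odot> k"
  shows "h = k"
proof -
  have "x \<in> Ob C" using hom_Ob[OF assms(2)] by simp
  moreover have p: "p1 \<in> hom C p a" "p2 \<in> hom C p b" using assms(1) by (auto simp: is_product_def)
  moreover note Comp_hom[OF assms(3) p(1)] Comp_hom[OF assms(3) p(2)]
  ultimately have "\<exists>!h. h \<in> hom C x p \<and> p1 \<odot> h = p1 \<odot> k \<and> p2 \<odot> h = p2 \<odot> k"
    using assms(1) unfolding is_product_def by blast
  then show ?thesis using assms by blast
qed

lemma product_arrow: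
  assumes "is_product C a b p p1 p2" "f \<in> hom C x a" "g \<in> hom C x b"
  obtains h where "h \<in> hom C x p" "p1 \<odot> h = f" "p2 \<odot> h = g"
proof -
  have "x \<in> Ob C" using hom_Ob[OF assms(2)] by simp
  then have "\<exists>!h. h \<in> hom C x p \<and> p1 \<odot> h = f \<and> p2 \<odot> h = g"
    using assms unfolding is_product_def by blast
  then show ?thesis using that by blast
qed

lemma is_productI:
  assumes "p1 \<in> hom C p a" "p2 \<in> hom C p b"
    and "\<And>x f g. f \<in> hom C x a \<Longrightarrow> g \<in> hom C x b \<Longrightarrow>
      \<exists>h. h \<in> hom C x p \<and> p1 \<odot> h = f \<and> p2 \<odot> h = g"
    and "\<And>x h k. h \<in> hom C x p \<Longrightarrow> k \<in> hom C x p \<Longrightarrow>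
      p1 \<odot> h = p1 \<odot> k \<Longrightarrow> p2 \<odot> h = p2 \<odot> k \<Longrightarrow> h = k"
  shows "is_product C a b p p1 p2"
  unfolding is_product_def
proof (intro conjI ballI)
  fix x f g assume "f \<in> hom C x a" "g \<in> hom C x b"
  from assms(3)[OF this] obtain h where h: "h \<in> hom C x p" "p1 \<odot> h = f" "p2 \<odot> h = g" by blast
  show "\<exists>!h. h \<in> hom C x p \<and> p1 \<odot> h = f \<and> p2 \<odot> h = g"
    using h assms(4) by (intro ex1I[of _ h]) auto
qed (use assms hom_Ob in blast)+

lemma pair:
  assumes "f \<in> hom C x a" "g \<in> hom C x b"
  shows pair_hom: "\<langle>f, g\<rangle> \<in> hom C x (a \<otimes> b)"
    and Pr1_pair: "Pr1 C a b \<odot> \<langle>f, g\<rangle> = f"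
    and Pr2_pair: "Pr2 C a b \<odot> \<langle>f, g\<rangle> = g"
proof -
  have ob: "x \<in> Ob C" "a \<in> Ob C" "b \<in> Ob C" using hom_Ob assms by blast+
  from assms have d: "Dom C f = x" "Cod C f = a" "Cod C g = b" by (auto dest: homD)
  have "\<exists>!h. h \<in> hom C x (a \<otimes> b) \<and> Pr1 C a b \<odot> h = f \<and> Pr2 C a b \<odot> h = g"
    using Prd_product[OF ob(2,3)] assms ob unfolding is_product_def by blast
  from theI'[OF this]
  show "\<langle>f, g\<rangle> \<in> hom C x (a \<otimes> b)" "Pr1 C a b \<odot> \<langle>f, g\<rangle> = f" "Pr2 C a b \<odot> \<langle>f, g\<rangle> = g"
    unfolding pair_def d by blast+
qed

lemma pair_eqI:
  assumes "h \<in> hom C x (a \<otimes> b)" "a \<in> Ob C" "b \<in> Ob C" "Pr1 C a b \<odot> h = f" "Pr2 C a b \<odot> h = g"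
  shows "\<langle>f, g\<rangle> = h"
proof -
  have fg: "f \<in> hom C x a" "g \<in> hom C x b"
    using Comp_hom[OF assms(1) Pr1_hom] Comp_hom[OF assms(1) Pr2_hom] assms by auto
  show ?thesis
    by (rule product_eq[OF Prd_product pair_hom[OF fg] assms(1)])
      (use assms Pr1_pair[OF fg] Pr2_pair[OF fg] in auto)
qed

lemma pair_comp:
  assumes "f \<in> hom C x a" "g \<in> hom C x b" "h \<in> hom C y x"
  shows "\<langle>f, g\<rangle> \<odot> h = \<langle>f \<odot> h, g \<odot> h\<rangle>"
proof -
  have ob: "a \<in> Ob C" "b \<in> Ob C" using hom_Ob assms by blast+
  note p = pair[OF assms(1,2)]
  show ?thesis
    by (rule pair_eqI[symmetric, OF Comp_hom[OF assms(3) p(1)] ob])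
      (simp_all add: Comp_assoc[OF assms(3) p(1) Pr1_hom[OF ob], symmetric]
        Comp_assoc[OF assms(3) p(1) Pr2_hom[OF ob], symmetric] p)
qed

lemma pair_Pr: "a \<in> Ob C \<Longrightarrow> b \<in> Ob C \<Longrightarrow> \<langle>Pr1 C a b, Pr2 C a b\<rangle> = Id C (a \<otimes> b)"
  by (rule pair_eqI[OF Id_hom[OF Prd_Ob]]) (auto intro: Id_right Pr1_hom Pr2_hom)

lemma prd_id_hom:
  assumes "f \<in> hom C a b" "c \<in> Ob C"
  shows "prd_id C f c \<in> hom C (a \<otimes> c) (b \<otimes> c)"
  unfolding prd_id_def homD[OF assms(1)]
  using assms hom_Ob[OF assms(1)] by (intro pair_hom Comp_hom[of _ _ a] Pr1_hom Pr2_hom)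

lemma prd_id_pair:
  assumes "f \<in> hom C a b" "g \<in> hom C x a" "h \<in> hom C x c"
  shows "prd_id C f c \<odot> \<langle>g, h\<rangle> = \<langle>f \<odot> g, h\<rangle>"
proof -
  have ob: "a \<in> Ob C" "c \<in> Ob C" using hom_Ob assms by blast+
  note p = pair[OF assms(2,3)] Pr1_hom[OF ob] Pr2_hom[OF ob]
  show ?thesis
    unfolding prd_id_def homD[OF assms(1)] pair_comp[OF Comp_hom[OF p(4) assms(1)] p(5) p(1)]
    by (simp add: Comp_assoc[OF p(1) p(4) assms(1)] p)
qed

lemma assoc_arrow_hom:
  assumes "b \<in> Ob C" "c \<in> Ob C" "d \<in> Ob C"
  shows "assoc_arrow C b c d \<in> hom C (b \<otimes> (c \<otimes> d)) ((b \<otimes> c) \<otimes> d)"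
  unfolding assoc_arrow_def Let_def
  using assms Prd_Ob by (intro pair_hom Comp_hom[of _ _ "c \<otimes> d"] Pr1_hom Pr2_hom) auto

lemma inverse_arrow_eqI:
  assumes "f \<in> hom C a b" "g \<in> hom C b a" "g \<odot> f = Id C a" "f \<odot> g = Id C b"
  shows "inverse_arrow C f = g"
  unfolding inverse_arrow_def homD[OF assms(1)]
proof (rule the_equality)
  fix k assume k: "k \<in> hom C b a \<and> k \<odot> f = Id C a \<and> f \<odot> k = Id C b"
  then have "k = k \<odot> (f \<odot> g)" using Id_right assms(4) by auto
  also have "\<dots> = g"
    using k Comp_assoc[OF assms(2,1), of k a] Id_left[OF assms(2)] by simp
  finally show "k = g" .
qed (use assms in auto)

section \<open>Comparison of a product cone with the designated one\<close>

lemma product_iso: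
  assumes "is_product C a b p p1 p2"
  defines "i \<equiv> \<langle>p1, p2\<rangle>" and "j \<equiv> inverse_arrow C \<langle>p1, p2\<rangle>"
  shows "i \<in> hom C p (a \<otimes> b)" "j \<in> hom C (a \<otimes> b) p" "j \<odot> i = Id C p" "i \<odot> j = Id C (a \<otimes> b)"
    "p1 \<odot> j = Pr1 C a b" "p2 \<odot> j = Pr2 C a b"
proof -
  have p: "p1 \<in> hom C p a" "p2 \<in> hom C p b" and ob: "a \<in> Ob C" "b \<in> Ob C" "p \<in> Ob C"
    using assms(1) by (auto simp: is_product_def)
  note pr = Pr1_hom[OF ob(1,2)] Pr2_hom[OF ob(1,2)]
  note i = pair[OF p, folded i_def]
  obtain g where g: "g \<in> hom C (a \<otimes> b) p" "p1 \<odot> g = Pr1 C a b" "p2 \<odot> g = Pr2 C a b"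
    using product_arrow[OF assms(1) pr] .
  \<comment> \<open>One inverse law holds because the projections of the cone are jointly monic, the
    other because pairing is compatible with precomposition.\<close>
  have 1: "g \<odot> i = Id C p"
  proof (rule product_eq[OF assms(1) Comp_hom[OF i(1) g(1)] Id_hom[OF ob(3)]])
    show "p1 \<odot> g \<odot> i = p1 \<odot> Id C p" "p2 \<odot> g \<odot> i = p2 \<odot> Id C p"
      using Comp_assoc[OF i(1) g(1)] p g i Id_right by metis+
  qed
  have 2: "i \<odot> g = Id C (a \<otimes> b)"
    using pair_comp[OF p g(1)] g pair_Pr ob i_def by simp
  have j: "j = g"
    unfolding j_def i_def[symmetric] by (rule inverse_arrow_eqI[OF i(1) g(1) 1 2])
  show "i \<in> hom C p (a \<otimes> b)" "j \<in> hom C (a \<otimes> b) p" "j \<odot> i = Id C p" "i \<odot> j = Id C (a \<otimes> b)"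
    "p1 \<odot> j = Pr1 C a b" "p2 \<odot> j = Pr2 C a b"
    unfolding j by (fact i g 1 2)+
qed

text \<open>Joint monicity of \<open>p1\<close> and \<open>p2\<close> replaces the two inverse
  equations: the inverse of the comparison arrow is recognised by its projections alone.\<close>

lemma product_inverse_eqI:
  assumes "is_product C a b p p1 p2" "h \<in> hom C (a \<otimes> b) p"
    "p1 \<odot> h = Pr1 C a b" "p2 \<odot> h = Pr2 C a b"
  shows "inverse_arrow C \<langle>p1, p2\<rangle> = h"
  using product_eq[OF assms(1) product_iso(2)[OF assms(1)] assms(2)] product_iso(5,6)[OF assms(1)] assms(3,4)
  by simp

lemma product_along_iso:
  assumes "is_product C a b p p1 p2" "i \<in> hom C q p" "j \<in> hom C p q"
    "j \<odot> i = Id C q" "i \<odot> j = Id C p"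
  shows "is_product C a b q (p1 \<odot> i) (p2 \<odot> i)"
proof (rule is_productI)
  have p: "p1 \<in> hom C p a" "p2 \<in> hom C p b" using assms(1) by (auto simp: is_product_def)
  show "p1 \<odot> i \<in> hom C q a" "p2 \<odot> i \<in> hom C q b" using Comp_hom[OF assms(2)] p by auto
  fix x
  {
    fix f g assume fg: "f \<in> hom C x a" "g \<in> hom C x b"
    obtain h where h: "h \<in> hom C x p" "p1 \<odot> h = f" "p2 \<odot> h = g"
      using product_arrow[OF assms(1) fg] .
    have jh: "j \<odot> h \<in> hom C x q" by (rule Comp_hom[OF h(1) assms(3)])
    have "i \<odot> j \<odot> h = h" using Comp_assoc[OF h(1) assms(3,2)] assms(5) Id_left[OF h(1)] by simp
    then have "(p1 \<odot> i) \<odot> (j \<odot> h) = f" "(p2 \<odot> i) \<odot> (j \<odot> h) = g"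
      using h Comp_assoc[OF jh assms(2) p(1)] Comp_assoc[OF jh assms(2) p(2)] by simp_all
    then show "\<exists>h. h \<in> hom C x q \<and> (p1 \<odot> i) \<odot> h = f \<and> (p2 \<odot> i) \<odot> h = g"
      using jh by blast
  }
  fix h k assume hk: "h \<in> hom C x q" "k \<in> hom C x q"
    and eq: "(p1 \<odot> i) \<odot> h = (p1 \<odot> i) \<odot> k" "(p2 \<odot> i) \<odot> h = (p2 \<odot> i) \<odot> k"
  have "i \<odot> h = i \<odot> k"
    by (rule product_eq[OF assms(1) Comp_hom[OF hk(1) assms(2)] Comp_hom[OF hk(2) assms(2)]])
      (use eq Comp_assoc[OF hk(1) assms(2)] Comp_assoc[OF hk(2) assms(2)] p in metis)+
  then have "(j \<odot> i) \<odot> h = (j \<odot> i) \<odot> k"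
    using Comp_assoc[OF hk(1) assms(2,3)] Comp_assoc[OF hk(2) assms(2,3)] by simp
  then show "h = k" using Id_left hk assms(4) by simp
qed

end

text \<open>
  As products and terminal objects are unique up to isomorphism, a functor that sends one product
  cone on \<open>a\<close>, \<open>b\<close> to a product cone sends all of them to product cones.
\<close>

locale fp_functor_data =
  C: fp_category C + D: fp_category D
  for C :: "('o1, 'm1, 'y) fpcat_scheme" and D :: "('o2, 'm2, 'z) fpcat_scheme" +
  fixes FO :: "'o1 \<Rightarrow> 'o2" and FM :: "'m1 \<Rightarrow> 'm2"
  assumes FM_hom: "f \<in> hom C a b \<Longrightarrow> FM f \<in> hom D (FO a) (FO b)"
    and FM_Id: "a \<in> Ob C \<Longrightarrow> FM (Id C a) = Id D (FO a)"
    and FM_Comp: "\<lbrakk>f \<in> hom C a b; g \<in> hom C b c\<rbrakk> \<Longrightarrow> FM (Comp C g f) = Comp D (FM g) (FM f)"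
begin

lemma product_transfer:
  assumes "is_product C a b p p1 p2" "is_product C a b q q1 q2"
    "is_product D (FO a) (FO b) (FO p) (FM p1) (FM p2)"
  shows "is_product D (FO a) (FO b) (FO q) (FM q1) (FM q2)"
proof -
  have p: "p1 \<in> hom C p a" "p2 \<in> hom C p b" "p \<in> Ob C"
    and q: "q1 \<in> hom C q a" "q2 \<in> hom C q b" "q \<in> Ob C"
    using assms(1,2) by (auto simp: is_product_def)
  obtain i where i: "i \<in> hom C q p" "Comp C p1 i = q1" "Comp C p2 i = q2"
    using C.product_arrow[OF assms(1) q(1,2)] .
  obtain j where j: "j \<in> hom C p q" "Comp C q1 j = p1" "Comp C q2 j = p2"
    using C.product_arrow[OF assms(2) p(1,2)] .
  have 1: "Comp C j i = Id C q"
    by (rule C.product_eq[OF assms(2) C.Comp_hom[OF i(1) j(1)] C.Id_hom[OF q(3)]])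
      (simp_all add: C.Comp_assoc[OF i(1) j(1) q(1), symmetric] C.Comp_assoc[OF i(1) j(1) q(2), symmetric]
        i j C.Id_right[OF q(1)] C.Id_right[OF q(2)])
  have 2: "Comp C i j = Id C p"
    by (rule C.product_eq[OF assms(1) C.Comp_hom[OF j(1) i(1)] C.Id_hom[OF p(3)]])
      (simp_all add: C.Comp_assoc[OF j(1) i(1) p(1), symmetric] C.Comp_assoc[OF j(1) i(1) p(2), symmetric]
        i j C.Id_right[OF p(1)] C.Id_right[OF p(2)])
  have "is_product D (FO a) (FO b) (FO q) (Comp D (FM p1) (FM i)) (Comp D (FM p2) (FM i))"
    by (rule D.product_along_iso[OF assms(3) FM_hom[OF i(1)] FM_hom[OF j(1)]])
      (metis 1 2 FM_Comp FM_Id i(1) j(1) p(3) q(3))+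
  moreover have "Comp D (FM p1) (FM i) = FM q1" "Comp D (FM p2) (FM i) = FM q2"
    using FM_Comp[OF i(1)] p i by metis+
  ultimately show ?thesis by simp
qed

lemma terminal_transfer:
  assumes "is_terminal C s" "is_terminal C t" "is_terminal D (FO s)"
  shows "is_terminal D (FO t)"
proof -
  have ob: "s \<in> Ob C" "t \<in> Ob C" using assms by (auto simp: is_terminal_def)
  obtain i where i: "i \<in> hom C t s" using C.terminal_arrow[OF assms(1) ob(2)] .
  obtain j where j: "j \<in> hom C s t" using C.terminal_arrow[OF assms(2) ob(1)] .
  have 1: "Comp C j i = Id C t"
    by (rule C.terminal_eq[OF assms(2) C.Comp_hom[OF i j] C.Id_hom[OF ob(2)]])
  \<comment> \<open>A retract of a terminal object is terminal, so this equation is all that has to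
    be carried over to \<open>D\<close>.\<close>
  have F1: "Comp D (FM j) (FM i) = Id D (FO t)"
    using FM_Comp[OF i j] 1 FM_Id ob by simp
  show ?thesis
    unfolding is_terminal_def
  proof (intro conjI ballI)
    show "FO t \<in> Ob D" using D.hom_Ob[OF FM_hom[OF i]] by simp
    fix x assume "x \<in> Ob D"
    then obtain h where h: "h \<in> hom D x (FO s)" using D.terminal_arrow[OF assms(3)] by blast
    show "\<exists>!h. h \<in> hom D x (FO t)"
    proof (rule ex1I)
      show "Comp D (FM j) h \<in> hom D x (FO t)" by (rule D.Comp_hom[OF h FM_hom[OF j]])
      fix k assume k: "k \<in> hom D x (FO t)"
      have "Comp D (FM i) k = h"
        by (rule D.terminal_eq[OF assms(3) D.Comp_hom[OF k FM_hom[OF i]] h])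
      then show "k = Comp D (FM j) h"
        using D.Comp_assoc[OF k FM_hom[OF i] FM_hom[OF j]] F1 D.Id_left[OF k] by simp
    qed
  qed
qed

end

section \<open>Morphisms\<close>

context FA_object
begin

lemma Le_Fib: "c \<in> Ob C \<Longrightarrow> (r, s) \<in> Le C c \<Longrightarrow> r \<in> Fib C c \<and> s \<in> Fib C c"
  using Le_poset[of c] by (auto simp: partial_order_on_def preorder_on_def)

lemma Le_refl: "c \<in> Ob C \<Longrightarrow> r \<in> Fib C c \<Longrightarrow> (r, r) \<in> Le C c"
  using Le_poset[of c] by (auto simp: partial_order_on_def preorder_on_def refl_on_def)

lemma Le_trans: "c \<in> Ob C \<Longrightarrow> (r, s) \<in> Le C c \<Longrightarrow> (s, t) \<in> Le C c \<Longrightarrow> (r, t) \<in> Le C c"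
  using Le_poset[of c] unfolding partial_order_on_def preorder_on_def by (blast dest: transD)

lemma Le_antisym: "c \<in> Ob C \<Longrightarrow> (r, s) \<in> Le C c \<Longrightarrow> (s, r) \<in> Le C c \<Longrightarrow> r = s"
  using Le_poset[of c] unfolding partial_order_on_def by (blast dest: antisymD)

text \<open>Contravariant functoriality turns \<open>g \<odot> f = Id C a\<close> into a
  cancellation. It serves both for canonical isomorphisms and for sections of context maps.\<close>

lemma Reix_cancel:
  assumes "f \<in> hom C a b" "g \<in> hom C b a" "g \<odot> f = Id C a" "r \<in> Fib C a"
  shows "Reix C f (Reix C g r) = r"
  using Reix_Comp[OF assms(1,2,4)] assms(3,4) Reix_Id hom_Ob(1)[OF assms(1)] by simp

end

locale FA_functor =
  C: FA_object \<L> C + D: FA_object \<L> D + FA_morphism \<L> C D F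
  for \<L> :: "('q, 'k) lang"
    and C :: "('o1, 'm1, 'p1, 'q, 'k) propcat" and D :: "('o2, 'm2, 'p2, 'q, 'k) propcat"
    and F :: "('o1, 'm1, 'p1, 'o2, 'm2, 'p2) mor"
begin

lemma mO_Ob: "c \<in> Ob C \<Longrightarrow> mO F c \<in> Ob D"
  using mO_fun by auto

lemma mP_Fib: "c \<in> Ob C \<Longrightarrow> r \<in> Fib C c \<Longrightarrow> mP F c r \<in> Fib D (mO F c)"
  using mP_fun by (auto simp: PiE_iff)

lemma product_image:
  assumes "a \<in> Ob C" "b \<in> Ob C"
  shows "is_product D (mO F a) (mO F b) (mO F (Prd C a b)) (mM F (Pr1 C a b)) (mM F (Pr2 C a b))"
  using pres_product C.Prd_product assms by blast

text \<open>Facts 1 to 4 make the canonical morphism an isomorphism with inverse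
  \<open>inverse_arrow\<close>; facts 5 and 6 are the projections of that inverse.\<close>

lemmas canon = D.product_iso[OF product_image, folded canon_def]

text \<open>As \<open>canon\<close> is itself a pairing, composing it with the image of a pair gives
  the images of the components, by functoriality. So \<open>F\<close> preserves pairing up to the
  canonical isomorphism.\<close>

lemma canon_pair:
  assumes "f \<in> hom C x a" "g \<in> hom C x b"
  shows "Comp D (canon C D F a b) (mM F (pair C f g)) = pair D (mM F f) (mM F g)"
proof -
  have ob: "a \<in> Ob C" "b \<in> Ob C" using C.hom_Ob assms by blast+
  note h = C.pair[OF assms]
  show ?thesis
    using D.pair_comp[OF mM_hom mM_hom mM_hom, OF C.Pr1_hom[OF ob] C.Pr2_hom[OF ob] h(1)]
      mM_Comp[OF h(1) C.Pr1_hom[OF ob]] mM_Comp[OF h(1) C.Pr2_hom[OF ob]] h(2,3)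
    by (simp add: canon_def)
qed

end

lemma FA_logic_morphism_functor: "FA_logic_morphism \<L> Lg C D F \<Longrightarrow> FA_functor \<L> C D F"
  unfolding FA_logic_morphism_def FA_logic_object_def FA_functor_def by blast

lemma mor_comp_simps:
  "c \<in> Ob C \<Longrightarrow> mO (mor_comp C K F) c = mO K (mO F c)"
  "f \<in> Ar C \<Longrightarrow> mM (mor_comp C K F) f = mM K (mM F f)"
  "c \<in> Ob C \<Longrightarrow> r \<in> Fib C c \<Longrightarrow> mP (mor_comp C K F) c r = mP K (mO F c) (mP F c r)"
  by (auto simp: mor_comp_def compose_def)

text \<open>All components of a morphism are extensional and \<open>compose\<close> restricts to the
  carrier, so agreement on the carriers gives equality of records.\<close>

lemma (in FA_morphism) mor_comp_eqI:
  assumes "\<And>c. c \<in> Ob C \<Longrightarrow> mO H (mO K c) = mO F c"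
    and "\<And>f. f \<in> Ar C \<Longrightarrow> mM H (mM K f) = mM F f"
    and "\<And>c r. c \<in> Ob C \<Longrightarrow> r \<in> Fib C c \<Longrightarrow> mP H (mO K c) (mP K c r) = mP F c r"
  shows "mor_comp C H K = F"
proof -
  have "compose (Ob C) (mO H) (mO K) = mO F"
    using mO_fun assms(1) by (intro extensionalityI[of _ "Ob C"]) (auto simp: compose_def PiE_iff)
  moreover have "compose (Ar C) (mM H) (mM K) = mM F"
    using mM_fun assms(2) by (intro extensionalityI[of _ "Ar C"]) (auto simp: compose_def PiE_iff)
  moreover have "(\<lambda>c\<in>Ob C. compose (Fib C c) (mP H (mO K c)) (mP K c)) = mP F"
  proof (rule extensionalityI[of _ "Ob C"])
    fix c assume c: "c \<in> Ob C"
    then have "mP F c \<in> extensional (Fib C c)" using mP_fun by (auto simp: PiE_iff)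
    then show "(\<lambda>c\<in>Ob C. compose (Fib C c) (mP H (mO K c)) (mP K c)) c = mP F c"
      using c assms(3) by (auto simp: compose_def intro!: extensionalityI[of _ "Fib C c"])
  qed (use mP_fun in \<open>auto simp: PiE_iff\<close>)
  ultimately show ?thesis by (simp add: mor_comp_def)
qed

lemma FA_morphism_eqI:
  assumes "FA_morphism \<L> C D F" "FA_morphism \<L> C D G"
    and "\<And>c. c \<in> Ob C \<Longrightarrow> mO F c = mO G c"
    and "\<And>f. f \<in> Ar C \<Longrightarrow> mM F f = mM G f"
    and "\<And>c r. c \<in> Ob C \<Longrightarrow> r \<in> Fib C c \<Longrightarrow> mP F c r = mP G c r"
  shows "F = G"
proof -
  interpret F: FA_morphism \<L> C D F by fact
  interpret G: FA_morphism \<L> C D G by fact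
  have "mO F = mO G"
    using F.mO_fun G.mO_fun assms(3) by (intro extensionalityI[of _ "Ob C"]) (auto simp: PiE_iff)
  moreover have "mM F = mM G"
    using F.mM_fun G.mM_fun assms(4) by (intro extensionalityI[of _ "Ar C"]) (auto simp: PiE_iff)
  moreover have "mP F = mP G"
  proof (rule extensionalityI[of _ "Ob C"])
    fix c assume c: "c \<in> Ob C"
    then show "mP F c = mP G c"
      using F.mP_fun G.mP_fun assms(5) by (intro extensionalityI[of _ "Fib C c"]) (auto simp: PiE_iff)
  qed (use F.mP_fun G.mP_fun in \<open>auto simp: PiE_iff\<close>)
  ultimately show ?thesis by (cases F, cases G) simp
qed

section \<open>Factorization through a full and surjective morphism\<close>

text \<open>For a predicate over \<open>e\<close> an object \<open>c\<close> above \<open>e\<close>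
  is chosen before the predicate, because surjectivity on predicates is given fibre by fibre. Arrows
  are chosen without regard to their endpoints; the inclusion of kernels makes every choice
  harmless. The restrictions keep the components extensional.\<close>

definition lift ::
  "('o1, 'm1, 'p1, 'q, 'k) propcat \<Rightarrow> ('o3, 'm3, 'p3, 'q, 'k) propcat
    \<Rightarrow> ('o1, 'm1, 'p1, 'o3, 'm3, 'p3) mor \<Rightarrow> ('o1, 'm1, 'p1, 'o2, 'm2, 'p2) mor
    \<Rightarrow> ('o3, 'm3, 'p3, 'o2, 'm2, 'p2) mor" where
  "lift C E K F =
     \<lparr> mO = (\<lambda>e\<in>Ob E. mO F (SOME c. c \<in> Ob C \<and> mO K c = e)),
       mM = (\<lambda>g\<in>Ar E. mM F (SOME f. f \<in> Ar C \<and> mM K f = g)),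
       mP = (\<lambda>e\<in>Ob E. \<lambda>s\<in>Fib E e.
         let c = SOME c. c \<in> Ob C \<and> mO K c = e
         in mP F c (SOME r. r \<in> Fib C c \<and> mP K c r = s)) \<rparr>"

locale FA_surjection = FA_functor \<L> C E K
  for \<L> :: "('q, 'k) lang"
    and C :: "('o1, 'm1, 'p1, 'q, 'k) propcat" and E :: "('o3, 'm3, 'p3, 'q, 'k) propcat"
    and K :: "('o1, 'm1, 'p1, 'o3, 'm3, 'p3) mor" +
  assumes full: "full_functor C E K"
    and ob_surj: "mO K ` Ob C = Ob E"
    and pred_surj: "pred_surjective C E K"
begin

lemma ob_lift:
  assumes "e \<in> Ob E"
  obtains c where "c \<in> Ob C" "mO K c = e"
  using assms ob_surj by (metis imageE)

text \<open>Fullness allows the endpoints of a lift to be prescribed. This is stronger than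
  surjectivity on arrows, and it is what makes lifts of composable arrows composable.\<close>

lemma ar_lift:
  assumes "g \<in> hom E (mO K a) (mO K b)" "a \<in> Ob C" "b \<in> Ob C"
  obtains f where "f \<in> hom C a b" "mM K f = g"
  using assms full unfolding full_functor_def by (metis imageE)

lemma Ar_lift:
  assumes "g \<in> Ar E"
  obtains f where "f \<in> Ar C" "mM K f = g"
proof -
  obtain a where a: "a \<in> Ob C" "mO K a = Dom E g" using ob_lift D.Dom_Ob assms by metis
  obtain b where b: "b \<in> Ob C" "mO K b = Cod E g" using ob_lift D.Cod_Ob assms by metis
  have "g \<in> hom E (mO K a) (mO K b)" using a b assms by (simp add: hom_def)
  then show ?thesis using ar_lift[OF _ a(1) b(1)] that homD(1) by metis
qed

lemma pr_lift:
  assumes "s \<in> Fib E (mO K c)" "c \<in> Ob C"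
  obtains r where "r \<in> Fib C c" "mP K c r = s"
  using assms pred_surj unfolding pred_surjective_def by (metis imageE)

end

locale FA_lift =
  K: FA_surjection \<L> C E K + F: FA_functor \<L> C D F
  for \<L> :: "('q, 'k) lang"
    and C :: "('o1, 'm1, 'p1, 'q, 'k) propcat" and E :: "('o3, 'm3, 'p3, 'q, 'k) propcat"
    and D :: "('o2, 'm2, 'p2, 'q, 'k) propcat"
    and K :: "('o1, 'm1, 'p1, 'o3, 'm3, 'p3) mor"
    and F :: "('o1, 'm1, 'p1, 'o2, 'm2, 'p2) mor" +
  assumes kernel_le: "kernel_le (mor_kernel C E K) (mor_kernel C D F)"
begin

lemma ker_ob_le:
  "c1 \<in> Ob C \<Longrightarrow> c2 \<in> Ob C \<Longrightarrow> mO K c1 = mO K c2 \<Longrightarrow> mO F c1 = mO F c2"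
  using kernel_le unfolding kernel_le_def mor_kernel_def by auto

lemma ker_ar_le:
  "f1 \<in> Ar C \<Longrightarrow> f2 \<in> Ar C \<Longrightarrow> mM K f1 = mM K f2 \<Longrightarrow> mM F f1 = mM F f2"
  using kernel_le unfolding kernel_le_def mor_kernel_def by auto

lemma ker_pr_le:
  assumes "c1 \<in> Ob C" "c2 \<in> Ob C" "r1 \<in> Fib C c1" "r2 \<in> Fib C c2"
    "mO K c1 = mO K c2" "(mP K c1 r1, mP K c2 r2) \<in> Le E (mO K c1)"
  shows "(mP F c1 r1, mP F c2 r2) \<in> Le D (mO F c1)"
proof -
  have "((c1, r1), (c2, r2)) \<in> ker_pr (mor_kernel C E K)"
    using assms by (simp add: mor_kernel_def)
  then have "((c1, r1), (c2, r2)) \<in> ker_pr (mor_kernel C D F)"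
    using kernel_le unfolding kernel_le_def by blast
  then show ?thesis by (simp add: mor_kernel_def) metis
qed

lemma ker_pr_eq:
  assumes "c1 \<in> Ob C" "c2 \<in> Ob C" "r1 \<in> Fib C c1" "r2 \<in> Fib C c2"
    "mO K c1 = mO K c2" "mP K c1 r1 = mP K c2 r2"
  shows "mP F c1 r1 = mP F c2 r2"
proof -
  \<comment> \<open>Reflexivity in \<open>E\<close> turns the equality of images into two instances
    of the order relation of the kernel, one in each direction.\<close>
  have le: "(mP K c1 r1, mP K c2 r2) \<in> Le E (mO K c1)" "(mP K c2 r2, mP K c1 r1) \<in> Le E (mO K c2)"
    using K.D.Le_refl[OF K.mO_Ob K.mP_Fib, OF assms(1,1,3)] assms(5,6) by simp_all
  show ?thesis
    using ker_pr_le[OF assms(1-5) le(1)] ker_pr_le[OF assms(2,1,4,3) assms(5)[symmetric] le(2)]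
      ker_ob_le[OF assms(1,2,5)] F.D.Le_antisym[OF F.mO_Ob[OF assms(1)]] by simp
qed

abbreviation H :: "('o3, 'm3, 'p3, 'o2, 'm2, 'p2) mor" where "H \<equiv> lift C E K F"

lemma mO_lift:
  assumes "c \<in> Ob C"
  shows "mO H (mO K c) = mO F c"
proof -
  have "mO H (mO K c) = mO F (SOME c'. c' \<in> Ob C \<and> mO K c' = mO K c)"
    using K.mO_Ob[OF assms] by (simp add: lift_def)
  also have "\<dots> = mO F c"
    by (rule someI2[of _ c]) (use assms ker_ob_le in blast)+
  finally show ?thesis .
qed

lemma mM_lift:
  assumes "f \<in> Ar C"
  shows "mM H (mM K f) = mM F f"
proof -
  have "mM K f \<in> Ar E" using K.mM_fun assms by auto
  then have "mM H (mM K f) = mM F (SOME f'. f' \<in> Ar C \<and> mM K f' = mM K f)"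
    by (simp add: lift_def)
  also have "\<dots> = mM F f"
    by (rule someI2[of _ f]) (use assms ker_ar_le in blast)+
  finally show ?thesis .
qed

lemma mP_lift:
  assumes "c \<in> Ob C" "r \<in> Fib C c"
  shows "mP H (mO K c) (mP K c r) = mP F c r"
proof -
  define c' where "c' = (SOME c'. c' \<in> Ob C \<and> mO K c' = mO K c)"
  have c': "c' \<in> Ob C" "mO K c' = mO K c"
    using someI[of "\<lambda>c'. c' \<in> Ob C \<and> mO K c' = mO K c" c] assms(1) unfolding c'_def by auto
  define r' where "r' = (SOME r'. r' \<in> Fib C c' \<and> mP K c' r' = mP K c r)"
  \<comment> \<open>The chosen \<open>c'\<close> may differ from \<open>c\<close>, so
    \<open>r\<close> itself need not lie over it; but \<open>c'\<close> has the same image, and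
    surjectivity of \<open>K\<close> on the fibre over \<open>c'\<close> supplies a predicate with
    the required image.\<close>
  obtain r0 where "r0 \<in> Fib C c'" "mP K c' r0 = mP K c r"
    using K.pr_lift[OF _ c'(1)] K.mP_Fib[OF assms] c'(2) by metis
  then have r': "r' \<in> Fib C c'" "mP K c' r' = mP K c r"
    using someI[of "\<lambda>r'. r' \<in> Fib C c' \<and> mP K c' r' = mP K c r" r0] unfolding r'_def by auto
  have "mP H (mO K c) (mP K c r) = mP F c' r'"
    using K.mO_Ob[OF assms(1)] K.mP_Fib[OF assms] by (simp add: lift_def c'_def r'_def Let_def)
  also have "\<dots> = mP F c r" by (rule ker_pr_eq[OF c'(1) assms(1) r'(1) assms(2) c'(2) r'(2)])
  finally show ?thesis .
qed

section \<open>Functoriality of the lift and preservation of finite products\<close>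

lemma mM_lift_hom:
  assumes "g \<in> hom E a b"
  shows "mM H g \<in> hom D (mO H a) (mO H b)"
proof -
  obtain x y where xy: "x \<in> Ob C" "y \<in> Ob C" "mO K x = a" "mO K y = b"
    using K.ob_lift K.D.hom_Ob[OF assms] by metis
  then obtain f where "f \<in> hom C x y" "mM K f = g" using K.ar_lift assms by metis
  then show ?thesis using F.mM_hom mO_lift mM_lift homD(1) xy by metis
qed

lemma mM_lift_Id:
  assumes "a \<in> Ob E"
  shows "mM H (Id E a) = Id D (mO H a)"
proof -
  obtain x where x: "x \<in> Ob C" "mO K x = a" using K.ob_lift assms by metis
  then show ?thesis
    using mM_lift[of "Id C x"] homD(1)[OF K.C.Id_hom[OF x(1)]] K.mM_Id F.mM_Id mO_lift by metis
qed

lemma mM_lift_Comp: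
  assumes "f \<in> hom E a b" "g \<in> hom E b c"
  shows "mM H (Comp E g f) = Comp D (mM H g) (mM H f)"
proof -
  obtain x y z where xyz: "x \<in> Ob C" "y \<in> Ob C" "z \<in> Ob C" "mO K x = a" "mO K y = b" "mO K z = c"
    using K.ob_lift K.D.hom_Ob[OF assms(1)] K.D.hom_Ob[OF assms(2)] by metis
  obtain f' where f: "f' \<in> hom C x y" "mM K f' = f" using K.ar_lift assms(1) xyz by metis
  obtain g' where g: "g' \<in> hom C y z" "mM K g' = g" using K.ar_lift assms(2) xyz by metis
  have "mM H (Comp E g f) = mM F (Comp C g' f')"
    using K.mM_Comp[OF f(1) g(1)] f g mM_lift[OF homD(1)[OF K.C.Comp_hom[OF f(1) g(1)]]] by simp
  also have "\<dots> = Comp D (mM H g) (mM H f)"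
    using F.mM_Comp[OF f(1) g(1)] mM_lift homD(1) f g by metis
  finally show ?thesis .
qed

sublocale H: fp_functor_data E D "mO H" "mM H"
  by unfold_locales (auto intro: mM_lift_hom mM_lift_Id mM_lift_Comp)

lemma lift_pres_terminal:
  assumes "is_terminal E t"
  shows "is_terminal D (mO H t)"
proof (rule H.terminal_transfer[OF _ assms])
  show "is_terminal E (mO K (One C))" by (rule K.pres_terminal[OF K.C.One_terminal])
  show "is_terminal D (mO H (mO K (One C)))"
    using F.pres_terminal[OF K.C.One_terminal] mO_lift K.C.One_Ob by simp
qed

lemma lift_pres_product:
  assumes "is_product E a b p p1 p2"
  shows "is_product D (mO H a) (mO H b) (mO H p) (mM H p1) (mM H p2)"
proof -
  have "a \<in> Ob E" "b \<in> Ob E" using assms by (auto simp: is_product_def)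
  then obtain x y where xy: "x \<in> Ob C" "y \<in> Ob C" "mO K x = a" "mO K y = b"
    using K.ob_lift by metis
  show ?thesis
  proof (rule H.product_transfer[OF _ assms])
    show "is_product E a b (mO K (Prd C x y)) (mM K (Pr1 C x y)) (mM K (Pr2 C x y))"
      using K.product_image xy by blast
    show "is_product D (mO H a) (mO H b) (mO H (mO K (Prd C x y)))
        (mM H (mM K (Pr1 C x y))) (mM H (mM K (Pr2 C x y)))"
      using F.product_image[OF xy(1,2)] mO_lift mM_lift K.C.Prd_Ob[OF xy(1,2)] xy
        homD(1)[OF K.C.Pr1_hom[OF xy(1,2)]] homD(1)[OF K.C.Pr2_hom[OF xy(1,2)]] by metis
  qed
qed

lemma mP_lift_natural:
  assumes "g \<in> hom E a b" "s \<in> Fib E b"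
  shows "mP H a (Reix E g s) = Reix D (mM H g) (mP H b s)"
proof -
  obtain x y where xy: "x \<in> Ob C" "y \<in> Ob C" "mO K x = a" "mO K y = b"
    using K.ob_lift K.D.hom_Ob[OF assms(1)] by metis
  then obtain f where f: "f \<in> hom C x y" "mM K f = g" using K.ar_lift assms by metis
  obtain r where r: "r \<in> Fib C y" "mP K y r = s" using K.pr_lift assms xy by metis
  have "mP H a (Reix E g s) = mP F x (Reix C f r)"
    using K.mP_natural[OF f(1) r(1)] mP_lift[OF xy(1) K.C.Reix_Fib[OF f(1) r(1)]] f r xy by simp
  also have "\<dots> = Reix D (mM H g) (mP H b s)"
    using F.mP_natural[OF f(1) r(1)] mM_lift[OF homD(1)[OF f(1)]] mP_lift[OF xy(2) r(1)] f r xy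
    by simp
  finally show ?thesis .
qed

lemma mP_lift_Fib:
  assumes "e \<in> Ob E" "s \<in> Fib E e"
  shows "mP H e s \<in> Fib D (mO H e)"
proof -
  obtain x where x: "x \<in> Ob C" "mO K x = e" using K.ob_lift assms by metis
  obtain r where r: "r \<in> Fib C x" "mP K x r = s" using K.pr_lift assms x by metis
  show ?thesis using mP_lift F.mP_Fib mO_lift x r by metis
qed

section \<open>Canonical isomorphisms of a composite\<close>

context
  fixes b c
  assumes ob: "b \<in> Ob C" "c \<in> Ob C"
begin

lemma Pr_E_hom:
  "Pr1 E (mO K b) (mO K c) \<in> hom E (Prd E (mO K b) (mO K c)) (mO K b)"
  "Pr2 E (mO K b) (mO K c) \<in> hom E (Prd E (mO K b) (mO K c)) (mO K c)"
  using K.D.Pr1_hom K.D.Pr2_hom K.mO_Ob ob by auto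

lemma mM_lift_Pr:
  "mM H (mM K (Pr1 C b c)) = mM F (Pr1 C b c)" "mM H (mM K (Pr2 C b c)) = mM F (Pr2 C b c)"
  using mM_lift homD(1)[OF K.C.Pr1_hom[OF ob]] homD(1)[OF K.C.Pr2_hom[OF ob]] by auto

text \<open>Since \<open>H \<circ> K = F\<close>, the canonical morphism of \<open>F\<close> is that
  of \<open>H\<close> after the \<open>H\<close>-image of that of \<open>K\<close>. This is that
  factorization solved for \<open>H\<close>, in the form needed for equality predicates.\<close>

lemma canon_lift:
  "Comp D (canon C D F b c) (mM H (inverse_arrow E (canon C E K b c))) = canon E D H (mO K b) (mO K c)"
proof -
  let ?j = "inverse_arrow E (canon C E K b c)"
  have j: "?j \<in> hom E (Prd E (mO K b) (mO K c)) (mO K (Prd C b c))" by (rule K.canon(2)[OF ob])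
  have Hj: "mM H ?j \<in> hom D (mO H (Prd E (mO K b) (mO K c))) (mO F (Prd C b c))"
    using mM_lift_hom[OF j] mO_lift K.C.Prd_Ob[OF ob] by simp
  have pr: "mM K (Pr1 C b c) \<in> hom E (mO K (Prd C b c)) (mO K b)"
      "mM K (Pr2 C b c) \<in> hom E (mO K (Prd C b c)) (mO K c)"
    using K.mM_hom K.C.Pr1_hom K.C.Pr2_hom ob by blast+
  show ?thesis
    unfolding canon_def[of C D] canon_def[of E D]
    using F.D.pair_comp[OF F.mM_hom F.mM_hom Hj, OF K.C.Pr1_hom[OF ob] K.C.Pr2_hom[OF ob]]
      mM_lift_Comp[OF j pr(1)] mM_lift_Comp[OF j pr(2)] K.canon(5,6)[OF ob] mM_lift_Pr by simp
qed

text \<open>The inverse form of the same factorization, needed for quantifiers. The image under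
  \<open>H\<close> of a designated cone of \<open>E\<close> is a product cone, so the composite is
  identified as an inverse by its projections.\<close>

lemma inverse_canon_lift:
  "Comp D (mM H (canon C E K b c)) (inverse_arrow D (canon C D F b c))
    = inverse_arrow D (canon E D H (mO K b) (mO K c))"
proof -
  let ?i = "canon C E K b c" and ?j = "inverse_arrow D (canon C D F b c)"
  have i: "?i \<in> hom E (mO K (Prd C b c)) (Prd E (mO K b) (mO K c))" by (rule K.canon(1)[OF ob])
  have Hi: "mM H ?i \<in> hom D (mO F (Prd C b c)) (mO H (Prd E (mO K b) (mO K c)))"
    using mM_lift_hom[OF i] mO_lift K.C.Prd_Ob[OF ob] by simp
  have j: "?j \<in> hom D (Prd D (mO F b) (mO F c)) (mO F (Prd C b c))" by (rule F.canon(2)[OF ob])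
  have pr: "mM K (Pr1 C b c) \<in> hom E (mO K (Prd C b c)) (mO K b)"
      "mM K (Pr2 C b c) \<in> hom E (mO K (Prd C b c)) (mO K c)"
    using K.mM_hom K.C.Pr1_hom K.C.Pr2_hom ob by blast+
  note Kob = K.mO_Ob[OF ob(1)] K.mO_Ob[OF ob(2)]
  have prod: "is_product D (mO F b) (mO F c) (mO H (Prd E (mO K b) (mO K c)))
      (mM H (Pr1 E (mO K b) (mO K c))) (mM H (Pr2 E (mO K b) (mO K c)))"
    using lift_pres_product[OF K.D.Prd_product[OF Kob]] mO_lift ob by simp
  have Hpr: "mM H (Pr1 E (mO K b) (mO K c)) \<in> hom D (mO H (Prd E (mO K b) (mO K c))) (mO F b)"
    "mM H (Pr2 E (mO K b) (mO K c)) \<in> hom D (mO H (Prd E (mO K b) (mO K c))) (mO F c)"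
    using prod by (auto simp: is_product_def)
  have eq: "Comp E (Pr1 E (mO K b) (mO K c)) ?i = mM K (Pr1 C b c)"
    "Comp E (Pr2 E (mO K b) (mO K c)) ?i = mM K (Pr2 C b c)"
    unfolding canon_def by (rule K.D.Pr1_pair[OF pr] K.D.Pr2_pair[OF pr])+
  show ?thesis
    unfolding canon_def[of E D]
  proof (rule F.D.product_inverse_eqI[OF prod F.D.Comp_hom[OF j Hi], symmetric])
    show "Comp D (mM H (Pr1 E (mO K b) (mO K c))) (Comp D (mM H ?i) ?j) = Pr1 D (mO F b) (mO F c)"
      using F.D.Comp_assoc[OF j Hi Hpr(1)] mM_lift_Comp[OF i Pr_E_hom(1)] eq mM_lift_Pr
        F.canon(5)[OF ob] by simp
    show "Comp D (mM H (Pr2 E (mO K b) (mO K c))) (Comp D (mM H ?i) ?j) = Pr2 D (mO F b) (mO F c)"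
      using F.D.Comp_assoc[OF j Hi Hpr(2)] mM_lift_Comp[OF i Pr_E_hom(2)] eq mM_lift_Pr
        F.canon(6)[OF ob] by simp
  qed
qed

end

section \<open>Connectives, quantifiers and equality under the lift\<close>

lemma mP_lift_Con:
  assumes "k \<in> lconns \<L>" "e \<in> Ob E" "length ss = larity \<L> k" "set ss \<subseteq> Fib E e"
  shows "mP H e (Con E k e ss) = Con D k (mO H e) (map (mP H e) ss)"
proof -
  obtain x where x: "x \<in> Ob C" "mO K x = e" using K.ob_lift assms by metis
  \<comment> \<open>All arguments are lifted to the fibre over one and the same \<open>x\<close>, so
    that the connective of \<open>C\<close> can be applied to the lifts.\<close>
  have "\<forall>s\<in>set ss. \<exists>r. r \<in> Fib C x \<and> mP K x r = s" using K.pr_lift assms(4) x by (metis subsetD)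
  then obtain g where g: "\<And>s. s \<in> set ss \<Longrightarrow> g s \<in> Fib C x \<and> mP K x (g s) = s" by metis
  define rs where "rs = map g ss"
  have rs: "length rs = larity \<L> k" "set rs \<subseteq> Fib C x" "map (mP K x) rs = ss"
    using g assms(3) by (auto simp: rs_def intro: map_idI)
  have "mP H e (Con E k e ss) = mP F x (Con C k x rs)"
    using K.mP_Con[OF assms(1) x(1) rs(1,2)] mP_lift[OF x(1) K.C.Con_Fib[OF assms(1) x(1) rs(1,2)]] rs x
    by simp
  also have "\<dots> = Con D k (mO H e) (map (mP F x) rs)"
    using F.mP_Con[OF assms(1) x(1) rs(1,2)] mO_lift x by auto
  also have "map (mP F x) rs = map (mP H e) ss"
    using mP_lift[OF x(1)] g x(2) unfolding rs_def by (simp, metis)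
  finally show ?thesis .
qed

lemma mP_lift_Qu:
  assumes "q \<in> lquants \<L>" "b \<in> Ob E" "c \<in> Ob E" "s \<in> Fib E (Prd E b c)"
  shows "mP H b (Qu E q b c s) =
    Qu D q (mO H b) (mO H c) (Reix D (inverse_arrow D (canon E D H b c)) (mP H (Prd E b c) s))"
proof -
  obtain x y where xy: "x \<in> Ob C" "y \<in> Ob C" "mO K x = b" "mO K y = c"
    using K.ob_lift assms by metis
  note xy' = xy(1,2)
  note p = K.C.Prd_Ob[OF xy']
  let ?i = "canon C E K x y"
  have i: "?i \<in> hom E (mO K (Prd C x y)) (Prd E b c)"
    "inverse_arrow E ?i \<in> hom E (Prd E b c) (mO K (Prd C x y))"
    "Comp E ?i (inverse_arrow E ?i) = Id E (Prd E b c)"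
    using K.canon[OF xy'] xy by auto
  \<comment> \<open>\<open>s\<close> lies over the designated product of \<open>E\<close>, which
    need not be the image of the designated product of \<open>C\<close>. So \<open>s\<close> is
    first moved along the canonical isomorphism, and the result is lifted.\<close>
  obtain r where r: "r \<in> Fib C (Prd C x y)" "mP K (Prd C x y) r = Reix E ?i s"
    using K.pr_lift[OF K.D.Reix_Fib[OF i(1) assms(4)] p] .
  have s: "Reix E (inverse_arrow E ?i) (Reix E ?i s) = s"
    by (rule K.D.Reix_cancel[OF i(2,1,3) assms(4)])
  have Fr: "mP F (Prd C x y) r = Reix D (mM H ?i) (mP H (Prd E b c) s)"
    using mP_lift_natural[OF i(1) assms(4)] mP_lift[OF p r(1)] r(2) by simp
  have Hi: "mM H ?i \<in> hom D (mO F (Prd C x y)) (mO H (Prd E b c))"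
    using mM_lift_hom[OF i(1)] mO_lift[OF p] by simp
  have Hs: "mP H (Prd E b c) s \<in> Fib D (mO H (Prd E b c))"
    using mP_lift_Fib[OF K.D.Prd_Ob[OF assms(2,3)] assms(4)] .
  have "mP H b (Qu E q b c s) = mP F x (Qu C q x y r)"
    using K.mP_Qu[OF assms(1) xy' r(1)] r(2) s xy
      mP_lift[OF xy(1) K.C.Qu_Fib[OF assms(1) xy' r(1)]] by simp
  also have "\<dots> = Qu D q (mO H b) (mO H c)
      (Reix D (inverse_arrow D (canon C D F x y)) (mP F (Prd C x y) r))"
    using F.mP_Qu[OF assms(1) xy' r(1)] mO_lift xy by auto
  also have "Reix D (inverse_arrow D (canon C D F x y)) (mP F (Prd C x y) r)
      = Reix D (inverse_arrow D (canon E D H b c)) (mP H (Prd E b c) s)"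
    using inverse_canon_lift[OF xy'] F.D.Reix_Comp[OF F.canon(2)[OF xy'] Hi Hs] Fr xy by simp
  finally show ?thesis .
qed

lemma mP_lift_Equ:
  assumes "c \<in> Ob E"
  shows "mP H (Prd E c c) (Equ E c) = Reix D (canon E D H c c) (Equ D (mO H c))"
proof -
  obtain x where x: "x \<in> Ob C" "mO K x = c" using K.ob_lift assms by metis
  note xx = x(1) x(1)
  note p = K.C.Prd_Ob[OF xx]
  let ?j = "inverse_arrow E (canon C E K x x)"
  have i: "canon C E K x x \<in> hom E (mO K (Prd C x x)) (Prd E c c)"
    "?j \<in> hom E (Prd E c c) (mO K (Prd C x x))"
    "Comp E (canon C E K x x) ?j = Id E (Prd E c c)"
    using K.canon[OF xx] x by auto
  note eq = K.D.Equ_Fib[OF assms] K.C.Equ_Fib[OF x(1)]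
  \<comment> \<open>This solves the compatibility of \<open>K\<close> with equality for the equality
    predicate of \<open>E\<close>, by reindexing along the inverse canonical isomorphism.\<close>
  have e: "Equ E c = Reix E ?j (mP K (Prd C x x) (Equ C x))"
    using K.mP_Equ[OF x(1)] K.D.Reix_cancel[OF i(2,1,3) eq(1)] x by simp
  have Hj: "mM H ?j \<in> hom D (mO H (Prd E c c)) (mO F (Prd C x x))"
    using mM_lift_hom[OF i(2)] mO_lift[OF p] by simp
  have "mP H (Prd E c c) (Equ E c) = Reix D (mM H ?j) (mP F (Prd C x x) (Equ C x))"
    using mP_lift_natural[OF i(2) K.mP_Fib[OF p eq(2)]] mP_lift[OF p eq(2)] e by simp
  also have "\<dots> = Reix D (mM H ?j) (Reix D (canon C D F x x) (Equ D (mO F x)))"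
    using F.mP_Equ[OF x(1)] by simp
  also have "\<dots> = Reix D (canon E D H c c) (Equ D (mO H c))"
    using canon_lift[OF xx] F.D.Reix_Comp[OF Hj F.canon(1)[OF xx] F.D.Equ_Fib[OF F.mO_Ob[OF x(1)]]]
      mO_lift x by auto
  finally show ?thesis .
qed

lemma lift_morphism: "FA_morphism \<L> E D H"
proof
  show "mO H \<in> Ob E \<rightarrow>\<^sub>E Ob D"
  proof (rule PiE_I)
    fix e assume "e \<in> Ob E"
    then show "mO H e \<in> Ob D" using K.ob_lift mO_lift F.mO_Ob by metis
  qed (simp add: lift_def)
  show "mM H \<in> Ar E \<rightarrow>\<^sub>E Ar D"
  proof (rule PiE_I)
    fix g assume "g \<in> Ar E"
    then show "mM H g \<in> Ar D" using mM_lift_hom homD(1) homI by metis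
  qed (simp add: lift_def)
  show "mP H \<in> (\<Pi>\<^sub>E e\<in>Ob E. Fib E e \<rightarrow>\<^sub>E Fib D (mO H e))"
    using mP_lift_Fib by (intro PiE_I) (auto simp: lift_def)
  show "mM H g \<in> hom D (mO H a) (mO H b)" if "g \<in> hom E a b" for g a b
    using that by (rule mM_lift_hom)
  show "mM H (Id E a) = Id D (mO H a)" if "a \<in> Ob E" for a
    using that by (rule mM_lift_Id)
  show "mM H (Comp E g f) = Comp D (mM H g) (mM H f)" if "f \<in> hom E a b" "g \<in> hom E b c" for f g a b c
    using that by (rule mM_lift_Comp)
  show "is_terminal D (mO H t)" if "is_terminal E t" for t
    using that by (rule lift_pres_terminal)
  show "is_product D (mO H a) (mO H b) (mO H p) (mM H p1) (mM H p2)" if "is_product E a b p p1 p2"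
    for a b p p1 p2 using that by (rule lift_pres_product)
  \<comment> \<open>An inequality in \<open>E\<close> need not be the image of an inequality in
    \<open>C\<close>, so monotonicity of \<open>F\<close> does not suffice. Here the kernel has to
    compare predicates by an order and not merely by an equivalence.\<close>
  show "(mP H e r, mP H e s) \<in> Le D (mO H e)" if e: "e \<in> Ob E" and le: "(r, s) \<in> Le E e" for e r s
  proof -
    obtain x where x: "x \<in> Ob C" "mO K x = e" using K.ob_lift[OF e] .
    have rs: "r \<in> Fib E (mO K x)" "s \<in> Fib E (mO K x)" using K.D.Le_Fib[OF e le] x by auto
    obtain r' where "r' \<in> Fib C x" "mP K x r' = r" using K.pr_lift[OF rs(1) x(1)] .
    moreover obtain s' where "s' \<in> Fib C x" "mP K x s' = s" using K.pr_lift[OF rs(2) x(1)] .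
    ultimately show ?thesis using ker_pr_le[of x x r' s'] mP_lift[OF x(1)] mO_lift[OF x(1)] x le by auto
  qed
  show "mP H a (Reix E f r) = Reix D (mM H f) (mP H b r)" if "f \<in> hom E a b" "r \<in> Fib E b" for f a b r
    using that by (rule mP_lift_natural)
  show "mP H c (Con E k c rs) = Con D k (mO H c) (map (mP H c) rs)"
    if "k \<in> lconns \<L>" "c \<in> Ob E" "length rs = larity \<L> k" "set rs \<subseteq> Fib E c" for k c rs
    using that by (rule mP_lift_Con)
  show "mP H b (Qu E q b c r) =
      Qu D q (mO H b) (mO H c) (Reix D (inverse_arrow D (canon E D H b c)) (mP H (Prd E b c) r))"
    if "q \<in> lquants \<L>" "b \<in> Ob E" "c \<in> Ob E" "r \<in> Fib E (Prd E b c)" for q b c r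
    using that by (rule mP_lift_Qu)
  show "mP H (Prd E c c) (Equ E c) = Reix D (canon E D H c c) (Equ D (mO H c))" if "c \<in> Ob E" for c
    using that by (rule mP_lift_Equ)
qed

lemma lift_comp: "mor_comp C H K = F"
  by (rule F.mor_comp_eqI) (auto intro: mO_lift mM_lift mP_lift)

end

text \<open>Every object, arrow and predicate of \<open>E\<close> is an image under
  \<open>K\<close>, so the values of \<open>H\<close> are read off from the composite.\<close>

lemma (in FA_surjection) comp_cancel:
  assumes "FA_morphism \<L> E D H" "FA_morphism \<L> E D H'" "mor_comp C H K = mor_comp C H' K"
  shows "H = H'"
proof (rule FA_morphism_eqI[OF assms(1,2)])
  show "mO H e = mO H' e" if "e \<in> Ob E" for e
    using ob_lift[OF that] assms(3) mor_comp_simps(1) by metis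
  show "mM H g = mM H' g" if "g \<in> Ar E" for g
    using Ar_lift[OF that] assms(3) mor_comp_simps(2) by metis
  show "mP H e s = mP H' e s" if e: "e \<in> Ob E" and s: "s \<in> Fib E e" for e s
  proof -
    obtain c where c: "c \<in> Ob C" "mO K c = e" using ob_lift[OF e] .
    then obtain r where "r \<in> Fib C c" "mP K c r = s" using pr_lift s by metis
    then show ?thesis using c assms(3) mor_comp_simps(3) by metis
  qed
qed

text \<open>What \<open>F\<close> identifies cannot be separated by applying \<open>H\<close>
  afterwards, and monotonicity of \<open>H\<close> gives the same for the order of predicates. This
  is the necessity of the kernel inclusion.\<close>

lemma (in FA_functor) kernel_le_comp:
  assumes "FA_morphism \<L> D E H"
  shows "kernel_le (mor_kernel C D F) (mor_kernel C E (mor_comp C H F))"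
proof -
  interpret H: FA_morphism \<L> D E H by fact
  show ?thesis
    unfolding kernel_le_def mor_kernel_def
    using H.mP_mono[OF mO_Ob] by (auto simp: mor_comp_simps)
qed

theorem (in FA_surjection) factorization_iff:
  assumes "FA_functor \<L> C D F"
  shows "(\<exists>!H. FA_morphism \<L> E D H \<and> mor_comp C H K = F)
    \<longleftrightarrow> kernel_le (mor_kernel C E K) (mor_kernel C D F)"
proof
  assume "\<exists>!H. FA_morphism \<L> E D H \<and> mor_comp C H K = F"
  then show "kernel_le (mor_kernel C E K) (mor_kernel C D F)" using kernel_le_comp by blast
next
  assume "kernel_le (mor_kernel C E K) (mor_kernel C D F)"
  then interpret FA_lift \<L> C E D K F
    using assms by (intro FA_lift.intro FA_surjection_axioms FA_lift_axioms.intro)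
  show "\<exists>!H. FA_morphism \<L> E D H \<and> mor_comp C H K = F"
    using lift_morphism lift_comp comp_cancel by metis
qed

section \<open>Interpretation along a morphism\<close>

locale FA_struct = FA_object \<L> C
  for \<L> :: "('q, 'k) lang" and C :: "('o, 'm, 'p, 'q, 'k) propcat" (structure) +
  fixes \<Sigma> :: "('s, 'f, 'r) sig" and M :: "('s, 'f, 'r, 'o, 'm, 'p) struct"
  assumes lang: "language \<L>"
    and sgn: "signature \<Sigma>"
    and struct: "structure_in \<Sigma> C M"
begin

lemma sort_Ob: "\<sigma> \<in> sorts \<Sigma> \<Longrightarrow> s_sort M \<sigma> \<in> Ob C"
  using struct by (simp add: structure_in_def)

lemma fun_hom:
  "f \<in> funs \<Sigma> \<Longrightarrow> s_fun M f \<in> hom C (sem_ctx C M (fdom \<Sigma> f)) (s_sort M (fcod \<Sigma> f))"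
  using struct by (simp add: structure_in_def)

lemma rel_Fib: "R \<in> rels \<Sigma> \<Longrightarrow> s_rel M R \<in> Fib C (sem_ctx C M (rdom \<Sigma> R))"
  using struct by (simp add: structure_in_def)

lemma fdom_sorts: "f \<in> funs \<Sigma> \<Longrightarrow> context_of \<Sigma> (fdom \<Sigma> f)"
  using sgn by (simp add: signature_def context_of_def)

lemma rdom_sorts: "R \<in> rels \<Sigma> \<Longrightarrow> context_of \<Sigma> (rdom \<Sigma> R)"
  using sgn by (simp add: signature_def context_of_def)

lemma sem_ctx_Ob: "context_of \<Sigma> \<Gamma> \<Longrightarrow> sem_ctx C M \<Gamma> \<in> Ob C"
  by (induction \<Gamma>) (auto simp: context_of_def One_Ob Prd_Ob sort_Ob)

lemma sem_var_hom:
  "context_of \<Sigma> \<Gamma> \<Longrightarrow> i < length \<Gamma> \<Longrightarrow> sem_var C M \<Gamma> i \<in> hom C (sem_ctx C M \<Gamma>) (s_sort M (\<Gamma> ! i))"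
proof (induction \<Gamma> arbitrary: i)
  case (Cons \<sigma> \<Gamma>)
  then have ctx: "context_of \<Sigma> \<Gamma>" and s: "s_sort M \<sigma> \<in> Ob C"
    by (auto simp: context_of_def sort_Ob)
  note ob = sem_ctx_Ob[OF ctx] s
  show ?case
  proof (cases i)
    case (Suc j)
    then show ?thesis using Comp_hom[OF Pr1_hom[OF ob] Cons.IH[OF ctx, of j]] Cons.prems(2) by simp
  qed (use Pr2_hom[OF ob] in simp)
qed simp

lemma tuple_hom:
  assumes "x \<in> Ob C"
  shows "list_all2 (\<lambda>g \<sigma>. g \<in> hom C x (s_sort M \<sigma>)) gs \<Delta> \<Longrightarrow> tuple C x gs \<in> hom C x (sem_ctx C M \<Delta>)"
  by (induction rule: list_all2_induct) (auto simp: bang_hom assms intro: pair_hom)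

lemma sem_tm_hom:
  "term_in \<Sigma> \<Gamma> t \<sigma> \<Longrightarrow> context_of \<Sigma> \<Gamma> \<Longrightarrow> sem_tm C M \<Gamma> t \<in> hom C (sem_ctx C M \<Gamma>) (s_sort M \<sigma>)"
proof (induction rule: term_in.induct)
  case (1 i)
  then show ?case using sem_var_hom by simp
next
  case (2 f ts)
  then have "list_all2 (\<lambda>g \<sigma>. g \<in> hom C (sem_ctx C M \<Gamma>) (s_sort M \<sigma>))
      (map (sem_tm C M \<Gamma>) ts) (fdom \<Sigma> f)"
    by (auto simp: list_all2_map1 elim!: list_all2_mono)
  from Comp_hom[OF tuple_hom[OF sem_ctx_Ob[OF 2(3)] this] fun_hom[OF 2(1)]]
  show ?case by simp
qed

lemma sem_tms_hom:
  assumes "list_all2 (term_in \<Sigma> \<Gamma>) ts \<Delta>" "context_of \<Sigma> \<Gamma>"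
  shows "list_all2 (\<lambda>g \<sigma>. g \<in> hom C (sem_ctx C M \<Gamma>) (s_sort M \<sigma>)) (map (sem_tm C M \<Gamma>) ts) \<Delta>"
  using assms by (auto simp: list_all2_map1 sem_tm_hom elim!: list_all2_mono)

lemma sem_fm_Fib:
  "formula_in \<L> \<Sigma> \<Gamma> \<phi> \<Longrightarrow> context_of \<Sigma> \<Gamma> \<Longrightarrow> sem_fm C M \<Gamma> \<phi> \<in> Fib C (sem_ctx C M \<Gamma>)"
proof (induction rule: formula_in.induct)
  case (1 R \<Gamma> ts)
  then show ?case
    using Reix_Fib[OF tuple_hom[OF sem_ctx_Ob sem_tms_hom] rel_Fib] by simp
next
  case (2 \<sigma> \<Gamma> t u)
  then show ?case
    using Reix_Fib[OF pair_hom[OF sem_tm_hom sem_tm_hom] Equ_Fib[OF sort_Ob]] by simp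
next
  case (3 k \<phi>s \<Gamma>)
  then show ?case by (auto intro!: Con_Fib sem_ctx_Ob)
next
  case (4 q \<sigma> \<Gamma> \<phi>)
  then show ?case by (auto intro!: Qu_Fib sem_ctx_Ob sort_Ob simp: context_of_def)
qed

lemma unit_Fib: "c \<in> Ob C \<Longrightarrow> unit_at \<L> C c \<in> Fib C c"
  using Con_Fib[of "lunit \<L>" c "[]"] lang by (simp add: language_def)

lemma tensor_Fib: "c \<in> Ob C \<Longrightarrow> x \<in> Fib C c \<Longrightarrow> y \<in> Fib C c \<Longrightarrow> tensor_at \<L> C c x y \<in> Fib C c"
  using Con_Fib[of "ltensor \<L>" c "[x, y]"] lang by (simp add: language_def)

lemma foldr_tensor_Fib:
  "c \<in> Ob C \<Longrightarrow> set rs \<subseteq> Fib C c \<Longrightarrow> foldr (tensor_at \<L> C c) rs (unit_at \<L> C c) \<in> Fib C c"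
  by (induction rs) (auto intro: unit_Fib tensor_Fib)

end

text \<open>This is the comparison from the context interpreted in \<open>D\<close> to the image of
  the context interpreted in \<open>C\<close>. The direction lets arrows and predicates over the
  image be pulled back to \<open>D\<close>. It depends on \<open>M\<close> and \<open>F\<close> but
  not on the image structure, so that the latter can be defined by means of it.\<close>

fun ctx_map ::
  "('o1, 'm1, 'p1, 'q, 'k) propcat \<Rightarrow> ('o2, 'm2, 'p2, 'q, 'k) propcat
    \<Rightarrow> ('o1, 'm1, 'p1, 'o2, 'm2, 'p2) mor \<Rightarrow> ('s, 'f, 'r, 'o1, 'm1, 'p1) struct \<Rightarrow> 's list \<Rightarrow> 'm2" where
  "ctx_map C D F M [] = (THE h. h \<in> hom D (One D) (mO F (One C)))"
| "ctx_map C D F M (\<sigma> # \<Gamma>) =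
     Comp D (inverse_arrow D (canon C D F (sem_ctx C M \<Gamma>) (s_sort M \<sigma>)))
       (prd_id D (ctx_map C D F M \<Gamma>) (mO F (s_sort M \<sigma>)))"

text \<open>The image of a function or relation symbol lives over the image of a product, whereas a
  structure in \<open>D\<close> needs it over the product of the images; the comparison of contexts
  makes the correction.\<close>

definition image_struct ::
  "('s, 'f, 'r) sig \<Rightarrow> ('o1, 'm1, 'p1, 'q, 'k) propcat \<Rightarrow> ('o2, 'm2, 'p2, 'q, 'k) propcat
    \<Rightarrow> ('o1, 'm1, 'p1, 'o2, 'm2, 'p2) mor \<Rightarrow> ('s, 'f, 'r, 'o1, 'm1, 'p1) struct
    \<Rightarrow> ('s, 'f, 'r, 'o2, 'm2, 'p2) struct" where
  "image_struct \<Sigma> C D F M =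
     \<lparr> s_sort = (\<lambda>\<sigma>. mO F (s_sort M \<sigma>)),
       s_fun = (\<lambda>f. Comp D (mM F (s_fun M f)) (ctx_map C D F M (fdom \<Sigma> f))),
       s_rel = (\<lambda>R. Reix D (ctx_map C D F M (rdom \<Sigma> R)) (mP F (sem_ctx C M (rdom \<Sigma> R)) (s_rel M R))) \<rparr>"

locale FA_functor_struct =
  FA_functor \<L> C D F + M: FA_struct \<L> C \<Sigma> M
  for \<L> :: "('q, 'k) lang"
    and C :: "('o1, 'm1, 'p1, 'q, 'k) propcat" and D :: "('o2, 'm2, 'p2, 'q, 'k) propcat"
    and F :: "('o1, 'm1, 'p1, 'o2, 'm2, 'p2) mor"
    and \<Sigma> :: "('s, 'f, 'r) sig" and M :: "('s, 'f, 'r, 'o1, 'm1, 'p1) struct"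
begin

abbreviation N :: "('s, 'f, 'r, 'o2, 'm2, 'p2) struct" where "N \<equiv> image_struct \<Sigma> C D F M"
abbreviation ctxC :: "'s list \<Rightarrow> 'o1" where "ctxC \<equiv> sem_ctx C M"
abbreviation ctxD :: "'s list \<Rightarrow> 'o2" where "ctxD \<equiv> sem_ctx D N"
abbreviation \<kappa> :: "'s list \<Rightarrow> 'm2" where "\<kappa> \<equiv> ctx_map C D F M"

lemma s_sort_N: "s_sort N \<sigma> = mO F (s_sort M \<sigma>)"
  by (simp add: image_struct_def)

lemma \<kappa>_hom: "context_of \<Sigma> \<Gamma> \<Longrightarrow> \<kappa> \<Gamma> \<in> hom D (ctxD \<Gamma>) (mO F (ctxC \<Gamma>))"
proof (induction \<Gamma>)
  case Nil
  have "\<exists>!h. h \<in> hom D (One D) (mO F (One C))"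
    using pres_terminal[OF C.One_terminal] D.One_Ob unfolding is_terminal_def by blast
  from theI'[OF this] show ?case by simp
next
  case (Cons \<sigma> \<Gamma>)
  then have ctx: "context_of \<Sigma> \<Gamma>" and s: "s_sort M \<sigma> \<in> Ob C"
    by (auto simp: context_of_def M.sort_Ob)
  show ?case
    using D.Comp_hom[OF D.prd_id_hom[OF Cons.IH[OF ctx] mO_Ob[OF s]] canon(2)[OF M.sem_ctx_Ob[OF ctx] s]]
    by (simp add: s_sort_N)
qed

text \<open>The inverse canonical isomorphism turns images of projections into designated
  projections, so \<open>\<kappa>\<close> commutes with the projections of an extended context.
  Variables and tuples are treated through these two equations.\<close>

lemma \<kappa>_Cons:
  assumes "context_of \<Sigma> \<Gamma>" "\<sigma> \<in> sorts \<Sigma>"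
  shows "Comp D (mM F (Pr1 C (ctxC \<Gamma>) (s_sort M \<sigma>))) (\<kappa> (\<sigma> # \<Gamma>))
      = Comp D (\<kappa> \<Gamma>) (Pr1 D (ctxD \<Gamma>) (s_sort N \<sigma>))"
    and "Comp D (mM F (Pr2 C (ctxC \<Gamma>) (s_sort M \<sigma>))) (\<kappa> (\<sigma> # \<Gamma>)) = Pr2 D (ctxD \<Gamma>) (s_sort N \<sigma>)"
proof -
  note ob = M.sem_ctx_Ob[OF assms(1)] M.sort_Ob[OF assms(2)]
  note k = \<kappa>_hom[OF assms(1)]
  note p = D.prd_id_hom[OF k mO_Ob[OF ob(2)]]
  note k_ob = D.hom_Ob(1)[OF k] mO_Ob[OF ob(2)]
  note k_pr = D.Comp_hom[OF D.Pr1_hom[OF k_ob] k] D.Pr2_hom[OF k_ob]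
  note F_pr = mM_hom[OF C.Pr1_hom[OF ob]] mM_hom[OF C.Pr2_hom[OF ob]]
  show "Comp D (mM F (Pr1 C (ctxC \<Gamma>) (s_sort M \<sigma>))) (\<kappa> (\<sigma> # \<Gamma>))
      = Comp D (\<kappa> \<Gamma>) (Pr1 D (ctxD \<Gamma>) (s_sort N \<sigma>))"
    using D.Comp_assoc[OF p canon(2)[OF ob] F_pr(1)] canon(5)[OF ob] D.Pr1_pair[OF k_pr]
    by (simp add: prd_id_def homD[OF k] s_sort_N)
  show "Comp D (mM F (Pr2 C (ctxC \<Gamma>) (s_sort M \<sigma>))) (\<kappa> (\<sigma> # \<Gamma>)) = Pr2 D (ctxD \<Gamma>) (s_sort N \<sigma>)"
    using D.Comp_assoc[OF p canon(2)[OF ob] F_pr(2)] canon(6)[OF ob] D.Pr2_pair[OF k_pr]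
    by (simp add: prd_id_def homD[OF k] s_sort_N)
qed

text \<open>A section of \<open>\<kappa>\<close> is what is needed to cancel it, both after arrows
  out of the image context and in reindexing of predicates. It is built by the same recursion as
  \<open>\<kappa>\<close>.\<close>

lemma \<kappa>_right_inverse:
  "context_of \<Sigma> \<Gamma> \<Longrightarrow> \<exists>k. k \<in> hom D (mO F (ctxC \<Gamma>)) (ctxD \<Gamma>) \<and> Comp D (\<kappa> \<Gamma>) k = Id D (mO F (ctxC \<Gamma>))"
proof (induction \<Gamma>)
  case Nil
  note F1 = mO_Ob[OF C.One_Ob]
  have k: "\<kappa> [] \<in> hom D (One D) (mO F (One C))" using \<kappa>_hom[of "[]"] Nil by simp
  have "Comp D (\<kappa> []) (bang D (mO F (One C))) = Id D (mO F (One C))"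
    by (rule D.terminal_eq[OF pres_terminal[OF C.One_terminal] D.Comp_hom[OF D.bang_hom[OF F1] k] D.Id_hom[OF F1]])
  then show ?case using D.bang_hom[OF F1] by (auto simp del: ctx_map.simps)
next
  case (Cons \<sigma> \<Gamma>)
  then have ctx: "context_of \<Sigma> \<Gamma>" and s: "s_sort M \<sigma> \<in> Ob C"
    by (auto simp: context_of_def M.sort_Ob)
  note ob = M.sem_ctx_Ob[OF ctx] s
  note k = \<kappa>_hom[OF ctx]
  note p = D.prd_id_hom[OF k mO_Ob[OF s]]
  note F_pr = mM_hom[OF C.Pr1_hom[OF ob]] mM_hom[OF C.Pr2_hom[OF ob]]
  obtain j where j: "j \<in> hom D (mO F (ctxC \<Gamma>)) (ctxD \<Gamma>)" "Comp D (\<kappa> \<Gamma>) j = Id D (mO F (ctxC \<Gamma>))"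
    using Cons.IH[OF ctx] by blast
  \<comment> \<open>This is the canonical morphism followed by \<open>j \<times> id\<close>; in the
    composite with \<open>\<kappa>\<close>, first \<open>j\<close> cancels and then the canonical
    isomorphism.\<close>
  let ?j = "pair D (Comp D j (mM F (Pr1 C (ctxC \<Gamma>) (s_sort M \<sigma>)))) (mM F (Pr2 C (ctxC \<Gamma>) (s_sort M \<sigma>)))"
  note j_pr = D.Comp_hom[OF F_pr(1) j(1)]
  note j' = D.pair_hom[OF j_pr F_pr(2)]
  have "Comp D (prd_id D (\<kappa> \<Gamma>) (mO F (s_sort M \<sigma>))) ?j = canon C D F (ctxC \<Gamma>) (s_sort M \<sigma>)"
    using D.prd_id_pair[OF k j_pr F_pr(2)] D.Comp_assoc[OF F_pr(1) j(1) k] j(2) D.Id_left[OF F_pr(1)]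
    by (simp add: canon_def)
  then have "Comp D (\<kappa> (\<sigma> # \<Gamma>)) ?j = Id D (mO F (ctxC (\<sigma> # \<Gamma>)))"
    using D.Comp_assoc[OF j' p canon(2)[OF ob]] canon(3)[OF ob] by simp
  then show ?case using j' by (auto simp: s_sort_N simp del: ctx_map.simps)
qed

lemma image_structure: "structure_in \<Sigma> D N"
  unfolding structure_in_def
proof (intro conjI ballI)
  show "s_sort N \<sigma> \<in> Ob D" if "\<sigma> \<in> sorts \<Sigma>" for \<sigma>
    using mO_Ob[OF M.sort_Ob[OF that]] by (simp add: s_sort_N)
  show "s_fun N f \<in> hom D (ctxD (fdom \<Sigma> f)) (s_sort N (fcod \<Sigma> f))" if "f \<in> funs \<Sigma>" for f
    using D.Comp_hom[OF \<kappa>_hom[OF M.fdom_sorts[OF that]] mM_hom[OF M.fun_hom[OF that]]]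
    by (simp add: image_struct_def)
  show "s_rel N R \<in> Fib D (ctxD (rdom \<Sigma> R))" if "R \<in> rels \<Sigma>" for R
    using D.Reix_Fib[OF \<kappa>_hom[OF M.rdom_sorts[OF that]]]
      mP_Fib[OF M.sem_ctx_Ob[OF M.rdom_sorts[OF that]] M.rel_Fib[OF that]]
    by (simp add: image_struct_def)
qed

sublocale N: FA_struct \<L> D \<Sigma> N
  by unfold_locales (use M.lang M.sgn image_structure in auto)

section \<open>Terms and formulas in the image structure\<close>

lemma sem_var_image:
  "context_of \<Sigma> \<Gamma> \<Longrightarrow> i < length \<Gamma> \<Longrightarrow> sem_var D N \<Gamma> i = Comp D (mM F (sem_var C M \<Gamma> i)) (\<kappa> \<Gamma>)"
proof (induction \<Gamma> arbitrary: i)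
  case (Cons \<sigma> \<Gamma>)
  then have ctx: "context_of \<Sigma> \<Gamma>" "\<sigma> \<in> sorts \<Sigma>" and s: "s_sort M \<sigma> \<in> Ob C"
    by (auto simp: context_of_def M.sort_Ob)
  note ob = M.sem_ctx_Ob[OF ctx(1)] s
  note ob' = N.sem_ctx_Ob[OF ctx(1)] N.sort_Ob[OF ctx(2)]
  show ?case
  proof (cases i)
    case 0
    then show ?thesis using \<kappa>_Cons(2)[OF ctx] by (simp del: ctx_map.simps)
  next
    case (Suc j)
    then have j: "j < length \<Gamma>" using Cons.prems by simp
    note v = M.sem_var_hom[OF ctx(1) j]
    have "sem_var D N (\<sigma> # \<Gamma>) i
        = Comp D (Comp D (mM F (sem_var C M \<Gamma> j)) (\<kappa> \<Gamma>)) (Pr1 D (ctxD \<Gamma>) (s_sort N \<sigma>))"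
      using Suc Cons.IH[OF ctx(1) j] by simp
    also have "\<dots> = Comp D (mM F (sem_var C M \<Gamma> j))
        (Comp D (mM F (Pr1 C (ctxC \<Gamma>) (s_sort M \<sigma>))) (\<kappa> (\<sigma> # \<Gamma>)))"
      using D.Comp_assoc[OF D.Pr1_hom[OF ob'] \<kappa>_hom[OF ctx(1)] mM_hom[OF v]] \<kappa>_Cons(1)[OF ctx] by simp
    also have "\<dots> = Comp D (Comp D (mM F (sem_var C M \<Gamma> j)) (mM F (Pr1 C (ctxC \<Gamma>) (s_sort M \<sigma>))))
        (\<kappa> (\<sigma> # \<Gamma>))"
      using D.Comp_assoc[OF \<kappa>_hom[OF Cons.prems(1)] _ mM_hom[OF v]] mM_hom[OF C.Pr1_hom[OF ob]] by simp
    also have "\<dots> = Comp D (mM F (sem_var C M (\<sigma> # \<Gamma>) i)) (\<kappa> (\<sigma> # \<Gamma>))"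
      using mM_Comp[OF C.Pr1_hom[OF ob] v] Suc by simp
    finally show ?thesis .
  qed
qed simp

text \<open>The image of a product is again a product cone, so the two arrows are compared by their
  projections, the first of which is the induction hypothesis. The factor
  \<open>\<kappa> \<Delta>\<close> accounts for the difference between a tuple of images and the
  image of a tuple.\<close>

lemma tuple_image:
  assumes "h \<in> hom D y (mO F x)" "x \<in> Ob C"
  shows "list_all2 (\<lambda>g \<sigma>. g \<in> hom C x (s_sort M \<sigma>)) gs \<Delta> \<Longrightarrow> context_of \<Sigma> \<Delta> \<Longrightarrow>
    Comp D (\<kappa> \<Delta>) (tuple D y (map (\<lambda>g. Comp D (mM F g) h) gs)) = Comp D (mM F (tuple C x gs)) h"
proof (induction rule: list_all2_induct)
  case Nil
  have "\<kappa> [] \<in> hom D (One D) (mO F (One C))" using \<kappa>_hom[OF Nil] by simp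
  note a = D.Comp_hom[OF D.bang_hom[OF D.hom_Ob(1)[OF assms(1)]] this]
  note b = D.Comp_hom[OF assms(1) mM_hom[OF C.bang_hom[OF assms(2)]]]
  show ?case
    using D.terminal_eq[OF pres_terminal[OF C.One_terminal] a b] by simp
next
  case (Cons g gs \<sigma> \<Delta>)
  then have ctx: "context_of \<Sigma> \<Delta>" "\<sigma> \<in> sorts \<Sigma>" and s: "s_sort M \<sigma> \<in> Ob C"
    by (auto simp: context_of_def M.sort_Ob)
  note ob = M.sem_ctx_Ob[OF ctx(1)] s
  note ob' = N.sem_ctx_Ob[OF ctx(1)] N.sort_Ob[OF ctx(2)]
  let ?gs = "map (\<lambda>g. Comp D (mM F g) h) gs" and ?g = "Comp D (mM F g) h"
  have hom': "k \<in> hom C x c \<Longrightarrow> Comp D (mM F k) h \<in> hom D y (mO F c)" for k c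
    by (rule D.Comp_hom[OF assms(1) mM_hom])
  have "list_all2 (\<lambda>g \<sigma>. g \<in> hom D y (s_sort N \<sigma>)) ?gs \<Delta>"
    using Cons.hyps(2) by (auto simp: list_all2_map1 s_sort_N hom' elim!: list_all2_mono)
  note T' = N.tuple_hom[OF D.hom_Ob(1)[OF assms(1)] this]
  have g': "?g \<in> hom D y (s_sort N \<sigma>)" using hom' Cons.hyps(1) by (simp add: s_sort_N)
  note p' = D.pair[OF T' g']
  note T = M.tuple_hom[OF assms(2) Cons.hyps(2)]
  note p = C.pair[OF T Cons.hyps(1)]
  note pr = mM_hom[OF C.Pr1_hom[OF ob]] mM_hom[OF C.Pr2_hom[OF ob]]
  have k: "\<kappa> (\<sigma> # \<Delta>) \<in> hom D (Prd D (ctxD \<Delta>) (s_sort N \<sigma>)) (mO F (Prd C (ctxC \<Delta>) (s_sort M \<sigma>)))"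
    using \<kappa>_hom[OF Cons.prems] by simp
  have "Comp D (\<kappa> (\<sigma> # \<Delta>)) (pair D (tuple D y ?gs) ?g)
      = Comp D (mM F (pair C (tuple C x gs) g)) h"
  proof (rule D.product_eq[OF product_image[OF ob] D.Comp_hom[OF p'(1) k] hom'[OF p(1)]])
    have "Comp D (mM F (Pr1 C (ctxC \<Delta>) (s_sort M \<sigma>))) (Comp D (\<kappa> (\<sigma> # \<Delta>)) (pair D (tuple D y ?gs) ?g))
        = Comp D (\<kappa> \<Delta>) (tuple D y ?gs)"
      using D.Comp_assoc[OF p'(1) k pr(1)] \<kappa>_Cons(1)[OF ctx] p'(2)
        D.Comp_assoc[OF p'(1) D.Pr1_hom[OF ob'] \<kappa>_hom[OF ctx(1)]] by (simp del: ctx_map.simps)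
    also have "\<dots> = Comp D (mM F (Pr1 C (ctxC \<Delta>) (s_sort M \<sigma>))) (Comp D (mM F (pair C (tuple C x gs) g)) h)"
      using Cons.IH[OF ctx(1)] D.Comp_assoc[OF assms(1) mM_hom[OF p(1)] pr(1)]
        mM_Comp[OF p(1) C.Pr1_hom[OF ob]] p(2) by simp
    finally show "Comp D (mM F (Pr1 C (ctxC \<Delta>) (s_sort M \<sigma>)))
          (Comp D (\<kappa> (\<sigma> # \<Delta>)) (pair D (tuple D y ?gs) ?g))
        = Comp D (mM F (Pr1 C (ctxC \<Delta>) (s_sort M \<sigma>))) (Comp D (mM F (pair C (tuple C x gs) g)) h)" .
    have "Comp D (mM F (Pr2 C (ctxC \<Delta>) (s_sort M \<sigma>))) (Comp D (\<kappa> (\<sigma> # \<Delta>)) (pair D (tuple D y ?gs) ?g)) = ?g"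
      using D.Comp_assoc[OF p'(1) k pr(2)] \<kappa>_Cons(2)[OF ctx] p'(3) by (simp del: ctx_map.simps)
    also have "\<dots> = Comp D (mM F (Pr2 C (ctxC \<Delta>) (s_sort M \<sigma>))) (Comp D (mM F (pair C (tuple C x gs) g)) h)"
      using D.Comp_assoc[OF assms(1) mM_hom[OF p(1)] pr(2)]
        mM_Comp[OF p(1) C.Pr2_hom[OF ob]] p(3) by simp
    finally show "Comp D (mM F (Pr2 C (ctxC \<Delta>) (s_sort M \<sigma>)))
          (Comp D (\<kappa> (\<sigma> # \<Delta>)) (pair D (tuple D y ?gs) ?g))
        = Comp D (mM F (Pr2 C (ctxC \<Delta>) (s_sort M \<sigma>))) (Comp D (mM F (pair C (tuple C x gs) g)) h)" .
  qed
  then show ?case by (simp del: ctx_map.simps)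
qed

text \<open>The first assumption has the shape of the induction hypothesis of
  \<open>term_in.induct\<close>, so the lemma can be used inside the induction on terms and again
  for relational atoms.\<close>

lemma sem_tms_image:
  assumes "list_all2 (\<lambda>t \<sigma>. term_in \<Sigma> \<Gamma> t \<sigma> \<and> sem_tm D N \<Gamma> t = Comp D (mM F (sem_tm C M \<Gamma> t)) (\<kappa> \<Gamma>)) ts \<Delta>"
    and "context_of \<Sigma> \<Gamma>" "context_of \<Sigma> \<Delta>"
  shows "Comp D (\<kappa> \<Delta>) (tuple D (ctxD \<Gamma>) (map (sem_tm D N \<Gamma>) ts))
    = Comp D (mM F (tuple C (ctxC \<Gamma>) (map (sem_tm C M \<Gamma>) ts))) (\<kappa> \<Gamma>)"
proof -
  have "map (sem_tm D N \<Gamma>) ts = map (\<lambda>g. Comp D (mM F g) (\<kappa> \<Gamma>)) (map (sem_tm C M \<Gamma>) ts)"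
    using assms(1) by (auto simp: list_all2_conv_all_nth in_set_conv_nth)
  moreover have "list_all2 (term_in \<Sigma> \<Gamma>) ts \<Delta>"
    using assms(1) by (auto elim: list_all2_mono)
  ultimately show ?thesis
    using tuple_image[OF \<kappa>_hom[OF assms(2)] M.sem_ctx_Ob[OF assms(2)] M.sem_tms_hom assms(3)] assms(2)
    by metis
qed

lemma sem_tm_image:
  "term_in \<Sigma> \<Gamma> t \<sigma> \<Longrightarrow> context_of \<Sigma> \<Gamma> \<Longrightarrow> sem_tm D N \<Gamma> t = Comp D (mM F (sem_tm C M \<Gamma> t)) (\<kappa> \<Gamma>)"
proof (induction rule: term_in.induct)
  case (1 i)
  then show ?case using sem_var_image by simp
next
  case (2 f ts)
  let ?T = "tuple C (ctxC \<Gamma>) (map (sem_tm C M \<Gamma>) ts)" and ?T' = "tuple D (ctxD \<Gamma>) (map (sem_tm D N \<Gamma>) ts)"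
  have tms: "list_all2 (term_in \<Sigma> \<Gamma>) ts (fdom \<Sigma> f)"
    using 2(2) by (auto elim: list_all2_mono)
  note f = M.fun_hom[OF 2(1)]
  note T = M.tuple_hom[OF M.sem_ctx_Ob[OF 2(3)] M.sem_tms_hom[OF tms 2(3)]]
  note T' = N.tuple_hom[OF N.sem_ctx_Ob[OF 2(3)] N.sem_tms_hom[OF tms 2(3)]]
  have T_eq: "Comp D (\<kappa> (fdom \<Sigma> f)) ?T' = Comp D (mM F ?T) (\<kappa> \<Gamma>)"
    using 2 by (intro sem_tms_image M.fdom_sorts) (auto elim: list_all2_mono)
  have "sem_tm D N \<Gamma> (Fn f ts) = Comp D (Comp D (mM F (s_fun M f)) (\<kappa> (fdom \<Sigma> f))) ?T'"
    by (simp add: image_struct_def)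
  also have "\<dots> = Comp D (mM F (s_fun M f)) (Comp D (mM F ?T) (\<kappa> \<Gamma>))"
    using D.Comp_assoc[OF T' \<kappa>_hom[OF M.fdom_sorts[OF 2(1)]] mM_hom[OF f]] T_eq by simp
  also have "\<dots> = Comp D (mM F (Comp C (s_fun M f) ?T)) (\<kappa> \<Gamma>)"
    using D.Comp_assoc[OF \<kappa>_hom[OF 2(3)] mM_hom[OF T] mM_hom[OF f]] mM_Comp[OF T f] by simp
  finally show ?case by simp
qed

lemma sem_fm_image:
  "formula_in \<L> \<Sigma> \<Gamma> \<phi> \<Longrightarrow> context_of \<Sigma> \<Gamma> \<Longrightarrow>
    sem_fm D N \<Gamma> \<phi> = Reix D (\<kappa> \<Gamma>) (mP F (ctxC \<Gamma>) (sem_fm C M \<Gamma> \<phi>))"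
proof (induction rule: formula_in.induct)
  case (1 R \<Gamma> ts)
  let ?T = "tuple C (ctxC \<Gamma>) (map (sem_tm C M \<Gamma>) ts)" and ?T' = "tuple D (ctxD \<Gamma>) (map (sem_tm D N \<Gamma>) ts)"
  let ?R = "mP F (ctxC (rdom \<Sigma> R)) (s_rel M R)"
  note ctx = M.rdom_sorts[OF 1(1)]
  note T = M.tuple_hom[OF M.sem_ctx_Ob[OF 1(3)] M.sem_tms_hom[OF 1(2,3)]]
  note T' = N.tuple_hom[OF N.sem_ctx_Ob[OF 1(3)] N.sem_tms_hom[OF 1(2,3)]]
  note R = mP_Fib[OF M.sem_ctx_Ob[OF ctx] M.rel_Fib[OF 1(1)]]
  have T_eq: "Comp D (\<kappa> (rdom \<Sigma> R)) ?T' = Comp D (mM F ?T) (\<kappa> \<Gamma>)"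
    using 1 sem_tm_image by (intro sem_tms_image ctx) (auto elim: list_all2_mono)
  have "sem_fm D N \<Gamma> (RelF R ts) = Reix D ?T' (Reix D (\<kappa> (rdom \<Sigma> R)) ?R)"
    by (simp add: image_struct_def)
  also have "\<dots> = Reix D (\<kappa> \<Gamma>) (Reix D (mM F ?T) ?R)"
    using D.Reix_Comp[OF T' \<kappa>_hom[OF ctx] R] D.Reix_Comp[OF \<kappa>_hom[OF 1(3)] mM_hom[OF T] R] T_eq
    by simp
  finally show ?case using mP_natural[OF T M.rel_Fib[OF 1(1)]] by simp
next
  case (2 \<sigma> \<Gamma> t u)
  let ?t = "sem_tm C M \<Gamma> t" and ?u = "sem_tm C M \<Gamma> u" and ?s = "s_sort M \<sigma>"
  note k = \<kappa>_hom[OF 2(4)]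
  note s = M.sort_Ob[OF 2(1)]
  note tu = M.sem_tm_hom[OF 2(2,4)] M.sem_tm_hom[OF 2(3,4)]
  note p = C.pair_hom[OF tu]
  note Fp = mM_hom[OF p]
  note E = D.Equ_Fib[OF mO_Ob[OF s]]
  have "Reix D (\<kappa> \<Gamma>) (mP F (ctxC \<Gamma>) (sem_fm C M \<Gamma> (EqF \<sigma> t u)))
      = Reix D (\<kappa> \<Gamma>) (Reix D (mM F (pair C ?t ?u)) (Reix D (canon C D F ?s ?s) (Equ D (mO F ?s))))"
    using mP_natural[OF p C.Equ_Fib[OF s]] mP_Equ[OF s] by simp
  \<comment> \<open>The canonical morphism coming from the equality predicate is absorbed by turning
    the image of a pair into a pair of images.\<close>
  also have "\<dots> = Reix D (\<kappa> \<Gamma>) (Reix D (pair D (mM F ?t) (mM F ?u)) (Equ D (mO F ?s)))"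
    using D.Reix_Comp[OF Fp canon(1)[OF s s] E] canon_pair[OF tu] by simp
  also have "\<dots> = Reix D (pair D (Comp D (mM F ?t) (\<kappa> \<Gamma>)) (Comp D (mM F ?u) (\<kappa> \<Gamma>))) (Equ D (mO F ?s))"
    using D.Reix_Comp[OF k D.pair_hom[OF mM_hom[OF tu(1)] mM_hom[OF tu(2)]] E]
      D.pair_comp[OF mM_hom[OF tu(1)] mM_hom[OF tu(2)] k] by simp
  also have "\<dots> = sem_fm D N \<Gamma> (EqF \<sigma> t u)"
    using sem_tm_image[OF 2(2,4)] sem_tm_image[OF 2(3,4)] by (simp add: s_sort_N)
  finally show ?case by simp
next
  case (3 k \<phi>s \<Gamma>)
  have len: "length (map (sem_fm C M \<Gamma>) \<phi>s) = larity \<L> k" using 3(2) by simp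
  have fib: "set (map (sem_fm C M \<Gamma>) \<phi>s) \<subseteq> Fib C (ctxC \<Gamma>)" using 3(3,4) M.sem_fm_Fib by auto
  have len': "length (map (mP F (ctxC \<Gamma>)) (map (sem_fm C M \<Gamma>) \<phi>s)) = larity \<L> k" using len by simp
  have fib': "set (map (mP F (ctxC \<Gamma>)) (map (sem_fm C M \<Gamma>) \<phi>s)) \<subseteq> Fib D (mO F (ctxC \<Gamma>))"
    using fib mP_Fib[OF M.sem_ctx_Ob[OF 3(4)]] by auto
  have "map (sem_fm D N \<Gamma>) \<phi>s = map (Reix D (\<kappa> \<Gamma>)) (map (mP F (ctxC \<Gamma>)) (map (sem_fm C M \<Gamma>) \<phi>s))"
    using 3(3,4) by simp
  then show ?case
    using D.Reix_Con[OF 3(1) \<kappa>_hom[OF 3(4)] len' fib'] mP_Con[OF 3(1) M.sem_ctx_Ob[OF 3(4)] len fib]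
    unfolding sem_fm.simps by metis
next
  case (4 q \<sigma> \<Gamma> \<phi>)
  let ?s = "s_sort M \<sigma>" and ?r = "sem_fm C M (\<sigma> # \<Gamma>) \<phi>"
  note k = \<kappa>_hom[OF 4(5)]
  have ctx: "context_of \<Sigma> (\<sigma> # \<Gamma>)" using 4 by (simp add: context_of_def)
  note ob = M.sem_ctx_Ob[OF 4(5)] M.sort_Ob[OF 4(2)]
  note s = mO_Ob[OF ob(2)]
  note p = D.prd_id_hom[OF k s]
  have r: "?r \<in> Fib C (Prd C (ctxC \<Gamma>) ?s)" using M.sem_fm_Fib[OF 4(3) ctx] by simp
  note Fr = mP_Fib[OF C.Prd_Ob[OF ob] r]
  note R = D.Reix_Fib[OF canon(2)[OF ob] Fr]
  have "Reix D (\<kappa> \<Gamma>) (mP F (ctxC \<Gamma>) (sem_fm C M \<Gamma> (QuF q \<sigma> \<phi>)))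
      = Qu D q (ctxD \<Gamma>) (mO F ?s) (Reix D (prd_id D (\<kappa> \<Gamma>) (mO F ?s))
          (Reix D (inverse_arrow D (canon C D F (ctxC \<Gamma>) ?s)) (mP F (Prd C (ctxC \<Gamma>) ?s) ?r)))"
    using mP_Qu[OF 4(1) ob r] D.Qu_natural[OF 4(1) k s R] by simp
  \<comment> \<open>Naturality of the quantifier has produced reindexing along
    \<open>\<kappa> \<Gamma> \<times> id\<close>, and preservation of quantifiers the inverse
    canonical isomorphism. Their composite is by definition \<open>\<kappa>\<close> of the extended
    context.\<close>
  also have "\<dots> = Qu D q (ctxD \<Gamma>) (mO F ?s) (Reix D (\<kappa> (\<sigma> # \<Gamma>)) (mP F (ctxC (\<sigma> # \<Gamma>)) ?r))"
    using D.Reix_Comp[OF p canon(2)[OF ob] Fr] by simp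
  also have "\<dots> = sem_fm D N \<Gamma> (QuF q \<sigma> \<phi>)"
    using 4(4)[OF ctx] by (simp add: s_sort_N del: ctx_map.simps)
  finally show ?case by simp
qed

text \<open>Both \<open>F\<close> and reindexing are homomorphisms for tensor and unit, the unit
  being the value of an empty list of premises.\<close>

lemma foldr_tensor_image:
  assumes "h \<in> hom D y (mO F c)" "c \<in> Ob C"
  shows "set rs \<subseteq> Fib C c \<Longrightarrow>
    foldr (tensor_at \<L> D y) (map (\<lambda>r. Reix D h (mP F c r)) rs) (unit_at \<L> D y)
    = Reix D h (mP F c (foldr (tensor_at \<L> C c) rs (unit_at \<L> C c)))"
proof (induction rs)
  case Nil
  show ?case
    using mP_Con[of "lunit \<L>" c "[]"] D.Reix_Con[OF _ assms(1), of "lunit \<L>" "[]"] assms(2) M.lang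
    by (simp add: language_def)
next
  case (Cons r rs)
  let ?x = "foldr (tensor_at \<L> C c) rs (unit_at \<L> C c)"
  have fib: "r \<in> Fib C c" "?x \<in> Fib C c" using Cons.prems M.foldr_tensor_Fib[OF assms(2)] by auto
  then show ?case
    using Cons mP_Con[of "ltensor \<L>" c "[r, ?x]"] assms(2) M.lang mP_Fib[OF assms(2)]
      D.Reix_Con[OF _ assms(1), of "ltensor \<L>" "[mP F c r, mP F c ?x]"]
    by (simp add: language_def)
qed

text \<open>Values in the image structure are images of values in \<open>M\<close>, pulled back
  along \<open>\<kappa>\<close>. The section of \<open>\<kappa>\<close> undoes the pullback, and
  faithfulness and the order embedding undo \<open>F\<close>.\<close>

lemma satisfies_image_iff:
  assumes "faithful_functor C F" "pred_order_embedding C D F" "assertion_over \<L> \<Sigma> a"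
  shows "satisfies \<L> D N a \<longleftrightarrow> satisfies \<L> C M a"
proof (cases a)
  case (Equation \<Gamma> t u \<sigma>)
  then have ctx: "context_of \<Sigma> \<Gamma>" and tu: "term_in \<Sigma> \<Gamma> t \<sigma>" "term_in \<Sigma> \<Gamma> u \<sigma>"
    using assms(3) by auto
  note h = M.sem_tm_hom[OF tu(1) ctx] M.sem_tm_hom[OF tu(2) ctx]
  obtain k where k: "k \<in> hom D (mO F (ctxC \<Gamma>)) (ctxD \<Gamma>)" "Comp D (\<kappa> \<Gamma>) k = Id D (mO F (ctxC \<Gamma>))"
    using \<kappa>_right_inverse[OF ctx] by blast
  have cancel: "Comp D (Comp D (mM F f) (\<kappa> \<Gamma>)) k = mM F f" if "f \<in> hom C (ctxC \<Gamma>) c" for f c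
    using D.Comp_assoc[OF k(1) \<kappa>_hom[OF ctx] mM_hom[OF that]] k(2) D.Id_right[OF mM_hom[OF that]] by simp
  have "sem_tm D N \<Gamma> t = sem_tm D N \<Gamma> u \<longleftrightarrow> mM F (sem_tm C M \<Gamma> t) = mM F (sem_tm C M \<Gamma> u)"
    using sem_tm_image[OF tu(1) ctx] sem_tm_image[OF tu(2) ctx] cancel[OF h(1)] cancel[OF h(2)] by metis
  also have "\<dots> \<longleftrightarrow> sem_tm C M \<Gamma> t = sem_tm C M \<Gamma> u"
    using assms(1) h C.hom_Ob[OF h(1)] unfolding faithful_functor_def inj_on_def by metis
  finally show ?thesis using Equation by simp
next
  case (Sequent \<Gamma> \<phi>s \<phi>)
  then have ctx: "context_of \<Sigma> \<Gamma>" and fm: "\<forall>\<psi>\<in>set \<phi>s. formula_in \<L> \<Sigma> \<Gamma> \<psi>" "formula_in \<L> \<Sigma> \<Gamma> \<phi>"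
    using assms(3) by auto
  note ob = M.sem_ctx_Ob[OF ctx]
  note h = \<kappa>_hom[OF ctx]
  obtain k where k: "k \<in> hom D (mO F (ctxC \<Gamma>)) (ctxD \<Gamma>)" "Comp D (\<kappa> \<Gamma>) k = Id D (mO F (ctxC \<Gamma>))"
    using \<kappa>_right_inverse[OF ctx] by blast
  let ?x = "foldr (tensor_at \<L> C (ctxC \<Gamma>)) (map (sem_fm C M \<Gamma>) \<phi>s) (unit_at \<L> C (ctxC \<Gamma>))"
  let ?y = "sem_fm C M \<Gamma> \<phi>"
  have fib: "set (map (sem_fm C M \<Gamma>) \<phi>s) \<subseteq> Fib C (ctxC \<Gamma>)" "?y \<in> Fib C (ctxC \<Gamma>)"
    using fm ctx M.sem_fm_Fib by auto
  have x: "?x \<in> Fib C (ctxC \<Gamma>)" by (rule M.foldr_tensor_Fib[OF ob fib(1)])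
  have "map (sem_fm D N \<Gamma>) \<phi>s = map (\<lambda>r. Reix D (\<kappa> \<Gamma>) (mP F (ctxC \<Gamma>) r)) (map (sem_fm C M \<Gamma>) \<phi>s)"
    using fm(1) ctx sem_fm_image by simp
  then have "satisfies \<L> D N a \<longleftrightarrow>
      (Reix D (\<kappa> \<Gamma>) (mP F (ctxC \<Gamma>) ?x), Reix D (\<kappa> \<Gamma>) (mP F (ctxC \<Gamma>) ?y)) \<in> Le D (ctxD \<Gamma>)"
    using foldr_tensor_image[OF h ob fib(1)] sem_fm_image[OF fm(2) ctx] Sequent
    by (simp add: Let_def del: map_map map_eq_conv)
  \<comment> \<open>From left to right the inequality is reindexed along the section
    \<open>k\<close>, which cancels \<open>\<kappa>\<close>; from right to left it is reindexed
    along \<open>\<kappa>\<close>.\<close>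
  also have "\<dots> \<longleftrightarrow> (mP F (ctxC \<Gamma>) ?x, mP F (ctxC \<Gamma>) ?y) \<in> Le D (mO F (ctxC \<Gamma>))"
    using D.Reix_mono[OF h] D.Reix_mono[OF k(1)]
      D.Reix_cancel[OF k(1) h k(2) mP_Fib[OF ob x]] D.Reix_cancel[OF k(1) h k(2) mP_Fib[OF ob fib(2)]]
    by metis
  also have "\<dots> \<longleftrightarrow> (?x, ?y) \<in> Le C (ctxC \<Gamma>)"
    using assms(2) ob x fib(2) unfolding pred_order_embedding_def by blast
  finally show ?thesis using Sequent by (simp add: Let_def)
qed

end

text \<open>Both directions of the equivalence are used: preservation turns a model of
  \<open>T\<close> in \<open>C\<close> into one in \<open>D\<close>, where \<open>T'\<close> holds
  because \<open>D\<close> validates the logic, and reflection brings \<open>T'\<close>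
  back.\<close>

lemma (in FA_functor) FA_logic_object_reflect:
  fixes Lg :: "('s, 'f, 'r, 'q, 'k) logic"
  assumes "language \<L>" "faithful_functor C F" "pred_order_embedding C D F" "FA_logic_object \<L> Lg D"
  shows "FA_logic_object \<L> Lg C"
  unfolding FA_logic_object_def sem_entails_def
proof (intro conjI allI impI ballI)
  show "FA_object \<L> C" by (rule C.FA_object_axioms)
  fix \<Sigma> :: "('s, 'f, 'r) sig" and T T' M a
  assume T: "signature \<Sigma> \<and> theory_over \<L> \<Sigma> T \<and> theory_over \<L> \<Sigma> T' \<and> entails Lg \<Sigma> T T'"
    and M: "model_of \<L> \<Sigma> C T M" and a: "a \<in> T'"
  interpret FA_functor_struct \<L> C D F \<Sigma> M
    by unfold_locales (use assms(1) T M in \<open>auto simp: model_of_def\<close>)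
  have sat: "satisfies \<L> D N b \<longleftrightarrow> satisfies \<L> C M b" if "assertion_over \<L> \<Sigma> b" for b
    using satisfies_image_iff assms(2,3) that by blast
  have "model_of \<L> \<Sigma> D T N"
    using T M sat image_structure by (auto simp: model_of_def theory_over_def)
  then have "satisfies \<L> D N a"
    using assms(4) T a unfolding FA_logic_object_def sem_entails_def by blast
  then show "satisfies \<L> C M a" using sat T a by (auto simp: theory_over_def)
qed

section \<open>The image of a morphism\<close>

text \<open>The choice depends on \<open>f\<close> only through its endpoints and its image, so
  parallel arrows with equal images share a representative, whereas arrows with different endpoints
  are never identified.\<close>

definition ar_rep ::
  "('o1, 'm1, 'p1, 'q, 'k) propcat \<Rightarrow> ('o1, 'm1, 'p1, 'o2, 'm2, 'p2) mor \<Rightarrow> 'm1 \<Rightarrow> 'm1" where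
  "ar_rep C F f = (SOME g. g \<in> hom C (Dom C f) (Cod C f) \<and> mM F g = mM F f)"

definition pr_rep ::
  "('o1, 'm1, 'p1, 'q, 'k) propcat \<Rightarrow> ('o1, 'm1, 'p1, 'o2, 'm2, 'p2) mor \<Rightarrow> 'o1 \<Rightarrow> 'p1 \<Rightarrow> 'p1" where
  "pr_rep C F c r = (SOME s. s \<in> Fib C c \<and> mP F c s = mP F c r)"

text \<open>Every operation is that of \<open>C\<close> followed by a choice of representative. The
  order, however, is pulled back from \<open>D\<close>: the image of the order of \<open>C\<close>
  could be too small for the second factor to be an order embedding.\<close>

definition image_object ::
  "('o1, 'm1, 'p1, 'q, 'k) propcat \<Rightarrow> ('o2, 'm2, 'p2, 'q, 'k) propcat
    \<Rightarrow> ('o1, 'm1, 'p1, 'o2, 'm2, 'p2) mor \<Rightarrow> ('o1, 'm1, 'p1, 'q, 'k) propcat" where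
  "image_object C D F =
     \<lparr> Ob = Ob C, Ar = ar_rep C F ` Ar C, Dom = Dom C, Cod = Cod C,
       Id = (\<lambda>a. ar_rep C F (Id C a)),
       Comp = (\<lambda>g f. ar_rep C F (Comp C g f)),
       One = One C, Prd = Prd C,
       Pr1 = (\<lambda>a b. ar_rep C F (Pr1 C a b)),
       Pr2 = (\<lambda>a b. ar_rep C F (Pr2 C a b)),
       Fib = (\<lambda>c. pr_rep C F c ` Fib C c),
       Le = (\<lambda>c. {(r, s). r \<in> pr_rep C F c ` Fib C c \<and> s \<in> pr_rep C F c ` Fib C c \<and>
         (mP F c r, mP F c s) \<in> Le D (mO F c)}),
       Reix = (\<lambda>f r. pr_rep C F (Dom C f) (Reix C f r)),
       Con = (\<lambda>k c rs. pr_rep C F c (Con C k c rs)),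
       Qu = (\<lambda>q b c r. pr_rep C F b (Qu C q b c r)),
       Equ = (\<lambda>c. pr_rep C F (Prd C c c) (Equ C c)) \<rparr>"

definition image_proj ::
  "('o1, 'm1, 'p1, 'q, 'k) propcat \<Rightarrow> ('o1, 'm1, 'p1, 'o2, 'm2, 'p2) mor
    \<Rightarrow> ('o1, 'm1, 'p1, 'o1, 'm1, 'p1) mor" where
  "image_proj C F =
     \<lparr> mO = (\<lambda>c\<in>Ob C. c), mM = restrict (ar_rep C F) (Ar C),
       mP = (\<lambda>c\<in>Ob C. restrict (pr_rep C F c) (Fib C c)) \<rparr>"

locale FA_image = FA_functor \<L> C D F
  for \<L> :: "('q, 'k) lang"
    and C :: "('o1, 'm1, 'p1, 'q, 'k) propcat" and D :: "('o2, 'm2, 'p2, 'q, 'k) propcat"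
    and F :: "('o1, 'm1, 'p1, 'o2, 'm2, 'p2) mor" +
  assumes lang: "language \<L>"
begin

abbreviation E :: "('o1, 'm1, 'p1, 'q, 'k) propcat" where "E \<equiv> image_object C D F"
abbreviation \<rho> :: "'m1 \<Rightarrow> 'm1" where "\<rho> \<equiv> ar_rep C F"
abbreviation \<pi> :: "'o1 \<Rightarrow> 'p1 \<Rightarrow> 'p1" where "\<pi> \<equiv> pr_rep C F"

lemma E_simps:
  "Ob E = Ob C" "One E = One C" "Prd E = Prd C"
  "Id E a = \<rho> (Id C a)" "Comp E g f = \<rho> (Comp C g f)" "Pr1 E a b = \<rho> (Pr1 C a b)" "Pr2 E a b = \<rho> (Pr2 C a b)"
  "Fib E c = \<pi> c ` Fib C c" "Reix E f r = \<pi> (Dom C f) (Reix C f r)" "Con E k c rs = \<pi> c (Con C k c rs)"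
  "Qu E q b c r = \<pi> b (Qu C q b c r)" "Equ E c = \<pi> (Prd C c c) (Equ C c)"
  by (simp_all add: image_object_def)

lemma \<rho>:
  assumes "f \<in> hom C a b"
  shows \<rho>_hom: "\<rho> f \<in> hom C a b" and mM_\<rho>: "mM F (\<rho> f) = mM F f"
  using someI[of "\<lambda>g. g \<in> hom C (Dom C f) (Cod C f) \<and> mM F g = mM F f" f] assms
  unfolding ar_rep_def by (auto simp: homD[OF assms])

lemma \<rho>_cong: "f \<in> hom C a b \<Longrightarrow> g \<in> hom C a b \<Longrightarrow> mM F f = mM F g \<Longrightarrow> \<rho> f = \<rho> g"
  unfolding ar_rep_def by (simp add: homD)

lemma \<pi>:
  assumes "r \<in> Fib C c"
  shows \<pi>_Fib_C: "\<pi> c r \<in> Fib C c" and mP_\<pi>: "mP F c (\<pi> c r) = mP F c r"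
  using someI[of "\<lambda>s. s \<in> Fib C c \<and> mP F c s = mP F c r" r] assms
  unfolding pr_rep_def by auto

lemma \<pi>_cong: "mP F c r = mP F c s \<Longrightarrow> \<pi> c r = \<pi> c s"
  unfolding pr_rep_def by simp

text \<open>Choosing a representative a second time changes nothing, so the arrows of
  \<open>E\<close> are the fixed points of \<open>\<rho>\<close>.\<close>

lemma hom_E_iff: "f \<in> hom E a b \<longleftrightarrow> f \<in> hom C a b \<and> \<rho> f = f"
proof
  assume f: "f \<in> hom E a b"
  then obtain g where g: "g \<in> Ar C" "f = \<rho> g" and d: "Dom C f = a" "Cod C f = b"
    by (auto simp: hom_def image_object_def)
  have "g \<in> hom C (Dom C g) (Cod C g)" using g by (simp add: hom_def)
  note r = \<rho>[OF this, folded g(2)]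
  then have "f \<in> hom C a b" "g \<in> hom C a b" using d g(1) by (auto simp: hom_def)
  then show "f \<in> hom C a b \<and> \<rho> f = f" using \<rho>_cong r(2) g(2) by metis
next
  assume f: "f \<in> hom C a b \<and> \<rho> f = f"
  then have "f \<in> \<rho> ` Ar C" using homD(1) by (metis imageI)
  then show "f \<in> hom E a b" using f by (simp add: hom_def image_object_def)
qed

lemma hom_E_C: "f \<in> hom E a b \<Longrightarrow> f \<in> hom C a b"
  by (simp add: hom_E_iff)

lemma \<rho>_hom_E: "f \<in> hom C a b \<Longrightarrow> \<rho> f \<in> hom E a b"
  unfolding hom_E_iff using \<rho> \<rho>_cong by blast

text \<open>Parallel arrows with equal images have the same representative, and arrows of
  \<open>E\<close> represent themselves. The laws of \<open>E\<close> are checked after applying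
  \<open>F\<close> by this lemma and its counterpart \<open>pr_E_eqI\<close>.\<close>

lemma ar_E_eqI: "f \<in> hom E a b \<Longrightarrow> g \<in> hom E a b \<Longrightarrow> mM F f = mM F g \<Longrightarrow> f = g"
  unfolding hom_E_iff using \<rho>_cong by metis

lemma Fib_E_iff: "r \<in> Fib E c \<longleftrightarrow> r \<in> Fib C c \<and> \<pi> c r = r"
  unfolding E_simps using \<pi>[of _ c] \<pi>_cong[of c] by (metis (no_types, lifting) image_iff)

lemma Fib_E_C: "r \<in> Fib E c \<Longrightarrow> r \<in> Fib C c"
  by (simp add: Fib_E_iff)

lemma \<pi>_Fib_E: "r \<in> Fib C c \<Longrightarrow> \<pi> c r \<in> Fib E c"
  by (simp add: E_simps)

lemma pr_E_eqI: "r \<in> Fib E c \<Longrightarrow> s \<in> Fib E c \<Longrightarrow> mP F c r = mP F c s \<Longrightarrow> r = s"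
  unfolding Fib_E_iff using \<pi>_cong by metis

lemma Le_E_iff:
  "(r, s) \<in> Le E c \<longleftrightarrow> r \<in> Fib E c \<and> s \<in> Fib E c \<and> (mP F c r, mP F c s) \<in> Le D (mO F c)"
  by (simp add: image_object_def)

section \<open>Finite products in the image\<close>

lemma Comp_E_hom: "f \<in> hom E a b \<Longrightarrow> g \<in> hom E b c \<Longrightarrow> Comp E g f \<in> hom E a c"
  unfolding E_simps by (intro \<rho>_hom_E C.Comp_hom[of _ _ b]) (auto dest: hom_E_C)

lemma mM_Comp_E:
  "f \<in> hom E a b \<Longrightarrow> g \<in> hom E b c \<Longrightarrow> mM F (Comp E g f) = Comp D (mM F g) (mM F f)"
  using mM_\<rho>[OF C.Comp_hom] mM_Comp hom_E_C E_simps(5) by metis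

lemma Id_E_hom: "a \<in> Ob C \<Longrightarrow> Id E a \<in> hom E a a"
  unfolding E_simps by (intro \<rho>_hom_E C.Id_hom)

lemma mM_Id_E: "a \<in> Ob C \<Longrightarrow> mM F (Id E a) = Id D (mO F a)"
  using mM_\<rho>[OF C.Id_hom] mM_Id E_simps(4) by metis

lemma Pr_E_hom:
  assumes "a \<in> Ob C" "b \<in> Ob C"
  shows "Pr1 E a b \<in> hom E (Prd C a b) a" "Pr2 E a b \<in> hom E (Prd C a b) b"
  unfolding E_simps using \<rho>_hom_E C.Pr1_hom[OF assms] C.Pr2_hom[OF assms] by auto

lemma mM_Pr_E:
  assumes "a \<in> Ob C" "b \<in> Ob C"
  shows "mM F (Pr1 E a b) = mM F (Pr1 C a b)" "mM F (Pr2 E a b) = mM F (Pr2 C a b)"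
  unfolding E_simps using mM_\<rho> C.Pr1_hom[OF assms] C.Pr2_hom[OF assms] by auto

text \<open>Mediating arrows exist because they exist in \<open>C\<close>. Their uniqueness comes
  from \<open>D\<close>: as \<open>F\<close> preserves terminal objects and products, two candidates
  have the same image and so are equal.\<close>

lemma fp_category_E: "fp_category E"
proof
  show "Dom E f \<in> Ob E" "Cod E f \<in> Ob E" if "f \<in> Ar E" for f
    using C.hom_Ob[OF hom_E_C[OF homI[OF that refl refl]]] by (simp_all add: E_simps)
  show "Id E a \<in> hom E a a" if "a \<in> Ob E" for a
    using that Id_E_hom by (simp add: E_simps(1))
  show "Comp E g f \<in> hom E a c" if "f \<in> hom E a b" "g \<in> hom E b c" for f g a b c
    using that by (rule Comp_E_hom)
  show "Comp E f (Id E a) = f" if f: "f \<in> hom E a b" for f a b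
  proof -
    note i = Id_E_hom[OF C.hom_Ob(1)[OF hom_E_C[OF f]]]
    show ?thesis
      using mM_Comp_E[OF i f] mM_Id_E C.hom_Ob[OF hom_E_C[OF f]] D.Id_right[OF mM_hom[OF hom_E_C[OF f]]]
      by (intro ar_E_eqI[OF Comp_E_hom[OF i f] f]) simp
  qed
  show "Comp E (Id E b) f = f" if f: "f \<in> hom E a b" for f a b
  proof -
    note i = Id_E_hom[OF C.hom_Ob(2)[OF hom_E_C[OF f]]]
    show ?thesis
      using mM_Comp_E[OF f i] mM_Id_E C.hom_Ob[OF hom_E_C[OF f]] D.Id_left[OF mM_hom[OF hom_E_C[OF f]]]
      by (intro ar_E_eqI[OF Comp_E_hom[OF f i] f]) simp
  qed
  show "Comp E (Comp E h g) f = Comp E h (Comp E g f)"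
    if f: "f \<in> hom E a b" and g: "g \<in> hom E b c" and h: "h \<in> hom E c d" for f g h a b c d
  proof -
    note gf = Comp_E_hom[OF f g] and hg = Comp_E_hom[OF g h]
    show ?thesis
      using mM_Comp_E[OF f g] mM_Comp_E[OF g h] mM_Comp_E[OF f hg] mM_Comp_E[OF gf h]
        D.Comp_assoc[OF mM_hom mM_hom mM_hom, OF hom_E_C hom_E_C hom_E_C, OF f g h]
      by (intro ar_E_eqI[OF Comp_E_hom[OF f hg] Comp_E_hom[OF gf h]]) simp
  qed
  show "is_terminal E (One E)"
    unfolding is_terminal_def
  proof (intro conjI ballI)
    show "One E \<in> Ob E" using C.One_Ob by (simp add: E_simps)
    fix x assume "x \<in> Ob E"
    then have bang: "\<rho> (bang C x) \<in> hom E x (One C)"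
      using \<rho>_hom_E[OF C.bang_hom] by (simp add: E_simps)
    show "\<exists>!h. h \<in> hom E x (One E)"
      unfolding E_simps(2)
    proof (rule ex1I, rule bang)
      fix h assume h: "h \<in> hom E x (One C)"
      show "h = \<rho> (bang C x)"
        by (rule ar_E_eqI[OF h bang D.terminal_eq[OF pres_terminal[OF C.One_terminal]
              mM_hom[OF hom_E_C[OF h]] mM_hom[OF hom_E_C[OF bang]]]])
    qed
  qed
  show "is_product E a b (Prd E a b) (Pr1 E a b) (Pr2 E a b)" if "a \<in> Ob E" "b \<in> Ob E" for a b
  proof -
    have ob: "a \<in> Ob C" "b \<in> Ob C" using that by (auto simp: E_simps)
    have p: "Prd E a b = Prd C a b" by (simp add: E_simps)
    note pr = Pr_E_hom[OF ob]
    show ?thesis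
      unfolding is_product_def p
    proof (intro conjI ballI)
      fix x f g assume fg: "f \<in> hom E x a" "g \<in> hom E x b"
      note h = C.pair[OF hom_E_C[OF fg(1)] hom_E_C[OF fg(2)]]
      note h' = \<rho>_hom_E[OF h(1)] mM_\<rho>[OF h(1)]
      show "\<exists>!h. h \<in> hom E x (Prd C a b) \<and> Comp E (Pr1 E a b) h = f \<and> Comp E (Pr2 E a b) h = g"
      proof (rule ex1I[of _ "\<rho> (pair C f g)"], intro conjI)
        show "\<rho> (pair C f g) \<in> hom E x (Prd C a b)" by fact
        show "Comp E (Pr1 E a b) (\<rho> (pair C f g)) = f"
          using mM_Comp_E[OF h'(1) pr(1)] mM_Comp[OF h(1) C.Pr1_hom[OF ob]] h(2) h'(2) mM_Pr_E[OF ob]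
          by (intro ar_E_eqI[OF Comp_E_hom[OF h'(1) pr(1)] fg(1)]) simp
        show "Comp E (Pr2 E a b) (\<rho> (pair C f g)) = g"
          using mM_Comp_E[OF h'(1) pr(2)] mM_Comp[OF h(1) C.Pr2_hom[OF ob]] h(3) h'(2) mM_Pr_E[OF ob]
          by (intro ar_E_eqI[OF Comp_E_hom[OF h'(1) pr(2)] fg(2)]) simp
        fix k assume k: "k \<in> hom E x (Prd C a b) \<and> Comp E (Pr1 E a b) k = f \<and> Comp E (Pr2 E a b) k = g"
        then have k1: "k \<in> hom E x (Prd C a b)" by simp
        show "k = \<rho> (pair C f g)"
        proof (rule ar_E_eqI[OF k1 h'(1)], rule D.product_eq[OF product_image[OF ob]])
          show "mM F k \<in> hom D (mO F x) (mO F (Prd C a b))"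
            "mM F (\<rho> (pair C f g)) \<in> hom D (mO F x) (mO F (Prd C a b))"
            using mM_hom hom_E_C k1 h'(1) by blast+
          show "Comp D (mM F (Pr1 C a b)) (mM F k) = Comp D (mM F (Pr1 C a b)) (mM F (\<rho> (pair C f g)))"
            using mM_Comp_E[OF k1 pr(1)] mM_Pr_E[OF ob] h h' k mM_Comp[OF h(1) C.Pr1_hom[OF ob]] by simp
          show "Comp D (mM F (Pr2 C a b)) (mM F k) = Comp D (mM F (Pr2 C a b)) (mM F (\<rho> (pair C f g)))"
            using mM_Comp_E[OF k1 pr(2)] mM_Pr_E[OF ob] h h' k mM_Comp[OF h(1) C.Pr2_hom[OF ob]] by simp
        qed
      qed
    qed (use ob pr C.Prd_Ob[OF ob] in \<open>auto simp: E_simps(1)\<close>)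
  qed
qed

sublocale E: fp_category E by (rule fp_category_E)

text \<open>The components enter the right-hand side only through their images. The pairing of
  \<open>E\<close> satisfies the same formula, so arrows built by pairing and composition in
  \<open>C\<close> and in \<open>E\<close> have equal images.\<close>

lemma mM_pair:
  assumes "f \<in> hom C x a" "g \<in> hom C x b"
  shows "mM F (pair C f g) = Comp D (inverse_arrow D (canon C D F a b)) (pair D (mM F f) (mM F g))"
proof -
  have ob: "a \<in> Ob C" "b \<in> Ob C" using C.hom_Ob assms by blast+
  note p = mM_hom[OF C.pair_hom[OF assms]]
  show ?thesis
    using canon_pair[OF assms] D.Comp_assoc[OF p canon(1,2)[OF ob]] canon(3)[OF ob] D.Id_left[OF p] by simp
qed

lemma mM_pair_E:
  assumes "f \<in> hom E x a" "g \<in> hom E x b"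
  shows "mM F (pair E f g) = Comp D (inverse_arrow D (canon C D F a b)) (pair D (mM F f) (mM F g))"
proof -
  have ob: "a \<in> Ob C" "b \<in> Ob C" using C.hom_Ob assms hom_E_C by blast+
  note fg = hom_E_C[OF assms(1)] hom_E_C[OF assms(2)]
  note h = C.pair[OF fg]
  note h' = \<rho>_hom_E[OF h(1)] mM_\<rho>[OF h(1)]
  note pr = Pr_E_hom[OF ob]
  have "pair E f g = \<rho> (pair C f g)"
  proof (rule E.pair_eqI)
    show "\<rho> (pair C f g) \<in> hom E x (Prd E a b)" using h'(1) by (simp add: E_simps(3))
    show "Comp E (Pr1 E a b) (\<rho> (pair C f g)) = f"
      using mM_Comp_E[OF h'(1) pr(1)] mM_Comp[OF h(1) C.Pr1_hom[OF ob]] h(2) h'(2) mM_Pr_E[OF ob]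
      by (intro ar_E_eqI[OF Comp_E_hom[OF h'(1) pr(1)] assms(1)]) simp
    show "Comp E (Pr2 E a b) (\<rho> (pair C f g)) = g"
      using mM_Comp_E[OF h'(1) pr(2)] mM_Comp[OF h(1) C.Pr2_hom[OF ob]] h(3) h'(2) mM_Pr_E[OF ob]
      by (intro ar_E_eqI[OF Comp_E_hom[OF h'(1) pr(2)] assms(2)]) simp
  qed (use ob in \<open>auto simp: E_simps(1)\<close>)
  then show ?thesis using h'(2) mM_pair[OF fg] by simp
qed

lemma mM_prd_id_E:
  assumes "f \<in> hom E a b" "c \<in> Ob C"
  shows "mM F (prd_id E f c) = mM F (prd_id C f c)"
proof -
  note f = hom_E_C[OF assms(1)]
  note ob = C.hom_Ob(1)[OF f] assms(2)
  note pr = Pr_E_hom[OF ob] and pr' = C.Pr1_hom[OF ob] C.Pr2_hom[OF ob]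
  show ?thesis
    unfolding prd_id_def homD[OF assms(1)] homD[OF f]
      mM_pair_E[OF Comp_E_hom[OF pr(1) assms(1)] pr(2)] mM_pair[OF C.Comp_hom[OF pr'(1) f] pr'(2)]
      mM_Comp_E[OF pr(1) assms(1)] mM_Comp[OF pr'(1) f] mM_Pr_E[OF ob] ..
qed

lemma mM_assoc_arrow_E:
  assumes "b \<in> Ob C" "c \<in> Ob C" "d \<in> Ob C"
  shows "mM F (assoc_arrow E b c d) = mM F (assoc_arrow C b c d)"
proof -
  note cd = C.Prd_Ob[OF assms(2,3)]
  note pr = Pr_E_hom[OF assms(2,3)] and pr' = C.Pr1_hom[OF assms(2,3)] C.Pr2_hom[OF assms(2,3)]
  note q = Pr_E_hom[OF assms(1) cd] and q' = C.Pr1_hom[OF assms(1) cd] C.Pr2_hom[OF assms(1) cd]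
  note f = Comp_E_hom[OF q(2) pr(1)] and f' = C.Comp_hom[OF q'(2) pr'(1)]
  note g = Comp_E_hom[OF q(2) pr(2)] and g' = C.Comp_hom[OF q'(2) pr'(2)]
  show ?thesis
    unfolding assoc_arrow_def Let_def E_simps(3)
      mM_pair_E[OF E.pair_hom[OF q(1) f, unfolded E_simps(3)] g] mM_pair[OF C.pair_hom[OF q'(1) f'] g']
      mM_pair_E[OF q(1) f] mM_pair[OF q'(1) f']
      mM_Comp_E[OF q(2) pr(1)] mM_Comp[OF q'(2) pr'(1)] mM_Comp_E[OF q(2) pr(2)] mM_Comp[OF q'(2) pr'(2)]
      mM_Pr_E[OF assms(2,3)] mM_Pr_E[OF assms(1) cd] ..
qed

section \<open>Predicates of the image\<close>

lemma Reix_E_Fib: "f \<in> hom C a b \<Longrightarrow> r \<in> Fib C b \<Longrightarrow> Reix E f r \<in> Fib E a"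
  using \<pi>_Fib_E[OF C.Reix_Fib] by (simp add: E_simps(9) homD)

lemma mP_Reix_E:
  "f \<in> hom C a b \<Longrightarrow> r \<in> Fib C b \<Longrightarrow> mP F a (Reix E f r) = Reix D (mM F f) (mP F b r)"
  using mP_\<pi>[OF C.Reix_Fib] by (simp add: E_simps(9) homD mP_natural)

lemma Con_E_Fib:
  "\<lbrakk>k \<in> lconns \<L>; c \<in> Ob C; length rs = larity \<L> k; set rs \<subseteq> Fib C c\<rbrakk> \<Longrightarrow> Con E k c rs \<in> Fib E c"
  using \<pi>_Fib_E[OF C.Con_Fib] by (simp add: E_simps(10))

lemma mP_Con_E:
  "\<lbrakk>k \<in> lconns \<L>; c \<in> Ob C; length rs = larity \<L> k; set rs \<subseteq> Fib C c\<rbrakk>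
    \<Longrightarrow> mP F c (Con E k c rs) = Con D k (mO F c) (map (mP F c) rs)"
  using mP_\<pi>[OF C.Con_Fib] by (simp add: E_simps(10) mP_Con)

lemma Qu_E_Fib:
  "\<lbrakk>q \<in> lquants \<L>; b \<in> Ob C; c \<in> Ob C; r \<in> Fib C (Prd C b c)\<rbrakk> \<Longrightarrow> Qu E q b c r \<in> Fib E b"
  using \<pi>_Fib_E[OF C.Qu_Fib] by (simp add: E_simps(11))

lemma mP_Qu_E:
  "\<lbrakk>q \<in> lquants \<L>; b \<in> Ob C; c \<in> Ob C; r \<in> Fib C (Prd C b c)\<rbrakk> \<Longrightarrow> mP F b (Qu E q b c r) =
      Qu D q (mO F b) (mO F c) (Reix D (inverse_arrow D (canon C D F b c)) (mP F (Prd C b c) r))"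
  using mP_\<pi>[OF C.Qu_Fib] by (simp add: E_simps(11) mP_Qu)

lemma Equ_E_Fib: "c \<in> Ob C \<Longrightarrow> Equ E c \<in> Fib E (Prd C c c)"
  using \<pi>_Fib_E[OF C.Equ_Fib] by (simp add: E_simps(12))

lemma mP_Equ_E: "c \<in> Ob C \<Longrightarrow> mP F (Prd C c c) (Equ E c) = mP F (Prd C c c) (Equ C c)"
  using mP_\<pi>[OF C.Equ_Fib] by (simp add: E_simps(12))

lemma lconns: "lunit \<L> \<in> lconns \<L>" "larity \<L> (lunit \<L>) = 0" "ltensor \<L> \<in> lconns \<L>" "larity \<L> (ltensor \<L>) = 2"
  using lang by (auto simp: language_def)

lemma unit_E_Fib: "c \<in> Ob C \<Longrightarrow> unit_at \<L> E c \<in> Fib E c"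
  using Con_E_Fib lconns by simp

lemma mP_unit_E: "c \<in> Ob C \<Longrightarrow> mP F c (unit_at \<L> E c) = unit_at \<L> D (mO F c)"
  using mP_Con_E lconns by simp

lemma tensor_E_Fib: "c \<in> Ob C \<Longrightarrow> x \<in> Fib E c \<Longrightarrow> y \<in> Fib E c \<Longrightarrow> tensor_at \<L> E c x y \<in> Fib E c"
  using Con_E_Fib[of "ltensor \<L>" c "[x, y]"] lconns Fib_E_C by simp

lemma mP_tensor_E:
  "c \<in> Ob C \<Longrightarrow> x \<in> Fib E c \<Longrightarrow> y \<in> Fib E c
    \<Longrightarrow> mP F c (tensor_at \<L> E c x y) = tensor_at \<L> D (mO F c) (mP F c x) (mP F c y)"
  using mP_Con_E[of "ltensor \<L>" c "[x, y]"] lconns Fib_E_C by simp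

text \<open>The order, reindexing and monoid laws reduce to those of \<open>D\<close>. The laws for
  quantifiers, and the one for equality on products, are instead taken from \<open>C\<close>: the
  operations of \<open>E\<close> and \<open>C\<close> have equal images, so no canonical isomorphism
  has to be moved about in \<open>D\<close>.\<close>

lemma FA_object_E: "FA_object \<L> E"
proof
  show "partial_order_on (Fib E c) (Le E c)" if "c \<in> Ob E" for c
  proof -
    have c: "c \<in> Ob C" "mO F c \<in> Ob D" using that mO_Ob by (auto simp: E_simps(1))
    have "Le E c \<subseteq> Fib E c \<times> Fib E c" using Le_E_iff by auto
    moreover have "refl_on (Fib E c) (Le E c)"
      using D.Le_refl[OF c(2) mP_Fib[OF c(1) Fib_E_C]] by (auto simp: refl_on_def Le_E_iff)
    moreover have "trans (Le E c)"
      using D.Le_trans[OF c(2)] unfolding trans_def Le_E_iff by blast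
    \<comment> \<open>Antisymmetry in \<open>D\<close> gives equal images, and injectivity of
      \<open>F\<close> on representatives gives equal predicates.\<close>
    moreover have "antisym (Le E c)"
      using D.Le_antisym[OF c(2)] pr_E_eqI unfolding antisym_def Le_E_iff by blast
    ultimately show ?thesis by (simp add: partial_order_on_def preorder_on_def)
  qed
  show "Reix E f r \<in> Fib E a" if "f \<in> hom E a b" "r \<in> Fib E b" for f a b r
    using Reix_E_Fib that hom_E_C Fib_E_C by blast
  show "(Reix E f r, Reix E f s) \<in> Le E a" if "f \<in> hom E a b" "(r, s) \<in> Le E b" for f a b r s
    using that hom_E_C[of f a b] Fib_E_C[of _ b] Reix_E_Fib[of f a b] mP_Reix_E[of f a b]
      D.Reix_mono[OF mM_hom, of f a b] by (auto simp: Le_E_iff)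
  show "Reix E (Id E c) r = r" if "c \<in> Ob E" "r \<in> Fib E c" for c r
  proof (rule pr_E_eqI)
    have c: "c \<in> Ob C" using that(1) by (simp add: E_simps(1))
    note i = hom_E_C[OF Id_E_hom[OF c]]
    show "Reix E (Id E c) r \<in> Fib E c" "r \<in> Fib E c" using Reix_E_Fib[OF i Fib_E_C] that by auto
    show "mP F c (Reix E (Id E c) r) = mP F c r"
      using mP_Reix_E[OF i Fib_E_C[OF that(2)]] mM_Id_E[OF c] D.Reix_Id[OF mO_Ob mP_Fib, OF c c Fib_E_C[OF that(2)]]
      by simp
  qed
  show "Reix E (Comp E g f) r = Reix E f (Reix E g r)"
    if fE: "f \<in> hom E a b" and gE: "g \<in> hom E b c" and rE: "r \<in> Fib E c" for f g a b c r
  proof (rule pr_E_eqI)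
    note f = hom_E_C[OF fE] and g = hom_E_C[OF gE] and r = Fib_E_C[OF rE]
    note gf = hom_E_C[OF Comp_E_hom[OF fE gE]]
    note gr = Reix_E_Fib[OF g r]
    show "Reix E (Comp E g f) r \<in> Fib E a" by (rule Reix_E_Fib[OF gf r])
    show "Reix E f (Reix E g r) \<in> Fib E a" by (rule Reix_E_Fib[OF f Fib_E_C[OF gr]])
    show "mP F a (Reix E (Comp E g f) r) = mP F a (Reix E f (Reix E g r))"
      unfolding mP_Reix_E[OF gf r] mP_Reix_E[OF f Fib_E_C[OF gr]] mP_Reix_E[OF g r] mM_Comp_E[OF fE gE]
      by (rule D.Reix_Comp[OF mM_hom[OF f] mM_hom[OF g] mP_Fib[OF C.hom_Ob(2)[OF g] r]])
  qed
  show "Con E k c rs \<in> Fib E c"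
    if "k \<in> lconns \<L>" "c \<in> Ob E" "length rs = larity \<L> k" "set rs \<subseteq> Fib E c" for k c rs
    using that Fib_E_C by (intro Con_E_Fib) (auto simp: E_simps(1))
  show "Reix E f (Con E k b rs) = Con E k a (map (Reix E f) rs)"
    if k: "k \<in> lconns \<L>" and fE: "f \<in> hom E a b" and len: "length rs = larity \<L> k" and rsE: "set rs \<subseteq> Fib E b"
    for k f a b rs
  proof (rule pr_E_eqI)
    note f = hom_E_C[OF fE]
    note ob = C.hom_Ob[OF f]
    have rs: "set rs \<subseteq> Fib C b" using rsE Fib_E_C by blast
    have rs': "length (map (Reix E f) rs) = larity \<L> k" "set (map (Reix E f) rs) \<subseteq> Fib C a"
      using len rs Reix_E_Fib[OF f] Fib_E_C by auto
    have rs'': "length (map (mP F b) rs) = larity \<L> k" "set (map (mP F b) rs) \<subseteq> Fib D (mO F b)"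
      using len rs mP_Fib[OF ob(2)] by auto
    note c = Con_E_Fib[OF k ob(2) len rs]
    show "Reix E f (Con E k b rs) \<in> Fib E a" by (rule Reix_E_Fib[OF f Fib_E_C[OF c]])
    show "Con E k a (map (Reix E f) rs) \<in> Fib E a" by (rule Con_E_Fib[OF k ob(1) rs'])
    have "map (mP F a) (map (Reix E f) rs) = map (Reix D (mM F f)) (map (mP F b) rs)"
      using mP_Reix_E[OF f] rs by auto
    then show "mP F a (Reix E f (Con E k b rs)) = mP F a (Con E k a (map (Reix E f) rs))"
      unfolding mP_Reix_E[OF f Fib_E_C[OF c]] mP_Con_E[OF k ob(2) len rs] mP_Con_E[OF k ob(1) rs']
      using D.Reix_Con[OF k mM_hom[OF f] rs''] by metis
  qed
  show "tensor_at \<L> E c (tensor_at \<L> E c x y) z = tensor_at \<L> E c x (tensor_at \<L> E c y z)"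
    if "c \<in> Ob E" and xyz: "x \<in> Fib E c" "y \<in> Fib E c" "z \<in> Fib E c" for c x y z
  proof -
    have c: "c \<in> Ob C" using that(1) by (simp add: E_simps(1))
    show ?thesis
      using D.tensor_assoc[OF mO_Ob[OF c]] mP_Fib[OF c] Fib_E_C xyz
      by (intro pr_E_eqI[of _ c] tensor_E_Fib c) (auto simp: mP_tensor_E tensor_E_Fib c)
  qed
  show "tensor_at \<L> E c (unit_at \<L> E c) x = x" if "c \<in> Ob E" and x: "x \<in> Fib E c" for c x
  proof -
    have c: "c \<in> Ob C" using that(1) by (simp add: E_simps(1))
    show ?thesis
      using D.unit_left[OF mO_Ob[OF c]] mP_Fib[OF c] Fib_E_C x
      by (intro pr_E_eqI[of _ c] tensor_E_Fib unit_E_Fib c)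
        (auto simp: mP_tensor_E unit_E_Fib mP_unit_E c)
  qed
  show "tensor_at \<L> E c x (unit_at \<L> E c) = x" if "c \<in> Ob E" and x: "x \<in> Fib E c" for c x
  proof -
    have c: "c \<in> Ob C" using that(1) by (simp add: E_simps(1))
    show ?thesis
      using D.unit_right[OF mO_Ob[OF c]] mP_Fib[OF c] Fib_E_C x
      by (intro pr_E_eqI[of _ c] tensor_E_Fib unit_E_Fib c)
        (auto simp: mP_tensor_E unit_E_Fib mP_unit_E c)
  qed
  show "Qu E q b c r \<in> Fib E b"
    if "q \<in> lquants \<L>" "b \<in> Ob E" "c \<in> Ob E" "r \<in> Fib E (Prd E b c)" for q b c r
    using that Fib_E_C by (intro Qu_E_Fib) (auto simp: E_simps(1,3))
  show "Reix E f (Qu E q b c r) = Qu E q a c (Reix E (prd_id E f c) r)"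
    if q: "q \<in> lquants \<L>" and fE: "f \<in> hom E a b" and "c \<in> Ob E" and "r \<in> Fib E (Prd E b c)" for q f a b c r
  proof (rule pr_E_eqI)
    have c: "c \<in> Ob C" "c \<in> Ob E" and r: "r \<in> Fib C (Prd C b c)"
      using that(3,4) Fib_E_C by (auto simp: E_simps(1,3))
    note f = hom_E_C[OF fE]
    note ob = C.hom_Ob[OF f]
    note pE = hom_E_C[OF E.prd_id_hom[OF fE c(2), unfolded E_simps(3)]]
    note pC = C.prd_id_hom[OF f c(1)]
    note Q = Fib_E_C[OF Qu_E_Fib[OF q ob(2) c(1) r]]
    note R = Fib_E_C[OF Reix_E_Fib[OF pE r]]
    show "Reix E f (Qu E q b c r) \<in> Fib E a" by (rule Reix_E_Fib[OF f Q])
    show "Qu E q a c (Reix E (prd_id E f c) r) \<in> Fib E a" by (rule Qu_E_Fib[OF q ob(1) c(1) R])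
    have "mP F a (Reix E f (Qu E q b c r)) = mP F a (Reix C f (Qu C q b c r))"
      unfolding mP_Reix_E[OF f Q] mP_natural[OF f C.Qu_Fib[OF q ob(2) c(1) r]]
        mP_Qu[OF q ob(2) c(1) r] mP_Qu_E[OF q ob(2) c(1) r] ..
    also have "\<dots> = mP F a (Qu C q a c (Reix C (prd_id C f c) r))"
      using C.Qu_natural[OF q f c(1) r] by simp
    also have "\<dots> = mP F a (Qu E q a c (Reix E (prd_id E f c) r))"
      unfolding mP_Qu_E[OF q ob(1) c(1) R] mP_Qu[OF q ob(1) c(1) C.Reix_Fib[OF pC r]]
        mP_Reix_E[OF pE r] mP_natural[OF pC r] mM_prd_id_E[OF fE c(1)] ..
    finally show "mP F a (Reix E f (Qu E q b c r)) = mP F a (Qu E q a c (Reix E (prd_id E f c) r))" .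
  qed
  show "Qu E q b (One E) (Reix E (Pr1 E b (One E)) r) = r"
    if q: "q \<in> lquants \<L>" and "b \<in> Ob E" and rE: "r \<in> Fib E b" for q b r
    unfolding E_simps(2)
  proof (rule pr_E_eqI)
    have b: "b \<in> Ob C" using that(2) by (simp add: E_simps(1))
    note r = Fib_E_C[OF rE] and ob = b C.One_Ob
    note pE = hom_E_C[OF Pr_E_hom(1)[OF ob]] and pC = C.Pr1_hom[OF ob]
    note R = Fib_E_C[OF Reix_E_Fib[OF pE r]]
    show "Qu E q b (One C) (Reix E (Pr1 E b (One C)) r) \<in> Fib E b" by (rule Qu_E_Fib[OF q ob R])
    show "r \<in> Fib E b" by fact
    have "mP F b (Qu E q b (One C) (Reix E (Pr1 E b (One C)) r))
        = mP F b (Qu C q b (One C) (Reix C (Pr1 C b (One C)) r))"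
      unfolding mP_Qu_E[OF q ob R] mP_Qu[OF q ob C.Reix_Fib[OF pC r]]
        mP_Reix_E[OF pE r] mP_natural[OF pC r] mM_Pr_E[OF ob] ..
    then show "mP F b (Qu E q b (One C) (Reix E (Pr1 E b (One C)) r)) = mP F b r"
      using C.Qu_One[OF q b r] by simp
  qed
  show "Qu E q b (Prd E c d) (Reix E (assoc_arrow E b c d) r) = Qu E q b c (Qu E q (Prd E b c) d r)"
    if q: "q \<in> lquants \<L>" and "b \<in> Ob E" "c \<in> Ob E" "d \<in> Ob E" "r \<in> Fib E (Prd E (Prd E b c) d)"
    for q b c d r
    unfolding E_simps(3)
  proof (rule pr_E_eqI)
    have b: "b \<in> Ob C" and c: "c \<in> Ob C" and d: "d \<in> Ob C" and r: "r \<in> Fib C (Prd C (Prd C b c) d)"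
      using that(2-) Fib_E_C by (auto simp: E_simps(1,3))
    note cd = C.Prd_Ob[OF c d] and bc = C.Prd_Ob[OF b c]
    note aE = hom_E_C[OF E.assoc_arrow_hom[OF that(2-4), unfolded E_simps(3)]]
    note aC = C.assoc_arrow_hom[OF b c d]
    note R = Fib_E_C[OF Reix_E_Fib[OF aE r]] and Q = Fib_E_C[OF Qu_E_Fib[OF q bc d r]]
    show "Qu E q b (Prd C c d) (Reix E (assoc_arrow E b c d) r) \<in> Fib E b" by (rule Qu_E_Fib[OF q b cd R])
    show "Qu E q b c (Qu E q (Prd C b c) d r) \<in> Fib E b" by (rule Qu_E_Fib[OF q b c Q])
    have "mP F b (Qu E q b (Prd C c d) (Reix E (assoc_arrow E b c d) r))
        = mP F b (Qu C q b (Prd C c d) (Reix C (assoc_arrow C b c d) r))"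
      unfolding mP_Qu_E[OF q b cd R] mP_Qu[OF q b cd C.Reix_Fib[OF aC r]]
        mP_Reix_E[OF aE r] mP_natural[OF aC r] mM_assoc_arrow_E[OF b c d] ..
    also have "\<dots> = mP F b (Qu C q b c (Qu C q (Prd C b c) d r))"
      using C.Qu_Prd[OF q b c d r] by simp
    also have "\<dots> = mP F b (Qu E q b c (Qu E q (Prd C b c) d r))"
      unfolding mP_Qu_E[OF q b c Q] mP_Qu[OF q b c C.Qu_Fib[OF q bc d r]]
        mP_Qu_E[OF q bc d r] mP_Qu[OF q bc d r] ..
    finally show "mP F b (Qu E q b (Prd C c d) (Reix E (assoc_arrow E b c d) r))
        = mP F b (Qu E q b c (Qu E q (Prd C b c) d r))" .
  qed
  show "Equ E c \<in> Fib E (Prd E c c)" if "c \<in> Ob E" for c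
    using Equ_E_Fib that by (simp add: E_simps(1,3))
  show "Equ E (One E) = unit_at \<L> E (Prd E (One E) (One E))"
    using C.Equ_One by (simp add: E_simps)
  show "Equ E (Prd E c1 c2) =
        tensor_at \<L> E (Prd E (Prd E c1 c2) (Prd E c1 c2))
          (Reix E (pair E (Comp E (Pr1 E c1 c2) (Pr1 E (Prd E c1 c2) (Prd E c1 c2)))
                   (Comp E (Pr1 E c1 c2) (Pr2 E (Prd E c1 c2) (Prd E c1 c2)))) (Equ E c1))
          (Reix E (pair E (Comp E (Pr2 E c1 c2) (Pr1 E (Prd E c1 c2) (Prd E c1 c2)))
                   (Comp E (Pr2 E c1 c2) (Pr2 E (Prd E c1 c2) (Prd E c1 c2)))) (Equ E c2))"
    if "c1 \<in> Ob E" "c2 \<in> Ob E" for c1 c2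
    unfolding E_simps(3)
  proof (rule pr_E_eqI)
    have ob: "c1 \<in> Ob C" "c2 \<in> Ob C" using that by (auto simp: E_simps(1))
    let ?p = "Prd C c1 c2"
    note p = C.Prd_Ob[OF ob]
    note pp = C.Prd_Ob[OF p p]
    note pr = Pr_E_hom[OF ob] and pr' = C.Pr1_hom[OF ob] C.Pr2_hom[OF ob]
    note q = Pr_E_hom[OF p p] and q' = C.Pr1_hom[OF p p] C.Pr2_hom[OF p p]
    note f = Comp_E_hom[OF q(1) pr(1)] Comp_E_hom[OF q(2) pr(1)]
      and f' = C.Comp_hom[OF q'(1) pr'(1)] C.Comp_hom[OF q'(2) pr'(1)]
    note g = Comp_E_hom[OF q(1) pr(2)] Comp_E_hom[OF q(2) pr(2)]
      and g' = C.Comp_hom[OF q'(1) pr'(2)] C.Comp_hom[OF q'(2) pr'(2)]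
    note ff = hom_E_C[OF E.pair_hom[OF f, unfolded E_simps(3)]] and ff' = C.pair_hom[OF f']
    note gg = hom_E_C[OF E.pair_hom[OF g, unfolded E_simps(3)]] and gg' = C.pair_hom[OF g']
    note e = Fib_E_C[OF Equ_E_Fib[OF ob(1)]] Fib_E_C[OF Equ_E_Fib[OF ob(2)]]
      and e' = C.Equ_Fib[OF ob(1)] C.Equ_Fib[OF ob(2)]
    note R = Reix_E_Fib[OF ff e(1)] Reix_E_Fib[OF gg e(2)]
      and R' = C.Reix_Fib[OF ff' e'(1)] C.Reix_Fib[OF gg' e'(2)]
    show "Equ E ?p \<in> Fib E (Prd C ?p ?p)" by (rule Equ_E_Fib[OF p])
    show "tensor_at \<L> E (Prd C ?p ?p)
        (Reix E (pair E (Comp E (Pr1 E c1 c2) (Pr1 E ?p ?p)) (Comp E (Pr1 E c1 c2) (Pr2 E ?p ?p))) (Equ E c1))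
        (Reix E (pair E (Comp E (Pr2 E c1 c2) (Pr1 E ?p ?p)) (Comp E (Pr2 E c1 c2) (Pr2 E ?p ?p))) (Equ E c2))
      \<in> Fib E (Prd C ?p ?p)"
      by (rule tensor_E_Fib[OF pp R])
    have pairs:
      "mM F (pair E (Comp E (Pr1 E c1 c2) (Pr1 E ?p ?p)) (Comp E (Pr1 E c1 c2) (Pr2 E ?p ?p)))
        = mM F (pair C (Comp C (Pr1 C c1 c2) (Pr1 C ?p ?p)) (Comp C (Pr1 C c1 c2) (Pr2 C ?p ?p)))"
      "mM F (pair E (Comp E (Pr2 E c1 c2) (Pr1 E ?p ?p)) (Comp E (Pr2 E c1 c2) (Pr2 E ?p ?p)))
        = mM F (pair C (Comp C (Pr2 C c1 c2) (Pr1 C ?p ?p)) (Comp C (Pr2 C c1 c2) (Pr2 C ?p ?p)))"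
      unfolding mM_pair_E[OF f] mM_pair[OF f'] mM_pair_E[OF g] mM_pair[OF g']
        mM_Comp_E[OF q(1) pr(1)] mM_Comp_E[OF q(2) pr(1)] mM_Comp_E[OF q(1) pr(2)] mM_Comp_E[OF q(2) pr(2)]
        mM_Comp[OF q'(1) pr'(1)] mM_Comp[OF q'(2) pr'(1)] mM_Comp[OF q'(1) pr'(2)] mM_Comp[OF q'(2) pr'(2)]
        mM_Pr_E[OF ob] mM_Pr_E[OF p p] by (rule refl)+
    have tensor: "mP F (Prd C ?p ?p) (tensor_at \<L> C (Prd C ?p ?p) x y)
        = tensor_at \<L> D (mO F (Prd C ?p ?p)) (mP F (Prd C ?p ?p) x) (mP F (Prd C ?p ?p) y)"
      if "x \<in> Fib C (Prd C ?p ?p)" "y \<in> Fib C (Prd C ?p ?p)" for x y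
      using mP_Con[OF lconns(3) pp, of "[x, y]"] lconns(4) that by simp
    show "mP F (Prd C ?p ?p) (Equ E ?p) = mP F (Prd C ?p ?p) (tensor_at \<L> E (Prd C ?p ?p)
        (Reix E (pair E (Comp E (Pr1 E c1 c2) (Pr1 E ?p ?p)) (Comp E (Pr1 E c1 c2) (Pr2 E ?p ?p))) (Equ E c1))
        (Reix E (pair E (Comp E (Pr2 E c1 c2) (Pr1 E ?p ?p)) (Comp E (Pr2 E c1 c2) (Pr2 E ?p ?p))) (Equ E c2)))"
      unfolding mP_tensor_E[OF pp R] mP_Reix_E[OF ff e(1)] mP_Reix_E[OF gg e(2)] mP_Equ_E[OF ob(1)]
        mP_Equ_E[OF ob(2)] mP_Equ_E[OF p] pairs C.Equ_Prd[OF ob] tensor[OF R']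
        mP_natural[OF ff' e'(1)] mP_natural[OF gg' e'(2)] ..
  qed
qed

sublocale E: FA_object \<L> E by (rule FA_object_E)

section \<open>The projection onto the image and the embedding of the image\<close>

abbreviation \<epsilon> :: "('o1, 'm1, 'p1, 'o1, 'm1, 'p1) mor" where "\<epsilon> \<equiv> image_proj C F"

lemma \<epsilon>_simps:
  "c \<in> Ob C \<Longrightarrow> mO \<epsilon> c = c"
  "f \<in> hom C a b \<Longrightarrow> mM \<epsilon> f = \<rho> f"
  "c \<in> Ob C \<Longrightarrow> r \<in> Fib C c \<Longrightarrow> mP \<epsilon> c r = \<pi> c r"
  by (auto simp: image_proj_def hom_def)

lemma \<epsilon>_hom: "f \<in> hom C a b \<Longrightarrow> mM \<epsilon> f \<in> hom E (mO \<epsilon> a) (mO \<epsilon> b)"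
  using C.hom_Ob[of f a b] by (simp add: \<epsilon>_simps \<rho>_hom_E)

lemma \<epsilon>_Id: "a \<in> Ob C \<Longrightarrow> mM \<epsilon> (Id C a) = Id E (mO \<epsilon> a)"
  using \<epsilon>_simps(2)[OF C.Id_hom] by (simp add: \<epsilon>_simps(1) E_simps(4))

lemma \<epsilon>_Comp:
  assumes "f \<in> hom C a b" "g \<in> hom C b c"
  shows "mM \<epsilon> (Comp C g f) = Comp E (mM \<epsilon> g) (mM \<epsilon> f)"
  unfolding \<epsilon>_simps(2)[OF C.Comp_hom[OF assms]] \<epsilon>_simps(2)[OF assms(1)] \<epsilon>_simps(2)[OF assms(2)] E_simps(5)
  by (rule \<rho>_cong[OF C.Comp_hom[OF assms] C.Comp_hom[OF \<rho>_hom[OF assms(1)] \<rho>_hom[OF assms(2)]]])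
    (simp add: mM_Comp[OF assms] mM_Comp[OF \<rho>_hom[OF assms(1)] \<rho>_hom[OF assms(2)]] mM_\<rho>[OF assms(1)] mM_\<rho>[OF assms(2)])

lemma \<epsilon>_functor: "fp_functor_data C E (mO \<epsilon>) (mM \<epsilon>)"
  by unfold_locales (auto intro: \<epsilon>_hom \<epsilon>_Id \<epsilon>_Comp)

text \<open>The projection carries the designated cones of \<open>C\<close> to those of
  \<open>E\<close> on the nose, so its canonical morphisms are pairings of designated projections,
  that is, identities.\<close>

lemma canon_\<epsilon>:
  assumes "a \<in> Ob C" "b \<in> Ob C"
  shows "canon C E \<epsilon> a b = Id E (Prd C a b)" "inverse_arrow E (canon C E \<epsilon> a b) = Id E (Prd C a b)"
proof -
  have E: "a \<in> Ob E" "b \<in> Ob E" using assms by (auto simp: E_simps(1))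
  show "canon C E \<epsilon> a b = Id E (Prd C a b)"
    using E.pair_Pr[OF E] \<epsilon>_simps(2) C.Pr1_hom[OF assms] C.Pr2_hom[OF assms]
    unfolding canon_def E_simps(3) by (metis E_simps(6,7))
  moreover have i: "Id E (Prd C a b) \<in> hom E (Prd C a b) (Prd C a b)"
    using Id_E_hom[OF C.Prd_Ob[OF assms]] .
  moreover have "inverse_arrow E (Id E (Prd C a b)) = Id E (Prd C a b)"
    by (rule E.inverse_arrow_eqI[OF i i]) (rule E.Id_right[OF i])+
  ultimately show "inverse_arrow E (canon C E \<epsilon> a b) = Id E (Prd C a b)" by simp
qed

lemma \<epsilon>_morphism: "FA_morphism \<L> C E \<epsilon>"
proof
  interpret \<epsilon>: fp_functor_data C E "mO \<epsilon>" "mM \<epsilon>" by (rule \<epsilon>_functor)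
  show "mO \<epsilon> \<in> Ob C \<rightarrow>\<^sub>E Ob E" by (auto simp: image_proj_def E_simps(1))
  show "mM \<epsilon> \<in> Ar C \<rightarrow>\<^sub>E Ar E" by (auto simp: image_proj_def image_object_def)
  show "mP \<epsilon> \<in> (\<Pi>\<^sub>E c\<in>Ob C. Fib C c \<rightarrow>\<^sub>E Fib E (mO \<epsilon> c))"
    by (auto simp: image_proj_def E_simps(8) PiE_iff)
  show "mM \<epsilon> f \<in> hom E (mO \<epsilon> a) (mO \<epsilon> b)" if "f \<in> hom C a b" for f a b
    using that by (rule \<epsilon>_hom)
  show "mM \<epsilon> (Id C a) = Id E (mO \<epsilon> a)" if "a \<in> Ob C" for a
    using that by (rule \<epsilon>_Id)
  show "mM \<epsilon> (Comp C g f) = Comp E (mM \<epsilon> g) (mM \<epsilon> f)" if "f \<in> hom C a b" "g \<in> hom C b c" for f g a b c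
    using that by (rule \<epsilon>_Comp)
  show "is_terminal E (mO \<epsilon> t)" if "is_terminal C t" for t
    using E.One_terminal C.One_Ob
    by (intro \<epsilon>.terminal_transfer[OF C.One_terminal that]) (simp add: E_simps(2) \<epsilon>_simps(1))
  show "is_product E (mO \<epsilon> a) (mO \<epsilon> b) (mO \<epsilon> p) (mM \<epsilon> p1) (mM \<epsilon> p2)" if "is_product C a b p p1 p2"
    for a b p p1 p2
  proof -
    have ob: "a \<in> Ob C" "b \<in> Ob C" using that by (auto simp: is_product_def)
    \<comment> \<open>The designated cone of \<open>C\<close> is sent to the designated cone of
      \<open>E\<close>; every other product cone on \<open>a\<close> and \<open>b\<close> follows by
      \<open>product_transfer\<close>.\<close>
    have "is_product E a b (Prd C a b) (\<rho> (Pr1 C a b)) (\<rho> (Pr2 C a b))"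
      using E.Prd_product[of a b] ob unfolding E_simps by simp
    then show ?thesis
      using \<epsilon>_simps(1)[OF ob(1)] \<epsilon>_simps(1)[OF ob(2)] \<epsilon>_simps(1)[OF C.Prd_Ob[OF ob]]
        \<epsilon>_simps(2)[OF C.Pr1_hom[OF ob]] \<epsilon>_simps(2)[OF C.Pr2_hom[OF ob]]
      by (intro \<epsilon>.product_transfer[OF C.Prd_product[OF ob] that]) simp
  qed
  show "(mP \<epsilon> c r, mP \<epsilon> c s) \<in> Le E (mO \<epsilon> c)" if c: "c \<in> Ob C" and le: "(r, s) \<in> Le C c" for c r s
    using mP_mono[OF c le] C.Le_Fib[OF c le] c by (auto simp: \<epsilon>_simps Le_E_iff \<pi>_Fib_E mP_\<pi>)
  show "mP \<epsilon> a (Reix C f r) = Reix E (mM \<epsilon> f) (mP \<epsilon> b r)" if f: "f \<in> hom C a b" and r: "r \<in> Fib C b" for f a b r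
    unfolding \<epsilon>_simps(2)[OF f] \<epsilon>_simps(3)[OF C.hom_Ob(2)[OF f] r] E_simps(9)
      \<epsilon>_simps(3)[OF C.hom_Ob(1)[OF f] C.Reix_Fib[OF f r]] homD[OF \<rho>_hom[OF f]]
    by (rule \<pi>_cong)
      (simp add: mP_natural[OF f r] mP_natural[OF \<rho>_hom[OF f] \<pi>_Fib_C[OF r]] mM_\<rho>[OF f] mP_\<pi>[OF r])
  show "mP \<epsilon> c (Con C k c rs) = Con E k (mO \<epsilon> c) (map (mP \<epsilon> c) rs)"
    if k: "k \<in> lconns \<L>" and c: "c \<in> Ob C" and len: "length rs = larity \<L> k" and rs: "set rs \<subseteq> Fib C c" for k c rs
  proof -
    have rs': "length (map (mP \<epsilon> c) rs) = larity \<L> k" "set (map (mP \<epsilon> c) rs) \<subseteq> Fib C c"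
      using len rs c \<pi>_Fib_C by (auto simp: \<epsilon>_simps(3) subset_iff)
    have "map (mP F c) (map (mP \<epsilon> c) rs) = map (mP F c) rs"
      using rs c mP_\<pi> by (auto simp: \<epsilon>_simps(3) subset_iff)
    then show ?thesis
      unfolding \<epsilon>_simps(1)[OF c] \<epsilon>_simps(3)[OF c C.Con_Fib[OF k c len rs]] E_simps(10)
      using mP_Con[OF k c len rs] mP_Con[OF k c rs'] by (intro \<pi>_cong) metis
  qed
  show "mP \<epsilon> b (Qu C q b c r) =
      Qu E q (mO \<epsilon> b) (mO \<epsilon> c) (Reix E (inverse_arrow E (canon C E \<epsilon> b c)) (mP \<epsilon> (Prd C b c) r))"
    if q: "q \<in> lquants \<L>" and b: "b \<in> Ob C" and c: "c \<in> Ob C" and r: "r \<in> Fib C (Prd C b c)" for q b c r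
  proof -
    have p: "Prd C b c \<in> Ob E" using C.Prd_Ob[OF b c] by (simp add: E_simps(1))
    show ?thesis
      unfolding \<epsilon>_simps(1)[OF b] \<epsilon>_simps(1)[OF c] \<epsilon>_simps(3)[OF b C.Qu_Fib[OF q b c r]]
        \<epsilon>_simps(3)[OF C.Prd_Ob[OF b c] r] canon_\<epsilon>(2)[OF b c] E.Reix_Id[OF p \<pi>_Fib_E[OF r]] E_simps(11)
      by (rule \<pi>_cong) (simp add: mP_Qu[OF q b c r] mP_Qu[OF q b c \<pi>_Fib_C[OF r]] mP_\<pi>[OF r])
  qed
  show "mP \<epsilon> (Prd C c c) (Equ C c) = Reix E (canon C E \<epsilon> c c) (Equ E (mO \<epsilon> c))" if c: "c \<in> Ob C" for c
  proof -
    have p: "Prd C c c \<in> Ob E" using C.Prd_Ob[OF c c] by (simp add: E_simps(1))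
    show ?thesis
      using canon_\<epsilon>(1)[OF c c] E.Reix_Id[OF p Equ_E_Fib[OF c]]
        \<epsilon>_simps(3)[OF C.Prd_Ob[OF c c] C.Equ_Fib[OF c]] \<epsilon>_simps(1)[OF c] E_simps(12) by metis
  qed
qed

lemma \<epsilon>_full: "full_functor C E \<epsilon>"
  unfolding full_functor_def
proof (intro ballI subset_antisym subsetI)
  fix a b g assume ab: "a \<in> Ob C" "b \<in> Ob C"
  show "g \<in> hom E (mO \<epsilon> a) (mO \<epsilon> b)" if "g \<in> mM \<epsilon> ` hom C a b"
    using that \<epsilon>_hom by blast
  assume "g \<in> hom E (mO \<epsilon> a) (mO \<epsilon> b)"
  then have "g \<in> hom C a b" "\<rho> g = g" using ab by (auto simp: \<epsilon>_simps(1) hom_E_iff)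
  then show "g \<in> mM \<epsilon> ` hom C a b" using \<epsilon>_simps(2) by (metis imageI)
qed

lemma \<epsilon>_bij: "bij_betw (mO \<epsilon>) (Ob C) (Ob E)"
  by (auto simp: bij_betw_def inj_on_def \<epsilon>_simps(1) E_simps(1))

lemma \<epsilon>_pred_surjective: "pred_surjective C E \<epsilon>"
  by (simp add: pred_surjective_def \<epsilon>_simps E_simps(8))

text \<open>Passing to a representative does not change the image under \<open>F\<close>, and the
  order of \<open>E\<close> is pulled back along \<open>F\<close>; so the projection relates only
  what \<open>F\<close> relates.\<close>

lemma kernel_\<epsilon>_le: "kernel_le (mor_kernel C E \<epsilon>) (mor_kernel C D F)"
proof -
  have "mM F f = mM F g" if "f \<in> Ar C" "g \<in> Ar C" "mM \<epsilon> f = mM \<epsilon> g" for f g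
    using that \<epsilon>_simps(2) mM_\<rho> homI by metis
  then show ?thesis
    by (auto simp: kernel_le_def mor_kernel_def \<epsilon>_simps Le_E_iff mP_\<pi>)
qed

sublocale L: FA_lift \<L> C E D \<epsilon> F
proof (intro FA_lift.intro FA_surjection.intro FA_functor.intro FA_surjection_axioms.intro FA_lift_axioms.intro)
  show "mO \<epsilon> ` Ob C = Ob E" using \<epsilon>_bij by (simp add: bij_betw_def)
qed (fact C.FA_object_axioms D.FA_object_axioms FA_object_E \<epsilon>_morphism FA_morphism_axioms
    \<epsilon>_full \<epsilon>_pred_surjective kernel_\<epsilon>_le)+

text \<open>An arrow of \<open>E\<close> is its own image under the projection, so the lift agrees
  with \<open>F\<close> on it, and \<open>F\<close> is injective on the hom-sets of
  \<open>E\<close>.\<close>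

lemma lift_faithful: "faithful_functor E L.H"
proof -
  have "mM L.H f = mM F f" if "f \<in> hom E a b" for f a b
    using that L.mM_lift[OF homD(1)] \<epsilon>_simps(2) unfolding hom_E_iff by metis
  then show ?thesis unfolding faithful_functor_def inj_on_def using ar_E_eqI by metis
qed

lemma lift_order_embedding: "pred_order_embedding E D L.H"
proof -
  have "mP L.H c r = mP F c r" "mO L.H c = mO F c" if "c \<in> Ob C" "r \<in> Fib E c" for c r
    using that L.mP_lift[of c r] L.mO_lift[of c] by (auto simp: \<epsilon>_simps Fib_E_iff)
  then show ?thesis by (simp add: pred_order_embedding_def Le_E_iff E_simps(1))
qed

end

theorem mainTheorem12:
  fixes \<L> :: "('q, 'k) lang"
    and Lg :: "('s, 'f, 'r, 'q, 'k) logic"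
    and C :: "('o1, 'm1, 'p1, 'q, 'k) propcat"
    and D :: "('o2, 'm2, 'p2, 'q, 'k) propcat"
    and F :: "('o1, 'm1, 'p1, 'o2, 'm2, 'p2) mor"
  assumes "logic \<L> Lg"
    and "FA_logic_morphism \<L> Lg C D F"
  shows
    "(\<exists>(E :: ('o1, 'm1, 'p1, 'q, 'k) propcat) \<epsilon> \<psi>.
        \<epsilon> \<in> class_E \<L> Lg C E \<and> \<psi> \<in> class_M \<L> Lg E D \<and> F = mor_comp C \<psi> \<epsilon>)
     \<and>
     (\<forall>(E :: ('o3, 'm3, 'p3, 'q, 'k) propcat) K.
        FA_logic_morphism \<L> Lg C E K \<and> full_functor C E K \<and> mO K ` Ob C = Ob E \<and>
        pred_surjective C E K \<longrightarrow>
        ((\<exists>!H. FA_logic_morphism \<L> Lg E D H \<and> mor_comp C H K = F)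
           \<longleftrightarrow> kernel_le (mor_kernel C E K) (mor_kernel C D F)))"
proof (intro conjI allI impI)
  have lang: "language \<L>" using assms(1) by (rule logic.language)
  interpret F: FA_functor \<L> C D F by (rule FA_logic_morphism_functor[OF assms(2)])
  interpret FA_image \<L> C D F by unfold_locales (rule lang)
  interpret \<psi>: FA_functor \<L> "image_object C D F" D L.H
    by (intro FA_functor.intro FA_object_E F.D.FA_object_axioms L.lift_morphism)
  have obj: "FA_logic_object \<L> Lg C" "FA_logic_object \<L> Lg D"
    using assms(2) by (auto simp: FA_logic_morphism_def)
  \<comment> \<open>So far both factors are morphisms of \<open>FA\<close> only; they belong to
    \<open>FA\<close> restricted to the logic once the image validates \<open>Lg\<close>.\<close>
  have E: "FA_logic_object \<L> Lg (image_object C D F)"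
    by (rule \<psi>.FA_logic_object_reflect[OF lang lift_faithful lift_order_embedding obj(2)])
  have "image_proj C F \<in> class_E \<L> Lg C (image_object C D F)"
    using obj E \<epsilon>_morphism \<epsilon>_bij \<epsilon>_full \<epsilon>_pred_surjective
    by (simp add: class_E_def FA_logic_morphism_def)
  moreover have "L.H \<in> class_M \<L> Lg (image_object C D F) D"
    using obj E L.lift_morphism lift_faithful lift_order_embedding
    by (simp add: class_M_def FA_logic_morphism_def)
  ultimately show "\<exists>(E :: ('o1, 'm1, 'p1, 'q, 'k) propcat) \<epsilon> \<psi>.
      \<epsilon> \<in> class_E \<L> Lg C E \<and> \<psi> \<in> class_M \<L> Lg E D \<and> F = mor_comp C \<psi> \<epsilon>"
    using L.lift_comp by metis
next
  fix E :: "('o3, 'm3, 'p3, 'q, 'k) propcat" and K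
  assume K: "FA_logic_morphism \<L> Lg C E K \<and> full_functor C E K \<and> mO K ` Ob C = Ob E \<and>
    pred_surjective C E K"
  then interpret FA_surjection \<L> C E K
    by (intro FA_surjection.intro FA_logic_morphism_functor FA_surjection_axioms.intro) auto
  \<comment> \<open>The objects validating the logic span a full subcategory, and \<open>E\<close>
    and \<open>D\<close> belong to it, so it suffices to factor in \<open>FA\<close>.\<close>
  have "FA_logic_morphism \<L> Lg E D H \<longleftrightarrow> FA_morphism \<L> E D H" for H
    using K assms(2) by (simp add: FA_logic_morphism_def)
  then show "(\<exists>!H. FA_logic_morphism \<L> Lg E D H \<and> mor_comp C H K = F)
      \<longleftrightarrow> kernel_le (mor_kernel C E K) (mor_kernel C D F)"
    using factorization_iff[OF FA_logic_morphism_functor[OF assms(2)]] by simp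
qed

end
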